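(* Let $\{J^kg\}_{k\in\mathbb N_0}$ be a block diagonal Carleson frame with $\sigma_p(J)=\{z_j\}_{j\in\mathbb N_0}\subset[0,1)$ a Carleson sequence. Suppose $\Lambda=\{\lambda_k\}_{k=0}^\infty\subset[0,\infty)$ is a strictly increasing sequence such that the limit $$\lim_{x\to\infty}\frac{N_\Lambda(x)}{x}=L$$ exists in $[0,\infty]$, where $N_\Lambda(x)=|\{k:\lambda_k\le x\}|$. (i) If $J$ is invertible, then $\{J^{\lambda_k}g\}_{k\in\mathbb N_0}$ is a frame for $\ell^2(\mathbb N_0)$ if and only if $0<L<\infty$. (ii) If $0\in\sigma_p(J)$, then $\{J^{\lambda_k}g\}_{k\in\mathbb N_0}$ is a frame for $\ell^2(\mathbb N_0)$ if and only if $0<L<\infty$ and $\lambda_j=j$ for all $0\le j\le n_0-1$, where $n_0$ is the algebraic multiplicity of $0$ as an eigenvalue of $J$.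
   Context: $\mathbb N_0=\{0,1,2,\dots\}$ and $\mathbb D$ is the open unit disc. Let $(n_i)_{i\ge0}$ be positive integers with $\sup_i n_i<\infty$ and $(z_i)_{i\ge0}\subset\mathbb D$. For each $i$, $V_i\cong\mathbb C^{n_i}$ has orthonormal basis $\{\delta_{i,j}\}_{j=0}^{n_i-1}$, and $\ell^2(\mathbb N_0)$ is identified with the orthogonal direct sum $\bigoplus_iV_i$. $J_{n_i}(z_i)$ is the operator on $V_i$ with $J_{n_i}(z_i)\delta_{i,j}=z_i\delta_{i,j}+(1-|z_i|^2)\delta_{i,j+1}$ for $0\le j<n_i-1$ and $J_{n_i}(z_i)\delta_{i,n_i-1}=z_i\delta_{i,n_i-1}$. A block diagonal Carleson frame is a frame for $\ell^2(\mathbb N_0)$ of the form $\{J^kg\}_{k=0}^\infty$, where $J=\bigoplus_iJ_{n_i}(z_i)$ and $g\in\ell^2(\mathbb N_0)$; $\sigma_p(J)$ denotes the point spectrum. A sequence $\{z_i\}_{i\ge0}\subset\mathbb D$ is a Carleson sequence if $\inf_k\prod_{j\ne k}\left|\frac{z_j-z_k}{1-\overline{z_j}z_k}\right|>0$. A sequence $\{f_k\}$ in a Hilbert space $H$ is a frame for $H$ if there are $B\ge A>0$ with $A\|h\|^2\le\sum_k|\langle h,f_k\rangle|^2\le B\|h\|^2$ for all $h\in H$. Noninteger powers: $J^\lambda=\bigoplus_iJ_{n_i}^\lambda(z_i)$, where $J_n^\lambda(z)=\sum_{j=0}^{n-1}\binom{\lambda}{j}z^{\lambda-j}(1-|z|^2)^jM_n^j$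 for $z\neq 0$, with $M_n$ the $n\times n$ matrix having ones on the subdiagonal and zeros elsewhere, $z^\lambda$ the principal branch, $\binom{\lambda}{j}=\lambda(\lambda-1)\cdots(\lambda-j+1)/j!$, $\binom\lambda0=1$; for $z=0$ the same formula is used when $\operatorname{Re}\lambda>n-1$ (giving $J_n^\lambda(0)=0$), $J_n^\lambda(0)$ is the ordinary power for $\lambda\in\mathbb N_0$, and $J_n^\lambda(0)$ is undefined for noninteger real $\lambda\in[0,n-1]$; being a frame includes that all the vectors $J^{\lambda_k}g$ are well defined. *)

theory Defs
  imports "HOL-Analysis.Analysis" "HOL-Library.Function_Algebras"
begin

definition l2 :: "(nat \<Rightarrow> complex) set" where
  "l2 = {x. summable (\<lambda>m. (cmod (x m))\<^sup>2)}"

definition l2_inner :: "(nat \<Rightarrow> complex) \<Rightarrow> (nat \<Rightarrow> complex) \<Rightarrow> complex" where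
  "l2_inner x y = (\<Sum>m. x m * cnj (y m))"

definition l2_norm :: "(nat \<Rightarrow> complex) \<Rightarrow> real" where
  "l2_norm x = sqrt (\<Sum>m. (cmod (x m))\<^sup>2)"

definition cscale :: "complex \<Rightarrow> (nat \<Rightarrow> complex) \<Rightarrow> (nat \<Rightarrow> complex)" where
  "cscale c x = (\<lambda>m. c * x m)"

definition l2_frame :: "(nat \<Rightarrow> nat \<Rightarrow> complex) \<Rightarrow> bool" where
  "l2_frame f \<longleftrightarrow> (\<forall>k. f k \<in> l2) \<and>
     (\<exists>A B. 0 < A \<and> A \<le> B \<and>
       (\<forall>h\<in>l2. summable (\<lambda>k. (cmod (l2_inner h (f k)))\<^sup>2) \<and>
          A * (l2_norm h)\<^sup>2 \<le> (\<Sum>k. (cmod (l2_inner h (f k)))\<^sup>2) \<and>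
          (\<Sum>k. (cmod (l2_inner h (f k)))\<^sup>2) \<le> B * (l2_norm h)\<^sup>2))"

text \<open>Operators are total functions on sequences; only their restriction to \<^const>\<open>l2\<close> matters.\<close>

definition l2_bounded_operator :: "((nat \<Rightarrow> complex) \<Rightarrow> nat \<Rightarrow> complex) \<Rightarrow> bool" where
  "l2_bounded_operator T \<longleftrightarrow>
     (\<forall>x\<in>l2. T x \<in> l2) \<and>
     (\<forall>x\<in>l2. \<forall>y\<in>l2. T (x + y) = T x + T y) \<and>
     (\<forall>c. \<forall>x\<in>l2. T (cscale c x) = cscale c (T x)) \<and>
     (\<exists>K. \<forall>x\<in>l2. l2_norm (T x) \<le> K * l2_norm x)"

definition l2_invertible :: "((nat \<Rightarrow> complex) \<Rightarrow> nat \<Rightarrow> complex) \<Rightarrow> bool" where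
  "l2_invertible T \<longleftrightarrow> l2_bounded_operator T \<and>
     (\<exists>S. l2_bounded_operator S \<and> (\<forall>x\<in>l2. S (T x) = x \<and> T (S x) = x))"

definition point_spectrum :: "((nat \<Rightarrow> complex) \<Rightarrow> nat \<Rightarrow> complex) \<Rightarrow> complex set" where
  "point_spectrum T = {\<mu>. \<exists>x\<in>l2. x \<noteq> 0 \<and> T x = cscale \<mu> x}"

text \<open>\<^const>\<open>vector_space.dim\<close> is 0 if the space of generalized eigenvectors is
  infinite-dimensional; this does not happen for the operators considered here.\<close>

definition algebraic_multiplicity ::
    "((nat \<Rightarrow> complex) \<Rightarrow> nat \<Rightarrow> complex) \<Rightarrow> complex \<Rightarrow> nat" where
  "algebraic_multiplicity T \<mu> =
     vector_space.dim cscale {x\<in>l2. \<exists>k. ((\<lambda>y. T y - cscale \<mu> y) ^^ k) x = 0}"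

text \<open>A vector of the \<open>n\<close>-dimensional space $V$ is the function of its coordinates at the
  indices below \<open>n\<close>; the values at other indices are irrelevant.
  \<open>subdiag n\<close> is multiplication by the matrix $M_n$ with ones on the subdiagonal.\<close>

definition subdiag :: "nat \<Rightarrow> (nat \<Rightarrow> complex) \<Rightarrow> nat \<Rightarrow> complex" where
  "subdiag n v = (\<lambda>a. if 0 < a \<and> a < n then v (a - 1) else 0)"

definition Jblock :: "nat \<Rightarrow> complex \<Rightarrow> (nat \<Rightarrow> complex) \<Rightarrow> nat \<Rightarrow> complex" where
  "Jblock n w v = (\<lambda>a. w * v a + of_real (1 - (cmod w)\<^sup>2) * subdiag n v a)"

definition Jblock_power_defined :: "nat \<Rightarrow> complex \<Rightarrow> real \<Rightarrow> bool" where
  "Jblock_power_defined n w t \<longleftrightarrow> w \<noteq> 0 \<or> t \<in> \<nat> \<or> real n - 1 < t"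

text \<open>If \<open>w = 0\<close> and \<open>t\<close> is not a natural number, the sum below is 0
  because \<open>0 powr s = 0\<close>; this is the intended value if \<open>t > n - 1\<close>, and a dummy value
  otherwise.\<close>

definition Jblock_power :: "nat \<Rightarrow> complex \<Rightarrow> real \<Rightarrow> (nat \<Rightarrow> complex) \<Rightarrow> nat \<Rightarrow> complex" where
  "Jblock_power n w t v =
     (if w = 0 \<and> t \<in> \<nat> then (Jblock n 0 ^^ nat \<lfloor>t\<rfloor>) v
      else (\<lambda>a. \<Sum>j<n. of_real (t gchoose j) * w powr of_real (t - real j)
                      * of_real ((1 - (cmod w)\<^sup>2) ^ j) * (subdiag n ^^ j) v a))"

text \<open>The space \<^const>\<open>l2\<close> is split into consecutive blocks $V_0, V_1, \ldots$ of
  dimensions \<open>n 0, n 1, \<dots>\<close>: the basis vector $\delta_{i,j}$ is the standard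
  basis vector with index \<open>block_start n i + j\<close>.\<close>

definition block_start :: "(nat \<Rightarrow> nat) \<Rightarrow> nat \<Rightarrow> nat" where
  "block_start n i = (\<Sum>l<i. n l)"

definition block_of :: "(nat \<Rightarrow> nat) \<Rightarrow> nat \<Rightarrow> nat" where
  "block_of n m = (LEAST i. m < block_start n (Suc i))"

definition block_component :: "(nat \<Rightarrow> nat) \<Rightarrow> (nat \<Rightarrow> complex) \<Rightarrow> nat \<Rightarrow> nat \<Rightarrow> complex" where
  "block_component n x i = (\<lambda>a. if a < n i then x (block_start n i + a) else 0)"

definition block_sum ::
    "(nat \<Rightarrow> nat) \<Rightarrow> (nat \<Rightarrow> (nat \<Rightarrow> complex) \<Rightarrow> nat \<Rightarrow> complex) \<Rightarrow>
     (nat \<Rightarrow> complex) \<Rightarrow> nat \<Rightarrow> complex" where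
  "block_sum n T x = (\<lambda>m. let i = block_of n m
                           in T i (block_component n x i) (m - block_start n i))"

definition Jop :: "(nat \<Rightarrow> nat) \<Rightarrow> (nat \<Rightarrow> complex) \<Rightarrow> (nat \<Rightarrow> complex) \<Rightarrow> nat \<Rightarrow> complex" where
  "Jop n z = block_sum n (\<lambda>i. Jblock (n i) (z i))"

definition Jpower ::
    "(nat \<Rightarrow> nat) \<Rightarrow> (nat \<Rightarrow> complex) \<Rightarrow> real \<Rightarrow> (nat \<Rightarrow> complex) \<Rightarrow> nat \<Rightarrow> complex" where
  "Jpower n z t = block_sum n (\<lambda>i. Jblock_power (n i) (z i) t)"

definition block_diagonal_Carleson_frame ::
    "(nat \<Rightarrow> nat) \<Rightarrow> (nat \<Rightarrow> complex) \<Rightarrow> (nat \<Rightarrow> complex) \<Rightarrow> bool" where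
  "block_diagonal_Carleson_frame n z g \<longleftrightarrow>
     (\<forall>i. 0 < n i) \<and> bdd_above (range n) \<and> (\<forall>i. cmod (z i) < 1) \<and>
     g \<in> l2 \<and> l2_frame (\<lambda>k. (Jop n z ^^ k) g)"

definition real_powers_frame ::
    "(nat \<Rightarrow> nat) \<Rightarrow> (nat \<Rightarrow> complex) \<Rightarrow> (nat \<Rightarrow> complex) \<Rightarrow> (nat \<Rightarrow> real) \<Rightarrow> bool" where
  "real_powers_frame n z g \<Lambda> \<longleftrightarrow>
     (\<forall>k i. Jblock_power_defined (n i) (z i) (\<Lambda> k)) \<and> l2_frame (\<lambda>k. Jpower n z (\<Lambda> k) g)"

text \<open>The infinite product is the limit of its partial products, which are decreasing, so that it
  may be 0 (whereas \<^const>\<open>prodinf\<close> is unspecified for products diverging to 0).\<close>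

definition Carleson_sequence :: "(nat \<Rightarrow> complex) \<Rightarrow> bool" where
  "Carleson_sequence z \<longleftrightarrow> (\<forall>i. cmod (z i) < 1) \<and>
     0 < (INF k. lim (\<lambda>N. \<Prod>j\<in>{..<N} - {k}. cmod ((z j - z k) / (1 - cnj (z j) * z k))))"

text \<open>The value is \<open>\<infinity>\<close> if infinitely many terms are at most \<open>x\<close>.\<close>

definition counting_function :: "(nat \<Rightarrow> real) \<Rightarrow> real \<Rightarrow> ennreal" where
  "counting_function \<Lambda> x = emeasure (count_space UNIV) {k. \<Lambda> k \<le> x}"

lemma block_of_eq:
  assumes "j < n i"
  shows "block_of n (block_start n i + j) = i"
  unfolding block_of_def
proof (rule Least_equality)
  show "block_start n i + j < block_start n (Suc i)"
    using assms by (simp add: block_start_def)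
next
  fix i' assume *: "block_start n i + j < block_start n (Suc i')"
  show "i \<le> i'"
  proof (rule ccontr)
    assume "\<not> i \<le> i'"
    then have "block_start n (Suc i') \<le> block_start n i"
      unfolding block_start_def by (intro sum_mono2) auto
    with * show False by simp
  qed
qed

lemma block_exhaust:
  assumes "\<And>i. 0 < n i"
  obtains i j where "j < n i" "m = block_start n i + j"
proof -
  have "\<exists>i j. j < n i \<and> m = block_start n i + j"
  proof (induction m)
    case 0
    show ?case using assms by (intro exI[of _ 0]) (auto simp: block_start_def)
  next
    case (Suc m)
    then obtain i j where ij: "j < n i" "m = block_start n i + j" by blast
    show ?case
    proof (cases "Suc j < n i")
      case True
      then show ?thesis using ij by (intro exI[of _ i] exI[of _ "Suc j"]) auto
    next
      case False
      then show ?thesis using ij assms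
        by (intro exI[of _ "Suc i"] exI[of _ 0]) (auto simp: block_start_def)
    qed
  qed
  then show ?thesis using that by blast
qed

definition delta :: "(nat \<Rightarrow> nat) \<Rightarrow> nat \<Rightarrow> nat \<Rightarrow> nat \<Rightarrow> complex" where
  "delta n i j = (\<lambda>m. if m = block_start n i + j then 1 else 0)"

lemma block_component_delta:
  assumes "j < n i"
  shows "block_component n (delta n i j) i' a = (if i' = i \<and> a = j then 1 else 0)"
  using assms block_of_eq[of j n i] block_of_eq[of a n i']
  by (auto simp: block_component_def delta_def)

lemma Jop_delta:
  assumes pos: "\<And>i. 0 < n i" and j: "j < n i"
  shows "Jop n z (delta n i j) =
    cscale (z i) (delta n i j) +
    (if j < n i - 1 then cscale (of_real (1 - (cmod (z i))\<^sup>2)) (delta n i (j + 1)) else 0)"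
    (is "?l = ?r")
proof
  fix m
  obtain i' a where a: "a < n i'" "m = block_start n i' + a"
    using block_exhaust[of n m] pos by blast
  have eq: "delta n i b m = (if i' = i \<and> a = b then 1 else 0)" if "b < n i" for b
    using that a block_of_eq[of b n i] block_of_eq[of a n i'] by (auto simp: delta_def)
  show "?l m = ?r m"
    using a j eq[of j] eq[of "j + 1"]
    by (auto simp: Jop_def block_sum_def block_of_eq Jblock_def subdiag_def
        block_component_delta cscale_def)
qed

lemma vector_space_cscale: "vector_space cscale"
  by unfold_locales (auto simp: cscale_def fun_eq_iff algebra_simps)

end

theory Submission
  imports Defs "HOL-Complex_Analysis.Complex_Analysis"
begin

text \<open>Write \<open>x i\<close> for the eigenvalues, which lie in \<open>[0, 1)\<close>, and \<open>s = 1 - x\<close>. For \<open>h\<close> in \<open>l2\<close> the numbers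
  \<open>\<langle>h, J^t g\<rangle>\<close> are, up to the block with eigenvalue 0, the values of a generalized Dirichlet series
  \<open>\<Sum>m. h m * E m t\<close>: each \<open>E m\<close> is an entire function, a polynomial times \<open>x^t\<close>, which is at most a constant
  times \<open>sqrt s * exp (- s t / 2)\<close> on the half-line (\<open>E_bound_disc\<close>; the factor \<open>sqrt s\<close> is
  \<open>g_bound\<close>, which is forced by the Bessel bound of the given frame). A Carleson sequence on a radius has a
  bounded number of members at each dyadic distance from 1 (\<open>Carleson_dyadic_card\<close>), and so the matrix
  \<open>sqrt (s s') / (s + s')\<close> is bounded by the Schur test (\<open>lacunary_kernel_bound\<close>). All estimates
  reduce to this matrix.

  Sufficiency. If \<open>0 < L < \<infinity>\<close>, then \<open>\<Lambda> k = k / L + o(k)\<close>.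
  Both \<open>\<Sum>k. \<phi> (\<Lambda> k)\<close> and \<open>L * (\<Sum>k. \<phi> k)\<close> are then close to \<open>L\<close> times
  the integral of \<open>\<phi>\<close> if \<open>\<phi>\<close> varies slowly (\<open>Riemann_sum_error\<close>). For the products
  \<open>\<phi> = E m * cnj (E m')\<close> this says that the frame operator of the samples at \<open>\<Lambda>\<close> is \<open>L\<close>
  times the frame operator of the orbit at the natural numbers, up to an operator that is small on sequences
  supported far out (\<open>tail_energy_comparison\<close>), that is, a compact one. By a Fredholm argument
  (\<open>frame_from_tail_bound\<close>) the samples form a frame as soon as no \<open>h \<noteq> 0\<close> is orthogonal to
  all of them. If \<open>h\<close> is, its Dirichlet series has zeros of positive density on the half-line; it is
  holomorphic and of polynomial growth in a half-plane, so that it vanishes by the argument of Blaschke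
  (\<open>half_plane_zeros_linear_growth\<close>, \<open>series_zeros_positive_density\<close>). Then \<open>h\<close> is
  orthogonal to the orbit at the natural numbers too, and \<open>h = 0\<close> because that orbit is a frame. The
  block with eigenvalue 0 contributes to \<open>\<langle>h, J^t g\<rangle>\<close> only at the integers \<open>t\<close> below its
  dimension; the condition on the first exponents says that these are sampled.

  Necessity. Testing a frame on the first basis vector of a block shows that
  \<open>(1 - x) * (\<Sum>k. x powr (2 * \<Lambda> k))\<close> stays between positive constants when \<open>x\<close> tends to 1
  through the eigenvalues, whereas it tends to 0 if \<open>L = 0\<close> and to \<open>\<infinity>\<close> if \<open>L = \<infinity>\<close>
  (\<open>Abel_means_imp_density\<close>). On the block with eigenvalue 0, the operator is a shift, that is,
  multiplication by the variable modulo a power of it; if an exponent \<open>r\<close> below the dimension is missing,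
  the reciprocal of the power series with the coefficients of \<open>g\<close> supplies a nonzero vector that is orthogonal to
  all other powers (\<open>frame_imp_initial_segment_subset\<close>).\<close>

section \<open>Zeros of bounded holomorphic functions in a half-plane\<close>

text \<open>The Cayley transform that takes \<open>a\<close> to 0 maps the half-plane onto the unit disc; in the disc this is the
  Schwarz lemma.\<close>

lemma half_plane_Schwarz:
  fixes f :: "complex \<Rightarrow> complex" and a M :: real
  assumes holf: "f holomorphic_on {w. 0 < Re w}"
    and bound: "\<And>w. 0 < Re w \<Longrightarrow> cmod (f w) \<le> M"
    and "0 < a" "f (of_real a) = 0" "0 < Re w"
  shows "cmod (f w) \<le> M * cmod ((w - of_real a) / (w + of_real a))"
proof -
  have "0 \<le> M" using bound[OF \<open>0 < Re w\<close>] norm_ge_zero order_trans by blast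
  define c :: "complex \<Rightarrow> complex" where "c \<zeta> = of_real a * (1 + \<zeta>) / (1 - \<zeta>)" for \<zeta>
  have c_pos: "0 < Re (c \<zeta>)" if "cmod \<zeta> < 1" for \<zeta>
  proof -
    have "\<zeta> \<noteq> 1" using that by auto
    have "(1 + \<zeta>) / (1 - \<zeta>) = (1 + \<zeta>) * cnj (1 - \<zeta>) / of_real ((cmod (1 - \<zeta>))\<^sup>2)"
      by (metis complex_div_cnj)
    then have "Re ((1 + \<zeta>) / (1 - \<zeta>)) = Re ((1 + \<zeta>) * cnj (1 - \<zeta>)) / (cmod (1 - \<zeta>))\<^sup>2"
      by (simp only: Re_divide_of_real)
    also have "Re ((1 + \<zeta>) * cnj (1 - \<zeta>)) = 1 - (cmod \<zeta>)\<^sup>2"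
      unfolding cmod_power2 by (simp add: algebra_simps power2_eq_square)
    finally have "0 < Re ((1 + \<zeta>) / (1 - \<zeta>))"
      using that \<open>\<zeta> \<noteq> 1\<close> by (simp add: abs_square_less_1 zero_less_divide_iff)
    moreover have "c \<zeta> = of_real a * ((1 + \<zeta>) / (1 - \<zeta>))" by (simp add: c_def)
    ultimately show ?thesis using \<open>0 < a\<close> by (simp del: times_divide_eq_right)
  qed
  have holc: "c holomorphic_on ball 0 1"
    unfolding c_def by (intro holomorphic_intros) auto
  have holfc: "(\<lambda>\<zeta>. f (c \<zeta>)) holomorphic_on ball 0 1"
  proof -
    have "c ` ball 0 1 \<subseteq> {w. 0 < Re w}" using c_pos by auto
    then show ?thesis using holomorphic_on_compose_gen[OF holc holf] by (simp add: o_def)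
  qed
  define \<zeta> where "\<zeta> = (w - of_real a) / (w + of_real a)"
  have wa: "w + of_real a \<noteq> 0"
    using \<open>0 < a\<close> \<open>0 < Re w\<close> by (metis Re_complex_of_real add_pos_pos less_irrefl plus_complex.simps(1) zero_complex.simps(1))
  have c\<zeta>: "c \<zeta> = w"
    using wa \<open>0 < a\<close> by (simp add: c_def \<zeta>_def divide_simps) 
  have \<zeta>1: "cmod \<zeta> < 1"
  proof -
    have "(cmod (w - of_real a))\<^sup>2 < (cmod (w + of_real a))\<^sup>2"
      unfolding cmod_power2 using \<open>0 < a\<close> \<open>0 < Re w\<close> by (simp add: power2_eq_square algebra_simps)
    then have "cmod (w - of_real a) < cmod (w + of_real a)"
      using power_less_imp_less_base norm_ge_zero by blast
    then show ?thesis using wa by (simp add: \<zeta>_def norm_divide)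
  qed
  \<comment> \<open>The Schwarz lemma needs a strict bound, so that \<open>M\<close> is approached from above.\<close>
  have "cmod (f w) \<le> M' * cmod \<zeta>" if "M < M'" for M'
  proof -
    have "0 < M'" using that \<open>0 \<le> M\<close> by simp
    have 1: "(\<lambda>\<zeta>. f (c \<zeta>) / of_real M') holomorphic_on ball 0 1"
      using \<open>0 < M'\<close> by (intro holomorphic_intros holfc) auto
    have "cmod (f (c \<zeta>) / of_real M') \<le> cmod \<zeta>"
    proof (rule Schwarz_Lemma(1)[OF 1 _ _ \<zeta>1])
      show "f (c 0) / of_real M' = 0" using \<open>f (of_real a) = 0\<close> by (simp add: c_def)
      show "cmod (f (c z) / of_real M') < 1" if "cmod z < 1" for z
        using bound[OF c_pos[OF that]] \<open>M < M'\<close> \<open>0 < M'\<close> by (simp add: norm_divide)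
    qed
    then show ?thesis using \<open>0 < M'\<close> c\<zeta> by (simp add: norm_divide field_simps)
  qed
  then have "\<forall>\<^sub>F M' in at_right M. cmod (f w) \<le> M' * cmod \<zeta>"
    by (auto simp: eventually_at_filter)
  moreover have "((\<lambda>M'. M' * cmod \<zeta>) \<longlongrightarrow> M * cmod \<zeta>) (at_right M)"
    by (intro tendsto_intros)
  ultimately show ?thesis unfolding \<zeta>_def
    using tendsto_lowerbound trivial_limit_at_right_real by blast
qed

text \<open>Dividing by a Blaschke factor does not increase the bound. This allows one to remove the zeros one at a time.\<close>

lemma half_plane_factor_zero:
  fixes f :: "complex \<Rightarrow> complex" and a M :: real
  assumes holf: "f holomorphic_on {w. 0 < Re w}"
    and bound: "\<And>w. 0 < Re w \<Longrightarrow> cmod (f w) \<le> M"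
    and "0 < a" "f (of_real a) = 0"
  obtains q where "q holomorphic_on {w. 0 < Re w}" "\<And>w. 0 < Re w \<Longrightarrow> cmod (q w) \<le> M"
    "\<And>w. 0 < Re w \<Longrightarrow> f w = (w - of_real a) / (w + of_real a) * q w"
proof -
  define H where "H = {w::complex. 0 < Re w}"
  have "open H" unfolding H_def by (rule open_halfspace_Re_gt)
  define d where "d w = (if w = of_real a then deriv f (of_real a)
      else (f w - f (of_real a)) / (w - of_real a))" for w
  have hold: "d holomorphic_on H"
    unfolding d_def using pole_lemma_open[OF _ \<open>open H\<close>] holf H_def by blast
  define q where "q w = (w + of_real a) * d w" for w
  have holq: "q holomorphic_on H" unfolding q_def by (intro holomorphic_intros hold)
  have wa: "w + of_real a \<noteq> 0" if "w \<in> H" for w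
    using \<open>0 < a\<close> that unfolding H_def by (metis Re_complex_of_real add_pos_pos less_irrefl mem_Collect_eq plus_complex.simps(1) zero_complex.simps(1))
  have eq: "f w = (w - of_real a) / (w + of_real a) * q w" if "w \<in> H" for w
    using wa[OF that] \<open>f (of_real a) = 0\<close> by (simp add: q_def d_def)
  have q1: "cmod (q w) \<le> M" if "w \<in> H" "w \<noteq> of_real a" for w
  proof -
    have "cmod (f w) \<le> M * cmod ((w - of_real a) / (w + of_real a))"
      using half_plane_Schwarz[OF holf bound \<open>0 < a\<close> \<open>f (of_real a) = 0\<close>] that H_def by auto
    moreover have "cmod (f w) = cmod (q w) * cmod ((w - of_real a) / (w + of_real a))"
      unfolding eq[OF that(1)] norm_mult by (rule mult.commute)
    moreover have "0 < cmod ((w - of_real a) / (w + of_real a))"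
      using that wa by auto
    ultimately show ?thesis by simp
  qed
  have "cmod (q w) \<le> M" if "w \<in> H" for w
  proof (cases "w = of_real a")
    case True
    have "(q \<longlongrightarrow> q w) (at w)"
      using holq that \<open>open H\<close> by (meson at_within_open continuous_on holomorphic_on_imp_continuous_on isCont_def continuous_on_eq_continuous_at)
    then have "((\<lambda>w. cmod (q w)) \<longlongrightarrow> cmod (q w)) (at w)" by (rule tendsto_norm)
    moreover have "\<forall>\<^sub>F v in at w. cmod (q v) \<le> M"
      using eventually_at_in_open[OF \<open>open H\<close> that] by eventually_elim (use q1 True in auto)
    ultimately show ?thesis using tendsto_upperbound trivial_limit_at by blast
  qed (use q1 that in auto)
  with that holq eq show ?thesis unfolding H_def by blast
qed

lemma half_plane_Blaschke_bound:
  fixes f :: "complex \<Rightarrow> complex" and M :: real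
  assumes "finite A"
    and "f holomorphic_on {w. 0 < Re w}"
    and "\<And>w. 0 < Re w \<Longrightarrow> cmod (f w) \<le> M"
    and "\<And>a. a \<in> A \<Longrightarrow> 0 < a \<and> f (of_real a) = 0"
    and "0 < Re w"
  shows "cmod (f w) \<le> M * (\<Prod>a\<in>A. cmod ((w - of_real a) / (w + of_real a)))"
  using assms
proof (induction A arbitrary: f rule: finite_induct)
  case empty
  then show ?case by simp
next
  case (insert a A)
  then have "0 < a" "f (of_real a) = 0" by auto
  obtain q where q: "q holomorphic_on {w. 0 < Re w}" "\<And>w. 0 < Re w \<Longrightarrow> cmod (q w) \<le> M"
    "\<And>w. 0 < Re w \<Longrightarrow> f w = (w - of_real a) / (w + of_real a) * q w"
    using half_plane_factor_zero[OF insert.prems(1,2) \<open>0 < a\<close> \<open>f (of_real a) = 0\<close>] by blast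
  have "0 < b \<and> q (of_real b) = 0" if "b \<in> A" for b
  proof -
    have "0 < b" "f (of_real b) = 0" using insert.prems(3) that by auto
    moreover have "b \<noteq> a" using that insert.hyps by auto
    moreover have "(of_real b + of_real a :: complex) \<noteq> 0"
      using \<open>0 < a\<close> \<open>0 < b\<close> by (metis add_pos_pos less_irrefl of_real_add of_real_eq_0_iff)
    ultimately show ?thesis using q(3)[of "of_real b"] by auto
  qed
  from insert.IH[OF q(1,2) this insert.prems(4)]
  have "cmod ((w - of_real a) / (w + of_real a)) * cmod (q w) \<le>
    cmod ((w - of_real a) / (w + of_real a)) * (M * (\<Prod>a\<in>A. cmod ((w - of_real a) / (w + of_real a))))"
    by (intro mult_left_mono) auto
  then show ?case
    using q(3)[OF \<open>0 < Re w\<close>] insert.hyps by (simp add: norm_mult norm_divide mult_ac)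
qed

text \<open>At a real point each Blaschke factor of a zero \<open>\<mu> k\<close> is at most \<open>exp (- c / (k + 1))\<close>, and
  the harmonic series diverges.\<close>

lemma half_plane_zeros_linear_growth:
  fixes f :: "complex \<Rightarrow> complex" and M C :: real and \<mu> :: "nat \<Rightarrow> real"
  assumes holf: "f holomorphic_on {w. 0 < Re w}"
    and bound: "\<And>w. 0 < Re w \<Longrightarrow> cmod (f w) \<le> M"
    and inj: "inj \<mu>"
    and growth: "\<And>k. 1 \<le> \<mu> k" "\<And>k. \<mu> k \<le> C * (real k + 1)"
    and zero: "\<And>k. f (of_real (\<mu> k)) = 0"
    and "0 < x"
  shows "f (of_real x) = 0"
proof -
  have "1 \<le> C" using growth[of 0] by simp
  have "0 \<le> M" using order_trans[OF norm_ge_zero bound[of 1]] by simp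
  define y where "y = min x 1"
  define c where "c = 2 * y / (x + C)"
  have "0 < y" "0 < c" using \<open>0 < x\<close> \<open>1 \<le> C\<close> by (auto simp: y_def c_def)
  have factor: "cmod ((of_real x - of_real (\<mu> k)) / (of_real x + of_real (\<mu> k)))
      \<le> exp (- c * (1 / (real k + 1)))" for k
  proof -
    have pos: "0 < x + \<mu> k" using \<open>0 < x\<close> growth(1)[of k] by simp
    have "cmod ((of_real x - of_real (\<mu> k)) / (of_real x + of_real (\<mu> k))) = \<bar>x - \<mu> k\<bar> / (x + \<mu> k)"
      by (metis abs_of_pos norm_divide norm_of_real of_real_add of_real_diff pos)
    also have "\<dots> \<le> 1 - 2 * y / (x + \<mu> k)"
    proof -
      \<comment> \<open>\<open>y\<close> is a lower bound of \<open>x\<close> and of all \<open>\<mu> k\<close>.\<close>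
      have "\<bar>x - \<mu> k\<bar> \<le> x + \<mu> k - 2 * y" using growth(1)[of k] by (auto simp: y_def)
      then have "\<bar>x - \<mu> k\<bar> / (x + \<mu> k) \<le> (x + \<mu> k - 2 * y) / (x + \<mu> k)"
        using pos by (intro divide_right_mono) auto
      then show ?thesis using pos by (simp add: diff_divide_distrib)
    qed
    also have "\<dots> \<le> 1 - c * (1 / (real k + 1))"
    proof -
      have "x + \<mu> k \<le> x * (real k + 1) + C * (real k + 1)"
        using growth(2)[of k] \<open>0 < x\<close> by (intro add_mono) (auto simp: algebra_simps)
      then have "x + \<mu> k \<le> (x + C) * (real k + 1)" by (simp add: algebra_simps)
      then have "2 * y / ((x + C) * (real k + 1)) \<le> 2 * y / (x + \<mu> k)"
        using pos \<open>0 < y\<close> by (intro divide_left_mono) auto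
      then show ?thesis by (simp add: c_def)
    qed
    also have "\<dots> \<le> exp (- c * (1 / (real k + 1)))"
      using exp_ge_add_one_self[of "- c * (1 / (real k + 1))"] by simp
    finally show ?thesis .
  qed
  have "cmod (f (of_real x)) \<le> M * exp (- c * harm K)" for K
  proof -
    have "cmod (f (of_real x)) \<le>
      M * (\<Prod>a\<in>\<mu> ` {..<K}. cmod ((of_real x - of_real a) / (of_real x + of_real a)))"
      using zero growth(1) \<open>0 < x\<close>
      by (intro half_plane_Blaschke_bound[OF _ holf bound])
         (auto intro: less_le_trans[OF zero_less_one])
    also have "(\<Prod>a\<in>\<mu> ` {..<K}. cmod ((of_real x - of_real a) / (of_real x + of_real a)))
      = (\<Prod>k<K. cmod ((of_real x - of_real (\<mu> k)) / (of_real x + of_real (\<mu> k))))"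
      using inj by (subst prod.reindex) (auto simp: inj_on_def inj_def)
    also have "M * \<dots> \<le> M * (\<Prod>k<K. exp (- c * (1 / (real k + 1))))"
      using \<open>0 \<le> M\<close> factor by (intro mult_left_mono prod_mono) auto
    also have "(\<Prod>k<K. exp (- c * (1 / (real k + 1)))) = exp (\<Sum>k<K. - c * (1 / (real k + 1)))"
      by (simp only: exp_sum finite_lessThan)
    also have "(\<Sum>k<K. - c * (1 / (real k + 1))) = - c * harm K"
      unfolding harm_def sum_distrib_left
      by (rule sum.reindex_bij_witness[of _ "\<lambda>k. k - 1" Suc]) (auto simp: field_simps)
    finally show ?thesis .
  qed
  moreover have "(\<lambda>K. M * exp (- c * harm K)) \<longlonglongrightarrow> M * 0"
  proof (intro tendsto_intros)
    have "filterlim (\<lambda>K. c * harm K) at_top sequentially"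
      using \<open>0 < c\<close> harm_at_top by (intro filterlim_tendsto_pos_mult_at_top[OF tendsto_const]) auto
    then have "filterlim (\<lambda>K. - (c * harm K)) at_bot sequentially"
      by (simp add: filterlim_uminus_at_bot)
    then show "(\<lambda>K. exp (- c * harm K)) \<longlonglongrightarrow> 0"
      using filterlim_compose[OF exp_at_bot] by fastforce
  qed
  ultimately have "cmod (f (of_real x)) \<le> M * 0"
    by (intro tendsto_lowerbound[of "\<lambda>K. M * exp (- c * harm K)"]) auto
  then show ?thesis by simp
qed

section \<open>Lacunary sequences and real Carleson sequences\<close>

text \<open>A finite union of geometrically decaying sequences, in any order. Repetitions are admitted because all coordinates of
  a block will share the distance of one eigenvalue from 1.\<close>

definition lacunary :: "(nat \<Rightarrow> real) \<Rightarrow> bool" where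
  "lacunary S \<longleftrightarrow> (\<forall>m. 0 < S m \<and> S m \<le> 1) \<and>
     (\<exists>P::nat. \<forall>p. finite {m. (1/2) ^ Suc p < S m \<and> S m \<le> (1/2) ^ p} \<and>
        card {m. (1/2) ^ Suc p < S m \<and> S m \<le> (1/2) ^ p} \<le> P)"

lemma dyadic_level:
  fixes s :: real
  assumes "0 < s" "s \<le> 1"
  obtains p where "(1/2) ^ Suc p < s" "s \<le> (1/2) ^ p"
proof -
  have "(\<lambda>p. (1/2 :: real) ^ p) \<longlonglongrightarrow> 0" by (rule LIMSEQ_realpow_zero) auto
  from order_tendstoD(2)[OF this assms(1)] obtain p0 where p0: "(1/2 :: real) ^ p0 < s"
    by (auto simp: eventually_sequentially)
  define p where "p = (LEAST p. (1/2 :: real) ^ p < s)"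
  have p: "(1/2 :: real) ^ p < s" unfolding p_def using p0 by (rule LeastI)
  then have "p \<noteq> 0" using assms by (metis not_less power_0)
  then have "\<not> (1/2 :: real) ^ (p - 1) < s" unfolding p_def by (intro not_less_Least) auto
  with p \<open>p \<noteq> 0\<close> that[of "p - 1"] show ?thesis by (simp add: not_less)
qed

text \<open>Sums over a lacunary sequence are controlled by sums over the dyadic levels. All estimates for lacunary sequences
  follow from this and the geometric series.\<close>

lemma lacunary_levels:
  assumes "lacunary S"
  obtains lev :: "nat \<Rightarrow> nat" and P :: nat where
    "\<And>m. (1/2) ^ Suc (lev m) < S m" "\<And>m. S m \<le> (1/2) ^ lev m"
    "\<And>A w. finite A \<Longrightarrow> (\<And>p. 0 \<le> (w p :: real)) \<Longrightarrow> (\<Sum>m\<in>A. w (lev m)) \<le> real P * (\<Sum>p\<in>lev ` A. w p)"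
proof -
  obtain P :: nat where P: "\<And>p. finite {m. (1/2) ^ Suc p < S m \<and> S m \<le> (1/2) ^ p}"
      "\<And>p. card {m. (1/2) ^ Suc p < S m \<and> S m \<le> (1/2) ^ p} \<le> P"
    using assms unfolding lacunary_def by blast
  have "\<exists>p. (1/2) ^ Suc p < S m \<and> S m \<le> (1/2) ^ p" for m
    using dyadic_level[of "S m"] assms unfolding lacunary_def by metis
  then obtain lev where l: "\<And>m. (1/2) ^ Suc (lev m) < S m" "\<And>m. S m \<le> (1/2) ^ lev m" by metis
  have "(\<Sum>m\<in>A. w (lev m)) \<le> real P * (\<Sum>p\<in>lev ` A. w p)"
    if A: "finite A" and w: "\<And>p. 0 \<le> w p" for A and w :: "nat \<Rightarrow> real"
  proof -
    have "(\<Sum>m\<in>A. w (lev m)) = (\<Sum>p\<in>lev ` A. \<Sum>m\<in>{m\<in>A. lev m = p}. w (lev m))"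
      by (rule sum.image_gen[OF A])
    also have "\<dots> = (\<Sum>p\<in>lev ` A. real (card {m\<in>A. lev m = p}) * w p)" by simp
    also have "\<dots> \<le> (\<Sum>p\<in>lev ` A. real P * w p)"
    proof (intro sum_mono mult_right_mono w)
      fix p
      have "card {m\<in>A. lev m = p} \<le> card {m. (1/2) ^ Suc p < S m \<and> S m \<le> (1/2) ^ p}"
        using l by (intro card_mono P(1)) auto
      then show "real (card {m\<in>A. lev m = p}) \<le> real P" using P(2)[of p] by simp
    qed
    finally show ?thesis by (simp add: sum_distrib_left)
  qed
  with l that show ?thesis by blast
qed

lemma sum_power_le_geometric:
  fixes q :: real
  assumes "0 \<le> q" "q < 1" "finite A" "inj_on f A"
  shows "(\<Sum>p\<in>A. q ^ f p) \<le> 1 / (1 - q)"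
proof -
  have "(\<Sum>p\<in>A. q ^ f p) = (\<Sum>i\<in>f ` A. q ^ i)" using assms(4) by (simp add: sum.reindex)
  also have "\<dots> \<le> (\<Sum>i. q ^ i)" using assms by (intro sum_le_suminf summable_geometric) auto
  also have "\<dots> = 1 / (1 - q)" using assms by (intro suminf_geometric) auto
  finally show ?thesis .
qed

lemma lacunary_summable_sqrt:
  assumes "lacunary S"
  shows "summable (\<lambda>m. sqrt (S m))"
proof -
  obtain lev :: "nat \<Rightarrow> nat" and P :: nat where l: "\<And>m. S m \<le> (1/2) ^ lev m"
    "\<And>A w. finite A \<Longrightarrow> (\<And>p. 0 \<le> (w p :: real)) \<Longrightarrow> (\<Sum>m\<in>A. w (lev m)) \<le> real P * (\<Sum>p\<in>lev ` A. w p)"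
    using lacunary_levels[OF assms] by metis
  define q where "q = sqrt (1/2 :: real)"
  have q: "0 \<le> q" "q < 1" by (auto simp: q_def real_sqrt_divide)
  show ?thesis
  proof (rule summableI_nonneg_bounded)
    show "0 \<le> sqrt (S m)" for m using assms by (simp add: lacunary_def less_imp_le)
    fix N
    have "(\<Sum>m<N. sqrt (S m)) \<le> (\<Sum>m<N. q ^ lev m)"
      unfolding q_def real_sqrt_power[symmetric] by (intro sum_mono real_sqrt_le_mono l)
    also have "\<dots> \<le> real P * (\<Sum>p\<in>lev ` {..<N}. q ^ p)" using q by (intro l(2)) auto
    also have "\<dots> \<le> real P * (1 / (1 - q))"
      using sum_power_le_geometric[of q "lev ` {..<N}" "\<lambda>p. p"] q by (intro mult_left_mono) auto
    finally show "(\<Sum>m<N. sqrt (S m)) \<le> real P * (1 / (1 - q))" .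
  qed
qed

text \<open>If the smaller number is at most a \<open>q\<close>-th part of the larger one, the quotient is at most \<open>1 / sqrt q\<close>;
  in terms of levels, it decays geometrically with the distance from the diagonal.\<close>

lemma kernel_le_power:
  fixes s s' :: real
  assumes "0 < s'" "(1/2) ^ Suc p < s" "s' \<le> (1/2) ^ p'" "p \<le> p'"
  shows "sqrt (s * s') / (s + s') \<le> sqrt 2 * sqrt (1/2) ^ (p' - p)"
proof -
  have "0 < s" using assms(2) less_trans[of 0 "(1/2) ^ Suc p" s] by simp
  have "sqrt (s * s') / (s + s') \<le> sqrt (s * s') / s"
    using \<open>0 < s\<close> assms(1) by (intro divide_left_mono) auto
  also have "\<dots> = sqrt (s' / s)"
    using \<open>0 < s\<close> by (simp add: real_sqrt_mult real_sqrt_divide field_simps)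
  also have "\<dots> \<le> sqrt ((1/2) ^ p' / (1/2) ^ Suc p)"
    using assms \<open>0 < s\<close> by (intro real_sqrt_le_mono frac_le) auto
  also have "(1/2 :: real) ^ p' / (1/2) ^ Suc p = 2 * (1/2) ^ (p' - p)"
    using assms(4) by (simp add: power_diff field_simps)
  finally show ?thesis by (simp add: real_sqrt_mult real_sqrt_power)
qed

text \<open>The entries of a row decay geometrically with the difference of the levels, and boundedly many entries share a level.\<close>

lemma lacunary_kernel_bound:
  assumes "lacunary S"
  obtains R where "0 \<le> R"
    "\<And>m A. finite A \<Longrightarrow> (\<Sum>m'\<in>A. sqrt (S m * S m') / (S m + S m')) \<le> R"
proof -
  obtain lev :: "nat \<Rightarrow> nat" and P :: nat where l:
    "\<And>m. (1/2) ^ Suc (lev m) < S m" "\<And>m. S m \<le> (1/2) ^ lev m"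
    "\<And>A w. finite A \<Longrightarrow> (\<And>p. 0 \<le> (w p :: real)) \<Longrightarrow> (\<Sum>m\<in>A. w (lev m)) \<le> real P * (\<Sum>p\<in>lev ` A. w p)"
    using lacunary_levels[OF assms] by metis
  have pos: "0 < S m" for m using assms by (simp add: lacunary_def)
  define q where "q = sqrt (1/2 :: real)"
  have q: "0 \<le> q" "q < 1" by (auto simp: q_def real_sqrt_divide)
  have kernel: "sqrt (S m * S m') / (S m + S m') \<le> sqrt 2 * q ^ ((lev m' - lev m) + (lev m - lev m'))" for m m'
  proof (cases "lev m \<le> lev m'")
    case True
    then show ?thesis using kernel_le_power[OF pos l(1,2) True] by (simp add: q_def)
  next
    case False
    then have "lev m' \<le> lev m" by simp
    then show ?thesis
      using kernel_le_power[OF pos l(1,2) \<open>lev m' \<le> lev m\<close>] by (simp add: q_def mult.commute add.commute)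
  qed
  have geo: "(\<Sum>p\<in>B. q ^ ((p - k) + (k - p))) \<le> 2 / (1 - q)" if "finite B" for B and k :: nat
  proof -
    have "(\<Sum>p\<in>B. q ^ ((p - k) + (k - p))) =
      (\<Sum>p\<in>{p\<in>B. k \<le> p}. q ^ ((p - k) + (k - p))) + (\<Sum>p\<in>{p\<in>B. \<not> k \<le> p}. q ^ ((p - k) + (k - p)))"
      using that by (subst sum.union_disjoint[symmetric]) (auto intro!: sum.cong)
    also have "\<dots> \<le> 1 / (1 - q) + 1 / (1 - q)"
      using q that by (intro add_mono sum_power_le_geometric) (auto simp: inj_on_def)
    finally show ?thesis by simp
  qed
  have "(\<Sum>m'\<in>A. sqrt (S m * S m') / (S m + S m')) \<le> sqrt 2 * (real P * (2 / (1 - q)))"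
    if "finite A" for m A
  proof -
    have "(\<Sum>m'\<in>A. sqrt (S m * S m') / (S m + S m')) \<le>
        (\<Sum>m'\<in>A. sqrt 2 * q ^ ((lev m' - lev m) + (lev m - lev m')))"
      by (intro sum_mono kernel)
    also have "\<dots> = sqrt 2 * (\<Sum>m'\<in>A. q ^ ((lev m' - lev m) + (lev m - lev m')))"
      by (simp add: sum_distrib_left)
    also have "\<dots> \<le> sqrt 2 * (real P * (\<Sum>p\<in>lev ` A. q ^ ((p - lev m) + (lev m - p))))"
      using q l(3)[OF that, of "\<lambda>p. q ^ ((p - lev m) + (lev m - p))"] by (intro mult_left_mono) auto
    also have "\<dots> \<le> sqrt 2 * (real P * (2 / (1 - q)))"
      using that by (intro mult_left_mono geo) auto
    finally show ?thesis .
  qed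
  moreover have "0 \<le> sqrt 2 * (real P * (2 / (1 - q)))" using q by simp
  ultimately show ?thesis using that by blast
qed

text \<open>All factors are at most 1, so that each finite product is at least the full one.\<close>

lemma Carleson_products_bounded_below:
  assumes "Carleson_sequence z"
  obtains \<delta> where "0 < \<delta>"
    "\<And>A k. finite A \<Longrightarrow> k \<notin> A \<Longrightarrow> \<delta> \<le> (\<Prod>j\<in>A. cmod ((z j - z k) / (1 - cnj (z j) * z k)))"
proof -
  define \<rho> where "\<rho> j k = cmod ((z j - z k) / (1 - cnj (z j) * z k))" for j k
  define \<pi> where "\<pi> k N = (\<Prod>j\<in>{..<N} - {k}. \<rho> j k)" for k N
  define \<delta> where "\<delta> = (INF k. lim (\<pi> k))"
  have z1: "cmod (z i) < 1" for i using assms by (simp add: Carleson_sequence_def)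
  have \<rho>: "0 \<le> \<rho> j k" "\<rho> j k \<le> 1" for j k
  proof -
    have "(cmod (z j - z k))\<^sup>2 \<le> (cmod (1 - cnj (z j) * z k))\<^sup>2"
    proof -
      have "0 \<le> (1 - (cmod (z j))\<^sup>2) * (1 - (cmod (z k))\<^sup>2)"
        using z1[of j] z1[of k] by (intro mult_nonneg_nonneg) (auto simp: abs_square_le_1 less_imp_le)
      then show ?thesis unfolding cmod_power2 by (simp add: power2_eq_square algebra_simps)
    qed
    then have "cmod (z j - z k) \<le> cmod (1 - cnj (z j) * z k)"
      by (rule power2_le_imp_le) simp
    then have "cmod (z j - z k) / cmod (1 - cnj (z j) * z k) \<le> 1"
      by (auto simp: divide_le_eq_1 less_le)
    then show "\<rho> j k \<le> 1" unfolding \<rho>_def norm_divide .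
  qed (simp add: \<rho>_def)
  have mono: "(\<Prod>j\<in>B. \<rho> j k) \<le> (\<Prod>j\<in>A. \<rho> j k)" if "finite B" "A \<subseteq> B" for A B k
  proof -
    have "(\<Prod>j\<in>B. \<rho> j k) = (\<Prod>j\<in>A. \<rho> j k) * (\<Prod>j\<in>B - A. \<rho> j k)"
      using that by (metis prod.subset_diff mult.commute)
    also have "\<dots> \<le> (\<Prod>j\<in>A. \<rho> j k)"
      using \<rho> by (intro mult_left_le prod_nonneg prod_le_1) auto
    finally show ?thesis .
  qed
  have dec: "decseq (\<pi> k)" for k
    unfolding \<pi>_def by (intro decseq_def[THEN iffD2] allI impI mono) auto
  have nonneg: "0 \<le> \<pi> k N" for k N unfolding \<pi>_def using \<rho> by (intro prod_nonneg) auto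
  have lim: "\<pi> k \<longlonglongrightarrow> lim (\<pi> k)" for k
    using decseq_convergent[OF dec, of 0 k] nonneg by (metis limI)
  have lim0: "0 \<le> lim (\<pi> k)" for k 
    by (rule LIMSEQ_le_const[OF lim]) (use nonneg in blast)
  have "\<delta> \<le> lim (\<pi> k)" for k
    unfolding \<delta>_def using lim0 by (intro cINF_lower bdd_belowI2[of _ 0]) auto
  moreover have "lim (\<pi> k) \<le> \<pi> k N" for k N using decseq_ge[OF dec lim] by simp
  ultimately have \<delta>_le: "\<delta> \<le> \<pi> k N" for k N by (rule order_trans)
  have "\<delta> \<le> (\<Prod>j\<in>A. cmod ((z j - z k) / (1 - cnj (z j) * z k)))" if A: "finite A" "k \<notin> A" for A k
  proof -
    obtain N where "A \<subseteq> {..<N}"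
      using finite_nat_iff_bounded[THEN iffD1, OF A(1)] by blast
    then have "\<pi> k N \<le> (\<Prod>j\<in>A. \<rho> j k)" unfolding \<pi>_def using that by (intro mono) auto
    then show ?thesis using \<delta>_le[of k N] by (simp add: \<rho>_def)
  qed
  moreover have "0 < \<delta>"
    using assms by (simp add: Carleson_sequence_def \<delta>_def \<pi>_def[abs_def] \<rho>_def)
  ultimately show ?thesis using that by blast
qed

lemma Carleson_inj:
  assumes "Carleson_sequence z"
  shows "inj z"
proof (rule injI, rule ccontr)
  fix j k assume "z j = z k" "j \<noteq> k"
  obtain \<delta> where "0 < \<delta>"
    "\<And>A k. finite A \<Longrightarrow> k \<notin> A \<Longrightarrow> \<delta> \<le> (\<Prod>j\<in>A. cmod ((z j - z k) / (1 - cnj (z j) * z k)))"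
    using Carleson_products_bounded_below[OF assms] by blast
  from this(1) this(2)[of "{j}" k] show False using \<open>z j = z k\<close> \<open>j \<noteq> k\<close> by simp
qed

text \<open>Two points of \<open>[0, 1)\<close> whose distances from 1 differ by a factor of at most 2 have pseudo-hyperbolic distance
  at most \<open>1/2\<close>. If many points share a dyadic level, the Carleson product at one of them is therefore small.\<close>

lemma Carleson_dyadic_card:
  assumes C: "Carleson_sequence (\<lambda>i. of_real (x i))" and x: "\<And>i. 0 \<le> x i" "\<And>i. x i < 1"
  obtains P :: nat where "\<And>p. finite {i. (1/2) ^ Suc p < 1 - x i \<and> 1 - x i \<le> (1/2) ^ p}"
    "\<And>p. card {i. (1/2) ^ Suc p < 1 - x i \<and> 1 - x i \<le> (1/2) ^ p} \<le> P"
proof -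
  obtain \<delta> where \<delta>: "0 < \<delta>"
    "\<And>A k. finite A \<Longrightarrow> k \<notin> A \<Longrightarrow>
      \<delta> \<le> (\<Prod>j\<in>A. cmod ((of_real (x j) - of_real (x k)) / (1 - cnj (of_real (x j)) * of_real (x k))))"
    using Carleson_products_bounded_below[OF C] by blast
  obtain P :: nat where P: "(1/2 :: real) ^ P < \<delta>"
    using real_arch_pow_inv[OF \<delta>(1), of "1/2"] by auto
  have half: "cmod ((of_real (x j) - of_real (x k)) / (1 - cnj (of_real (x j)) * of_real (x k))) \<le> 1/2"
    if jk: "(1/2) ^ Suc p < 1 - x j" "1 - x j \<le> (1/2) ^ p" "(1/2) ^ Suc p < 1 - x k" "1 - x k \<le> (1/2) ^ p"
    for j k p
  proof -
    have eq: "cmod ((of_real (x j) - of_real (x k)) / (1 - cnj (of_real (x j)) * of_real (x k)))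
      = \<bar>x j - x k\<bar> / \<bar>1 - x j * x k\<bar>"
      unfolding norm_divide complex_cnj_complex_of_real
      by (metis norm_of_real of_real_1 of_real_diff of_real_mult)
    have prod_le: "x j * x k \<le> x j" "x j * x k \<le> x k"
      using x[of j] x[of k] by (auto intro: mult_left_le mult_left_le_one_le)
    have "1 - x j \<le> 2 * (1 - x k)" "1 - x k \<le> 2 * (1 - x j)" using jk by auto
    then have "2 * (x j - x k) \<le> 1 - x j * x k \<and> 2 * (x k - x j) \<le> 1 - x j * x k"
      using prod_le by argo
    then have "2 * \<bar>x j - x k\<bar> \<le> 1 - x j * x k" by (simp add: abs_if)
    moreover have "0 < 1 - x j * x k" using prod_le x[of j] by linarith
    ultimately show ?thesis unfolding eq by (simp add: divide_le_eq)
  qed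
  have "finite {i. (1/2) ^ Suc p < 1 - x i \<and> 1 - x i \<le> (1/2) ^ p} \<and>
     card {i. (1/2) ^ Suc p < 1 - x i \<and> 1 - x i \<le> (1/2) ^ p} \<le> Suc P" for p
  proof (rule finite_if_finite_subsets_card_bdd)
    fix G assume G: "G \<subseteq> {i. (1/2) ^ Suc p < 1 - x i \<and> 1 - x i \<le> (1/2) ^ p}" "finite G"
    show "card G \<le> Suc P"
    proof (cases "G = {}")
      case False
      then obtain k where k: "k \<in> G" by blast
      have "\<delta> \<le> (\<Prod>j\<in>G - {k}. cmod ((of_real (x j) - of_real (x k)) / (1 - cnj (of_real (x j)) * of_real (x k))))"
        using G(2) by (intro \<delta>(2)) auto
      also have "\<dots> \<le> (\<Prod>j\<in>G - {k}. 1/2)"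
        using G(1) k by (intro prod_mono conjI norm_ge_zero half[of p]) auto
      also have "\<dots> = (1/2) ^ (card G - 1)" using k G(2) by simp
      finally have "(1/2 :: real) ^ P < (1/2) ^ (card G - 1)" using P by linarith
      then have "card G - 1 < P" by (subst (asm) power_strict_decreasing_iff) auto
      then show ?thesis by simp
    qed simp
  qed
  then show ?thesis using that by blast
qed

section \<open>Riemann sums over nearly arithmetic progressions\<close>

lemma inverse_one_minus_exp_le:
  fixes a :: real
  assumes "0 < a"
  shows "1 / (1 - exp (- a)) \<le> 1 + 1 / a"
proof -
  have "exp (- a) * (1 + a) \<le> exp (- a) * exp a"
    by (intro mult_left_mono exp_ge_add_one_self) auto
  then have "exp (- a) * (1 + a) \<le> 1" by (simp add: exp_minus)
  moreover have "exp (- a) < 1" using assms by simp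
  ultimately show ?thesis using assms by (simp add: field_simps)
qed

lemma exp_minus_mult_nat: "exp (- (a * real k)) = exp (- a) ^ k"
  by (simp add: exp_of_nat_mult[symmetric] mult.commute)

lemma suminf_exp_le:
  fixes a :: real
  assumes "0 < a"
  shows "summable (\<lambda>k. exp (- (a * real k)))" "(\<Sum>k. exp (- (a * real k))) \<le> 1 + 1 / a"
  using inverse_one_minus_exp_le[OF assms] assms
  by (auto simp: exp_minus_mult_nat suminf_geometric intro!: summable_geometric)

lemma suminf_linear_exp_le:
  fixes a :: real
  assumes "0 < a"
  shows "summable (\<lambda>k. (real k + 1) * exp (- (a * real k)))"
    "(\<Sum>k. (real k + 1) * exp (- (a * real k))) \<le> (1 + 1 / a)\<^sup>2"
proof -
  have e: "(real k + 1) * exp (- (a * real k)) = of_nat (Suc k) * exp (- a) ^ k" for k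
    by (simp add: exp_minus_mult_nat)
  have s: "(\<lambda>k. (real k + 1) * exp (- (a * real k))) sums (1 / (1 - exp (- a))\<^sup>2)"
    unfolding e using assms by (intro geometric_deriv_sums) auto
  then show "summable (\<lambda>k. (real k + 1) * exp (- (a * real k)))" by (rule sums_summable)
  have "(1 / (1 - exp (- a)))\<^sup>2 \<le> (1 + 1 / a)\<^sup>2"
    using assms by (intro power_mono inverse_one_minus_exp_le) auto
  then show "(\<Sum>k. (real k + 1) * exp (- (a * real k))) \<le> (1 + 1 / a)\<^sup>2"
    using sums_unique[OF s] by (simp add: power_divide)
qed

lemma field_differentiable_bound_real_axis:
  fixes F F' :: "complex \<Rightarrow> complex"
  assumes F: "\<And>w. (F has_field_derivative F' w) (at w)"
    and B: "\<And>t. min x y \<le> t \<Longrightarrow> t \<le> max x y \<Longrightarrow> cmod (F' (of_real t)) \<le> B"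
  shows "cmod (F (of_real x) - F (of_real y)) \<le> B * \<bar>x - y\<bar>"
proof -
  have "cmod (F (of_real x) - F (of_real y)) \<le> B * cmod (of_real x - of_real y)"
  proof (rule field_differentiable_bound)
    show "convex (closed_segment (of_real x :: complex) (of_real y))" by simp
    show "(F has_field_derivative F' w) (at w within closed_segment (of_real x) (of_real y))" for w
      using F has_field_derivative_at_within by blast
    fix w :: complex assume "w \<in> closed_segment (of_real x) (of_real y)"
    then obtain t where "w = of_real t" "t \<in> closed_segment x y"
      by (auto simp: closed_segment_of_real)
    then show "cmod (F' w) \<le> B"
      using B[of t] by (auto simp: closed_segment_eq_real_ivl split: if_splits)
  qed auto
  then show ?thesis by (metis norm_of_real of_real_diff)
qed

text \<open>The terms stay within \<open>\<epsilon> k + C\<close> of the progression with step \<open>h\<close>. The rough lower bound with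
  \<open>c\<close> and \<open>C0\<close> is recorded separately because \<open>C0\<close> enters error bounds exponentially and must not
  depend on \<open>\<epsilon>\<close>.\<close>

definition near_progression :: "real \<Rightarrow> real \<Rightarrow> real \<Rightarrow> real \<Rightarrow> real \<Rightarrow> (nat \<Rightarrow> real) \<Rightarrow> bool" where
  "near_progression h \<epsilon> C c C0 \<mu> \<longleftrightarrow> 0 < h \<and> 0 \<le> \<epsilon> \<and> 0 < c \<and>
     (\<forall>k. 0 \<le> \<mu> k \<and> \<bar>\<mu> k - real k * h\<bar> \<le> \<epsilon> * real k + C \<and>
          c * real k - C0 \<le> \<mu> k \<and> c * real k - C0 \<le> real k * h)"

text \<open>The number \<open>I\<close> is the integral of \<open>Q\<close> over the half-line; it does not depend on the sampled progression,
  and this makes sums over different progressions comparable. With a primitive \<open>\<Phi>\<close>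
  of \<open>Q\<close>, the error at step \<open>k\<close> is \<open>\<Phi> ((k + 1) h) - \<Phi> (k h) - h Q (\<mu> k)\<close>; the
  differences telescope, and each error is bounded by the mean value theorem and the decay of the derivative.
  If \<open>K = \<sigma> K'\<close>, the first term of the bound is of order \<open>\<epsilon> / \<sigma>\<close>, which is
  a small multiple of the size \<open>1 / \<sigma>\<close> of the sums, and the second one stays bounded.\<close>

lemma Riemann_sum_error:
  fixes Q :: "complex \<Rightarrow> complex" and K0 K \<sigma> :: real
  assumes holQ: "Q holomorphic_on UNIV" and "0 < \<sigma>"
    and Q: "\<And>t. 0 \<le> t \<Longrightarrow> cmod (Q (of_real t)) \<le> K0 * exp (- \<sigma> * t)"
    and Q': "\<And>t. 0 \<le> t \<Longrightarrow> cmod (deriv Q (of_real t)) \<le> K * exp (- \<sigma> * t)"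
  shows "\<exists>I. \<forall>h \<mu> \<epsilon> C c C0. near_progression h \<epsilon> C c C0 \<mu> \<longrightarrow>
      summable (\<lambda>k. Q (of_real (\<mu> k))) \<and>
      cmod (of_real h * (\<Sum>k. Q (of_real (\<mu> k))) - I) \<le>
        h * K * exp (\<sigma> * C0) * (\<epsilon> * (1 + 1 / (\<sigma> * c))\<^sup>2 + (C + h) * (1 + 1 / (\<sigma> * c)))"
proof -
  obtain \<Phi> where \<Phi>: "\<And>w. (\<Phi> has_field_derivative Q w) (at w)"
    using holomorphic_convex_primitive'[OF convex_UNIV open_UNIV holQ] by auto
  have dQ: "(Q has_field_derivative deriv Q w) (at w)" for w
    using holQ holomorphic_derivI by blast
  have "0 \<le> K0" using order_trans[OF norm_ge_zero Q[of 0]] by simp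
  have "0 \<le> K" using order_trans[OF norm_ge_zero Q'[of 0]] by simp
  have \<Phi>_diff: "cmod (\<Phi> (of_real x) - \<Phi> (of_real y)) \<le> K0 * exp (- \<sigma> * y) * (x - y)"
    if "0 \<le> y" "y \<le> x" for x y
  proof -
    have "cmod (\<Phi> (of_real x) - \<Phi> (of_real y)) \<le> K0 * exp (- \<sigma> * y) * \<bar>x - y\<bar>"
    proof (rule field_differentiable_bound_real_axis[OF \<Phi>])
      fix t assume "min x y \<le> t" "t \<le> max x y"
      then have "y \<le> t" using that by simp
      then have "K0 * exp (- \<sigma> * t) \<le> K0 * exp (- \<sigma> * y)"
        using \<open>0 \<le> K0\<close> \<open>0 < \<sigma>\<close> by (intro mult_left_mono) auto
      then show "cmod (Q (of_real t)) \<le> K0 * exp (- \<sigma> * y)"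
        using Q[of t] that \<open>y \<le> t\<close> by linarith
    qed
    then show ?thesis using that by simp
  qed
  have Q_diff: "cmod (Q (of_real x) - Q (of_real y)) \<le> K * exp (- \<sigma> * d) * \<bar>x - y\<bar>"
    if "0 \<le> x" "0 \<le> y" "d \<le> x" "d \<le> y" for x y d
  proof (rule field_differentiable_bound_real_axis[OF dQ])
    fix t assume "min x y \<le> t" "t \<le> max x y"
    then have "d \<le> t" "0 \<le> t" using that by auto
    then have "K * exp (- \<sigma> * t) \<le> K * exp (- \<sigma> * d)"
      using \<open>0 \<le> K\<close> \<open>0 < \<sigma>\<close> by (intro mult_left_mono) auto
    then show "cmod (deriv Q (of_real t)) \<le> K * exp (- \<sigma> * d)"
      using Q'[OF \<open>0 \<le> t\<close>] by linarith
  qed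
  have "summable (\<lambda>k. \<Phi> (of_real (real (Suc k))) - \<Phi> (of_real (real k)))"
  proof (rule summable_comparison_test')
    show "summable (\<lambda>k. K0 * exp (- (\<sigma> * real k)))"
      using suminf_exp_le(1)[OF \<open>0 < \<sigma>\<close>] by (rule summable_mult)
    show "cmod (\<Phi> (of_real (real (Suc k))) - \<Phi> (of_real (real k))) \<le> K0 * exp (- (\<sigma> * real k))" for k
      using \<Phi>_diff[of "real k" "real (Suc k)"] by simp
  qed
  then have "convergent (\<lambda>k. \<Phi> (of_real (real k)) - \<Phi> (of_real (real 0)))"
    unfolding summable_iff_convergent
      sum_lessThan_telescope[of "\<lambda>k. \<Phi> (of_real (real k))"] .
  then obtain J' where "(\<lambda>k. \<Phi> (of_real (real k)) - \<Phi> (of_real (real 0))) \<longlonglongrightarrow> J'"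
    by (auto simp: convergent_def)
  from tendsto_add[OF this tendsto_const[of "\<Phi> (of_real (real 0))"]]
  obtain J where J: "(\<lambda>k. \<Phi> (of_real (real k))) \<longlonglongrightarrow> J" by auto
  \<comment> \<open>The primitive has the same limit along every progression, since it changes little between consecutive integers far out.\<close>
  have J_real: "(\<lambda>k. \<Phi> (of_real (real k * h))) \<longlonglongrightarrow> J" if "0 < h" for h
  proof -
    define r where "r k = nat \<lfloor>real k * h\<rfloor>" for k
    have r: "real (r k) \<le> real k * h" "real k * h \<le> real (r k) + 1" for k
      using that by (auto simp: r_def)
    have "filterlim r at_top sequentially"
    proof -
      have "filterlim (\<lambda>k. real k * h) at_top sequentially"
        using that by (intro filterlim_at_top_mult_tendsto_pos[OF tendsto_const] filterlim_real_sequentially) auto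
      then show ?thesis unfolding r_def
        by (intro filterlim_compose[OF filterlim_nat_sequentially] filterlim_compose[OF filterlim_floor_sequentially])
    qed
    note r_lim = this
    have 1: "(\<lambda>k. \<Phi> (of_real (real (r k)))) \<longlonglongrightarrow> J"
      using filterlim_compose[OF J r_lim] .
    have "(\<lambda>k. exp (- (\<sigma> * real k))) \<longlonglongrightarrow> 0"
      by (rule summable_LIMSEQ_zero[OF suminf_exp_le(1)[OF \<open>0 < \<sigma>\<close>]])
    from tendsto_mult[OF tendsto_const filterlim_compose[OF this r_lim]]
    have 2: "(\<lambda>k. K0 * exp (- \<sigma> * real (r k))) \<longlonglongrightarrow> K0 * 0" by simp
    have "(\<lambda>k. \<Phi> (of_real (real k * h)) - \<Phi> (of_real (real (r k)))) \<longlonglongrightarrow> 0"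
    proof (rule Lim_null_comparison)
      show "(\<lambda>k. K0 * exp (- \<sigma> * real (r k))) \<longlonglongrightarrow> 0" using 2 by simp
      have "cmod (\<Phi> (of_real (real k * h)) - \<Phi> (of_real (real (r k)))) \<le> K0 * exp (- \<sigma> * real (r k))" for k
      proof -
        have "K0 * exp (- \<sigma> * real (r k)) * (real k * h - real (r k)) \<le> K0 * exp (- \<sigma> * real (r k)) * 1"
          using r[of k] \<open>0 \<le> K0\<close> by (intro mult_left_mono) auto
        then show ?thesis using \<Phi>_diff[OF _ r(1), of k] by simp
      qed
      then show "\<forall>\<^sub>F k in sequentially. cmod (\<Phi> (of_real (real k * h)) - \<Phi> (of_real (real (r k))))
          \<le> K0 * exp (- \<sigma> * real (r k))" by simp
    qed
    from tendsto_add[OF this 1] show ?thesis by simp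
  qed
  have "summable (\<lambda>k. Q (of_real (\<mu> k))) \<and>
      cmod (of_real h * (\<Sum>k. Q (of_real (\<mu> k))) - (J - \<Phi> 0)) \<le>
        h * K * exp (\<sigma> * C0) * (\<epsilon> * (1 + 1 / (\<sigma> * c))\<^sup>2 + (C + h) * (1 + 1 / (\<sigma> * c)))"
    if near: "near_progression h \<epsilon> C c C0 \<mu>" for h \<mu> \<epsilon> C c C0
  proof -
    have h: "0 < h" "0 \<le> \<epsilon>" "0 < c" and \<mu>: "\<And>k. 0 \<le> \<mu> k"
      "\<And>k. \<bar>\<mu> k - real k * h\<bar> \<le> \<epsilon> * real k + C"
      "\<And>k. c * real k - C0 \<le> \<mu> k" "\<And>k. c * real k - C0 \<le> real k * h"
      using near unfolding near_progression_def by blast+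
    have "0 \<le> C" using \<mu>(2)[of 0] by simp
    have \<sigma>c: "0 < \<sigma> * c" using \<open>0 < \<sigma>\<close> h by simp
    define e where "e k = exp (- (\<sigma> * c * real k))" for k
    have e: "exp (- \<sigma> * (c * real k - C0)) = exp (\<sigma> * C0) * e k" for k
      by (simp add: e_def exp_add[symmetric] algebra_simps)
    have sum_e: "summable e" "summable (\<lambda>k. (real k + 1) * e k)"
      and le_e: "(\<Sum>k. e k) \<le> 1 + 1 / (\<sigma> * c)" "(\<Sum>k. (real k + 1) * e k) \<le> (1 + 1 / (\<sigma> * c))\<^sup>2"
      unfolding e_def using suminf_exp_le[OF \<sigma>c] suminf_linear_exp_le[OF \<sigma>c] by auto
    have "summable (\<lambda>k. K0 * exp (\<sigma> * C0) * e k)" by (intro summable_mult sum_e)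
    moreover have "cmod (Q (of_real (\<mu> k))) \<le> K0 * exp (\<sigma> * C0) * e k" for k
    proof -
      have "K0 * exp (- \<sigma> * \<mu> k) \<le> K0 * exp (- \<sigma> * (c * real k - C0))"
        using \<open>0 \<le> K0\<close> \<open>0 < \<sigma>\<close> \<mu>(3) by (intro mult_left_mono) auto
      then show ?thesis using Q[OF \<mu>(1), of k] e[of k] by (simp add: mult.assoc)
    qed
    ultimately have sumQ: "summable (\<lambda>k. Q (of_real (\<mu> k)))"
      by (rule summable_comparison_test')
    define D where "D k = \<Phi> (of_real (real (Suc k) * h)) - \<Phi> (of_real (real k * h))
        - of_real h * Q (of_real (\<mu> k))" for k
    define b where "b k = h * K * exp (\<sigma> * C0) * (\<epsilon> * ((real k + 1) * e k) + (C + h) * e k)" for k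
    have D_le: "cmod (D k) \<le> b k" for k
    proof -
      \<comment> \<open>\<open>F\<close> has the derivative \<open>Q - Q (\<mu> k)\<close>, and its increment over the step is \<open>D k\<close>.\<close>
      define F where "F w = \<Phi> w - w * Q (of_real (\<mu> k))" for w
      define B where "B = K * exp (- \<sigma> * (c * real k - C0)) * (\<epsilon> * real k + C + h)"
      have dF: "(F has_field_derivative Q w - Q (of_real (\<mu> k))) (at w)" for w
        unfolding F_def by (auto intro!: derivative_eq_intros \<Phi>)
      have "cmod (F (of_real (real (Suc k) * h)) - F (of_real (real k * h)))
          \<le> B * \<bar>real (Suc k) * h - real k * h\<bar>"
      proof (rule field_differentiable_bound_real_axis[OF dF])
        fix t assume t: "min (real (Suc k) * h) (real k * h) \<le> t" "t \<le> max (real (Suc k) * h) (real k * h)"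
        have t1: "real k * h \<le> t" "t \<le> real k * h + h"
          using t h by (auto simp: min_def max_def algebra_simps split: if_splits)
        then have "0 \<le> t" using h by (meson mult_nonneg_nonneg of_nat_0_le_iff less_imp_le order_trans)
        have "cmod (Q (of_real t) - Q (of_real (\<mu> k))) \<le> K * exp (- \<sigma> * (c * real k - C0)) * \<bar>t - \<mu> k\<bar>"
          using \<mu> \<open>0 \<le> t\<close> order_trans[OF \<mu>(4) t1(1)] by (intro Q_diff)
        also have "\<dots> \<le> B"
          unfolding B_def using \<mu>(2)[of k] t1 \<open>0 \<le> K\<close> by (intro mult_left_mono) auto
        finally show "cmod (Q (of_real t) - Q (of_real (\<mu> k))) \<le> B" .
      qed
      moreover have "F (of_real (real (Suc k) * h)) - F (of_real (real k * h)) = D k"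
        by (simp add: F_def D_def algebra_simps)
      moreover have "\<bar>real (Suc k) * h - real k * h\<bar> = h" using h by (simp add: algebra_simps)
      ultimately have "cmod (D k) \<le> B * h" by simp
      also have "\<dots> = (h * K * exp (\<sigma> * C0) * e k) * (\<epsilon> * real k + (C + h))"
        unfolding B_def e by (simp add: algebra_simps)
      also have "\<dots> \<le> (h * K * exp (\<sigma> * C0) * e k) * (\<epsilon> * (real k + 1) + (C + h))"
        using h \<open>0 \<le> K\<close> by (intro mult_left_mono add_mono) (auto simp: e_def)
      also have "\<dots> = b k" by (simp add: b_def algebra_simps)
      finally show ?thesis .
    qed
    have b_sums: "b sums (h * K * exp (\<sigma> * C0) *
        (\<epsilon> * (\<Sum>k. (real k + 1) * e k) + (C + h) * (\<Sum>k. e k)))"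
      unfolding b_def by (intro sums_mult sums_add summable_sums sum_e)
    have "D sums (J - \<Phi> (of_real (real 0 * h)) - of_real h * (\<Sum>k. Q (of_real (\<mu> k))))"
      unfolding D_def
      by (intro sums_diff telescope_sums[OF J_real[OF h(1)]] sums_mult summable_sums sumQ)
    then have "cmod (J - \<Phi> 0 - of_real h * (\<Sum>k. Q (of_real (\<mu> k)))) = cmod (\<Sum>k. D k)"
      by (simp add: sums_iff)
    also have "\<dots> \<le> (\<Sum>k. b k)"
      using D_le b_sums by (intro norm_suminf_le) (auto simp: sums_iff)
    also have "\<dots> \<le> h * K * exp (\<sigma> * C0) * (\<epsilon> * (1 + 1 / (\<sigma> * c))\<^sup>2 + (C + h) * (1 + 1 / (\<sigma> * c)))"
      unfolding sums_unique[OF b_sums, symmetric] using h \<open>0 \<le> K\<close> \<open>0 \<le> C\<close> le_e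
      by (intro mult_left_mono add_mono mult_nonneg_nonneg) auto
    finally show ?thesis using sumQ by (simp add: norm_minus_commute)
  qed
  then show ?thesis by (intro exI[of _ "J - \<Phi> 0"] allI impI)
qed

section \<open>Bessel bounds and frames in the sequence space\<close>

lemma l2_norm_power2: "x \<in> l2 \<Longrightarrow> (l2_norm x)\<^sup>2 = (\<Sum>m. (cmod (x m))\<^sup>2)"
  unfolding l2_norm_def l2_def by (simp add: suminf_nonneg)

lemma l2_partial_le: "x \<in> l2 \<Longrightarrow> finite A \<Longrightarrow> (\<Sum>m\<in>A. (cmod (x m))\<^sup>2) \<le> (l2_norm x)\<^sup>2"
  unfolding l2_norm_power2 by (rule sum_le_suminf) (auto simp: l2_def)

lemma l2_restrict:
  assumes "x \<in> l2"
  shows "(\<lambda>m. if P m then x m else 0) \<in> l2"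
proof -
  have "summable (\<lambda>m. (cmod (if P m then x m else 0))\<^sup>2)"
    by (rule summable_comparison_test'[of "\<lambda>m. (cmod (x m))\<^sup>2" 0])
       (use assms in \<open>auto simp: l2_def\<close>)
  then show ?thesis by (simp add: l2_def)
qed

lemma l2_finite_support:
  assumes "\<And>m. N \<le> m \<Longrightarrow> x m = 0"
  shows "x \<in> l2" "(l2_norm x)\<^sup>2 = (\<Sum>m<N. (cmod (x m))\<^sup>2)"
    "l2_inner x y = (\<Sum>m<N. x m * cnj (y m))"
proof -
  have "summable (\<lambda>m. (cmod (x m))\<^sup>2)"
    by (rule summable_finite[of "{..<N}"]) (use assms in auto)
  then show "x \<in> l2" by (simp add: l2_def)
  then show "(l2_norm x)\<^sup>2 = (\<Sum>m<N. (cmod (x m))\<^sup>2)"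
    unfolding l2_norm_power2[OF \<open>x \<in> l2\<close>] by (intro suminf_finite) (use assms in auto)
  show "l2_inner x y = (\<Sum>m<N. x m * cnj (y m))"
    unfolding l2_inner_def by (intro suminf_finite) (use assms in auto)
qed

lemma norm_add_power2_le:
  "(norm (x + y :: 'a::real_normed_vector))\<^sup>2 \<le> 2 * (norm x)\<^sup>2 + 2 * (norm y)\<^sup>2"
proof -
  have "(norm (x + y))\<^sup>2 \<le> (norm x + norm y)\<^sup>2"
    by (intro power_mono norm_triangle_ineq) auto
  also have "\<dots> \<le> 2 * (norm x)\<^sup>2 + 2 * (norm y)\<^sup>2"
    using sum_squares_ge_zero[of "norm x - norm y" 0] by (simp add: power2_eq_square algebra_simps)
  finally show ?thesis .
qed

lemma l2_inner_summable:
  assumes "x \<in> l2" "y \<in> l2"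
  shows "summable (\<lambda>m. norm (x m * cnj (y m)))"
proof (rule summable_comparison_test'[of "\<lambda>m. (cmod (x m))\<^sup>2 + (cmod (y m))\<^sup>2" 0])
  show "summable (\<lambda>m. (cmod (x m))\<^sup>2 + (cmod (y m))\<^sup>2)"
    using assms by (intro summable_add) (auto simp: l2_def)
  show "norm (norm (x m * cnj (y m))) \<le> (cmod (x m))\<^sup>2 + (cmod (y m))\<^sup>2" for m
  proof -
    have "0 \<le> cmod (x m) * cmod (y m)" by simp
    then show ?thesis
      using sum_squares_bound[of "cmod (x m)" "cmod (y m)"]
      unfolding norm_mult complex_mod_cnj real_norm_def abs_mult abs_norm_cancel by linarith
  qed
qed

lemma l2_inner_add:
  assumes "x \<in> l2" "y \<in> l2" "f \<in> l2"
  shows "l2_inner (\<lambda>m. x m + y m) f = l2_inner x f + l2_inner y f"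
  unfolding l2_inner_def
  using suminf_add[OF l2_inner_summable[OF assms(1,3), THEN summable_norm_cancel]
      l2_inner_summable[OF assms(2,3), THEN summable_norm_cancel]]
  by (simp add: algebra_simps)

definition energy :: "(nat \<Rightarrow> nat \<Rightarrow> complex) \<Rightarrow> (nat \<Rightarrow> complex) \<Rightarrow> real" where
  "energy f h = (\<Sum>k. (cmod (l2_inner h (f k)))\<^sup>2)"

definition Bessel :: "(nat \<Rightarrow> nat \<Rightarrow> complex) \<Rightarrow> real \<Rightarrow> bool" where
  "Bessel f B \<longleftrightarrow> 0 \<le> B \<and> (\<forall>k. f k \<in> l2) \<and>
     (\<forall>h\<in>l2. summable (\<lambda>k. (cmod (l2_inner h (f k)))\<^sup>2) \<and> energy f h \<le> B * (l2_norm h)\<^sup>2)"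

lemma energy_split_le:
  assumes f: "Bessel f B" and x: "x \<in> l2" and y: "y \<in> l2" and h: "h \<in> l2"
    and eq: "\<And>m. h m = x m + y m"
  shows "energy f h \<le> 2 * energy f x + 2 * energy f y"
proof -
  have sx: "summable (\<lambda>k. (cmod (l2_inner x (f k)))\<^sup>2)"
    and sy: "summable (\<lambda>k. (cmod (l2_inner y (f k)))\<^sup>2)"
    and sh: "summable (\<lambda>k. (cmod (l2_inner h (f k)))\<^sup>2)"
    using f x y h by (auto simp: Bessel_def)
  have "h = (\<lambda>m. x m + y m)" using eq by auto
  then have "l2_inner h (f k) = l2_inner x (f k) + l2_inner y (f k)" for k
    using l2_inner_add[OF x y] f by (simp add: Bessel_def)
  then have "(cmod (l2_inner h (f k)))\<^sup>2 \<le>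
      2 * (cmod (l2_inner x (f k)))\<^sup>2 + 2 * (cmod (l2_inner y (f k)))\<^sup>2" for k
    using norm_add_power2_le by metis
  then have "energy f h \<le> (\<Sum>k. 2 * (cmod (l2_inner x (f k)))\<^sup>2 + 2 * (cmod (l2_inner y (f k)))\<^sup>2)"
    unfolding energy_def using sh sx sy
    by (intro suminf_le) (auto intro!: summable_add summable_mult)
  also have "\<dots> = 2 * energy f x + 2 * energy f y"
    unfolding energy_def using sx sy
    by (subst suminf_add[symmetric]) (auto intro!: summable_mult simp: suminf_mult)
  finally show ?thesis .
qed

lemma Bessel_from_finite:
  assumes f: "\<And>k. f k \<in> l2" and "0 \<le> B"
    and fin: "\<And>N K (h :: nat \<Rightarrow> complex).
      (\<Sum>k<K. (cmod (\<Sum>m<N. h m * cnj (f k m)))\<^sup>2) \<le> B * (\<Sum>m<N. (cmod (h m))\<^sup>2)"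
  shows "Bessel f B"
proof -
  have part: "(\<Sum>k<K. (cmod (l2_inner h (f k)))\<^sup>2) \<le> B * (l2_norm h)\<^sup>2" if h: "h \<in> l2" for h K
  proof (rule LIMSEQ_le_const2)
    show "(\<lambda>N. \<Sum>k<K. (cmod (\<Sum>m<N. h m * cnj (f k m)))\<^sup>2)
        \<longlonglongrightarrow> (\<Sum>k<K. (cmod (l2_inner h (f k)))\<^sup>2)"
      unfolding l2_inner_def
      by (intro tendsto_intros summable_LIMSEQ l2_inner_summable[OF h f, THEN summable_norm_cancel])
    show "\<exists>N0. \<forall>N\<ge>N0. (\<Sum>k<K. (cmod (\<Sum>m<N. h m * cnj (f k m)))\<^sup>2) \<le> B * (l2_norm h)\<^sup>2"
      using fin l2_partial_le[OF h] \<open>0 \<le> B\<close>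
      by (meson finite_lessThan mult_left_mono order_trans)
  qed
  have "summable (\<lambda>k. (cmod (l2_inner h (f k)))\<^sup>2)" if "h \<in> l2" for h
    using part[OF that] by (intro summableI_nonneg_bounded) auto
  then show ?thesis
    unfolding Bessel_def energy_def using f \<open>0 \<le> B\<close> part by (auto intro: suminf_le_const)
qed

text \<open>Truncation loses a factor of 2, from the inequality \<open>|a + b|^2 \<le> 2 |a|^2 + 2 |b|^2\<close>.\<close>

lemma lower_bound_from_finite:
  assumes f: "Bessel f B"
    and fin: "\<And>N (h :: nat \<Rightarrow> complex). (\<forall>m<M. h m = 0) \<Longrightarrow>
      A * (\<Sum>m<N. (cmod (h m))\<^sup>2) \<le> (\<Sum>k. (cmod (\<Sum>m<N. h m * cnj (f k m)))\<^sup>2)"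
    and h: "h \<in> l2" "\<forall>m<M. h m = 0"
  shows "A / 2 * (l2_norm h)\<^sup>2 \<le> energy f h"
proof -
  define S where "S N = (\<Sum>m<N. (cmod (h m))\<^sup>2)" for N
  have S_lim: "S \<longlonglongrightarrow> (l2_norm h)\<^sup>2"
    unfolding S_def l2_norm_power2[OF h(1)] using h(1) by (intro summable_LIMSEQ) (auto simp: l2_def)
  have "A * S N \<le> 2 * energy f h + 2 * (B * ((l2_norm h)\<^sup>2 - S N))" for N
  proof -
    define x where "x m = (if m < N then h m else 0)" for m
    define y where "y m = (if N \<le> m then - h m else 0)" for m
    have x: "x \<in> l2" and y: "y \<in> l2"
      using l2_restrict[of h] l2_restrict[of "\<lambda>m. - h m"] h(1) by (auto simp: x_def y_def l2_def)
    have "(l2_norm y)\<^sup>2 = (\<Sum>m. (cmod (h m))\<^sup>2 - (cmod (x m))\<^sup>2)"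
      unfolding l2_norm_power2[OF y] by (intro suminf_cong) (auto simp: x_def y_def)
    also have "\<dots> = (l2_norm h)\<^sup>2 - (l2_norm x)\<^sup>2"
      unfolding l2_norm_power2[OF x] l2_norm_power2[OF h(1)] using x h(1)
      by (intro suminf_diff[symmetric]) (auto simp: l2_def)
    also have "(l2_norm x)\<^sup>2 = S N"
      by (subst l2_finite_support(2)[of N]) (auto simp: x_def S_def)
    finally have ny: "(l2_norm y)\<^sup>2 = (l2_norm h)\<^sup>2 - S N" .
    have "l2_inner x (f k) = (\<Sum>m<N. h m * cnj (f k m))" for k
      by (subst l2_finite_support(3)[of N]) (auto simp: x_def)
    then have "A * S N \<le> energy f x"
      unfolding energy_def S_def using fin[OF h(2), of N] by simp
    also have "\<dots> \<le> 2 * energy f h + 2 * energy f y"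
      by (rule energy_split_le[OF f h(1) y x]) (auto simp: x_def y_def)
    also have "energy f y \<le> B * (l2_norm y)\<^sup>2" using f y by (simp add: Bessel_def)
    finally show ?thesis using ny by simp
  qed
  moreover have "(\<lambda>N. A * S N) \<longlonglongrightarrow> A * (l2_norm h)\<^sup>2"
    by (intro tendsto_intros S_lim)
  moreover have "(\<lambda>N. 2 * energy f h + 2 * (B * ((l2_norm h)\<^sup>2 - S N)))
      \<longlonglongrightarrow> 2 * energy f h + 2 * (B * ((l2_norm h)\<^sup>2 - (l2_norm h)\<^sup>2))"
    by (intro tendsto_intros S_lim)
  ultimately have "A * (l2_norm h)\<^sup>2 \<le> 2 * energy f h + 2 * (B * ((l2_norm h)\<^sup>2 - (l2_norm h)\<^sup>2))"
    using LIMSEQ_le by blast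
  then show ?thesis by simp
qed

text \<open>The map from \<open>h\<close> to its coefficients is bounded below on a closed subspace of finite codimension, so that it
  has closed range, and injectivity implies a lower bound on the whole space. In detail: unit vectors whose energies tend to
  0 have a subsequence that converges in each coordinate; the limit has energy 0, hence is 0. So the first \<open>M\<close>
  coordinates tend to 0, and the remaining parts, of norm close to 1, have energies that tend to 0, contrary to the
  bound on tails. The assumption that the vectors are summable makes coordinatewise convergence of bounded sequences sufficient for
  convergence of the coefficients.\<close>

lemma frame_from_tail_bound:
  assumes f: "Bessel f B" and l1: "\<And>k. summable (\<lambda>m. cmod (f k m))"
    and "0 < A"
    and tail: "\<And>h. h \<in> l2 \<Longrightarrow> (\<forall>m<M. h m = 0) \<Longrightarrow> A * (l2_norm h)\<^sup>2 \<le> energy f h"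
    and inj: "\<And>h. h \<in> l2 \<Longrightarrow> (\<forall>k. l2_inner h (f k) = 0) \<Longrightarrow> \<forall>m. h m = 0"
  shows "l2_frame f"
proof -
  have sq_le_energy: "(cmod (l2_inner h (f k)))\<^sup>2 \<le> energy f h" if "h \<in> l2" for h k
    unfolding energy_def using f that sum_le_suminf[of "\<lambda>k. (cmod (l2_inner h (f k)))\<^sup>2" "{k}"]
    by (simp add: Bessel_def)
  have energy_nonneg: "0 \<le> energy f h" if "h \<in> l2" for h
    using sq_le_energy[OF that, of 0] zero_le_power2[of "cmod (l2_inner h (f 0))"] by linarith
  have "\<exists>A>0. \<forall>h\<in>l2. A * (l2_norm h)\<^sup>2 \<le> energy f h"
  proof (rule ccontr)
    assume contra: "\<not> (\<exists>A>0. \<forall>h\<in>l2. A * (l2_norm h)\<^sup>2 \<le> energy f h)"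
    have "\<exists>h\<in>l2. (l2_norm h)\<^sup>2 = 1 \<and> energy f h \<le> 1 / (real r + 1)" for r
    proof -
      obtain h where h: "h \<in> l2" "energy f h < 1 / (real r + 1) * (l2_norm h)\<^sup>2"
        using contra by (metis divide_pos_pos not_le_imp_less of_nat_0_le_iff add_nonneg_pos zero_less_one)
      have pos: "0 < (l2_norm h)\<^sup>2"
        using h energy_nonneg[OF h(1)] by (auto simp: zero_less_mult_iff zero_le_mult_iff less_le)
      define c where "c = 1 / l2_norm h"
      have c2: "c\<^sup>2 = 1 / (l2_norm h)\<^sup>2" by (simp add: c_def power_divide)
      define u where "u m = of_real c * h m" for m
      have u: "u \<in> l2"
        using h(1) unfolding l2_def u_def by (auto simp: norm_mult power_mult_distrib intro!: summable_mult)
      have "(l2_norm u)\<^sup>2 = c\<^sup>2 * (l2_norm h)\<^sup>2"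
        unfolding l2_norm_power2[OF u] l2_norm_power2[OF h(1)]
        using h(1) by (simp add: u_def norm_mult power_mult_distrib suminf_mult l2_def)
      then have 1: "(l2_norm u)\<^sup>2 = 1" using pos c2 by simp
      have "l2_inner u (f k) = of_real c * l2_inner h (f k)" for k
        unfolding l2_inner_def u_def
        using l2_inner_summable[OF h(1), THEN summable_norm_cancel, of "f k"] f
        by (simp add: Bessel_def mult.assoc suminf_mult)
      then have "energy f u = c\<^sup>2 * energy f h"
        unfolding energy_def using f h(1)
        by (simp add: norm_mult power_mult_distrib suminf_mult Bessel_def)
      also have "\<dots> \<le> c\<^sup>2 * (1 / (real r + 1) * (l2_norm h)\<^sup>2)"
        using h(2) by (intro mult_left_mono) auto
      also have "\<dots> = 1 / (real r + 1)" using pos c2 by simp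
      finally show ?thesis using u 1 by blast
    qed
    then obtain H where H: "\<And>r. H r \<in> l2" "\<And>r. (l2_norm (H r))\<^sup>2 = 1"
      "\<And>r. energy f (H r) \<le> 1 / (real r + 1)" by metis
    have H1: "cmod (H r m) \<le> 1" for r m
    proof -
      have "(cmod (H r m))\<^sup>2 \<le> 1\<^sup>2" using l2_partial_le[OF H(1), of "{m}" r] H(2) by simp
      then show ?thesis by (rule power2_le_imp_le) auto
    qed
    obtain \<kappa> where \<kappa>: "strict_mono (\<kappa> :: nat \<Rightarrow> nat)" "\<And>m. \<exists>l. (\<lambda>r. H (\<kappa> r) m) \<longlonglongrightarrow> l"
      using function_convergent_subsequence[of UNIV H 1] H1 by auto
    then obtain h where h: "\<And>m. (\<lambda>r. H (\<kappa> r) m) \<longlonglongrightarrow> h m" by metis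
    have "(\<Sum>m<N. (cmod (h m))\<^sup>2) \<le> 1" for N
    proof (rule LIMSEQ_le_const2)
      show "(\<lambda>r. \<Sum>m<N. (cmod (H (\<kappa> r) m))\<^sup>2) \<longlonglongrightarrow> (\<Sum>m<N. (cmod (h m))\<^sup>2)"
        by (intro tendsto_intros h)
      show "\<exists>r0. \<forall>r\<ge>r0. (\<Sum>m<N. (cmod (H (\<kappa> r) m))\<^sup>2) \<le> 1"
        using l2_partial_le[OF H(1)] H(2) by (metis finite_lessThan)
    qed
    then have "summable (\<lambda>m. (cmod (h m))\<^sup>2)" by (intro summableI_nonneg_bounded[of _ 1]) auto
    then have hl2: "h \<in> l2" by (simp add: l2_def)
    have en0: "(\<lambda>r. energy f (H (\<kappa> r))) \<longlonglongrightarrow> 0"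
    proof -
      have "(\<lambda>r. 1 / (real r + 1)) \<longlonglongrightarrow> 0"
        using LIMSEQ_inverse_real_of_nat by (simp add: inverse_eq_divide add.commute)
      then have lim: "(\<lambda>r. 1 / (real (\<kappa> r) + 1)) \<longlonglongrightarrow> 0"
        using LIMSEQ_subseq_LIMSEQ[OF _ \<kappa>(1), of "\<lambda>r. 1 / (real r + 1)"] by (simp add: o_def)
      show ?thesis
        by (rule tendsto_sandwich[OF always_eventually always_eventually tendsto_const lim])
           (use energy_nonneg[OF H(1)] H(3) in auto)
    qed
    have "l2_inner h (f k) = 0" for k
    proof -
      have "(\<lambda>r. l2_inner (H (\<kappa> r)) (f k)) \<longlonglongrightarrow> l2_inner h (f k)"
        unfolding l2_inner_def
      proof (rule tannerys_theorem[THEN conjunct2, THEN conjunct2, OF _ _ l1[of k]])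
        show "\<And>m. (\<lambda>r. H (\<kappa> r) m * cnj (f k m)) \<longlonglongrightarrow> h m * cnj (f k m)"
          by (intro tendsto_intros h)
        show "\<forall>\<^sub>F (m, r) in sequentially \<times>\<^sub>F sequentially. cmod (H (\<kappa> r) m * cnj (f k m)) \<le> cmod (f k m)"
          by (rule always_eventually)
             (auto simp: norm_mult intro!: mult_left_le_one_le H1)
      qed simp
      then have "(\<lambda>r. (cmod (l2_inner (H (\<kappa> r)) (f k)))\<^sup>2) \<longlonglongrightarrow> (cmod (l2_inner h (f k)))\<^sup>2"
        by (intro tendsto_intros)
      moreover have "(\<lambda>r. (cmod (l2_inner (H (\<kappa> r)) (f k)))\<^sup>2) \<longlonglongrightarrow> 0"
        by (rule tendsto_sandwich[OF _ _ tendsto_const en0]) (use sq_le_energy H(1) in auto)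
      ultimately have "(cmod (l2_inner h (f k)))\<^sup>2 = 0" by (rule LIMSEQ_unique)
      then show ?thesis by simp
    qed
    then have h0: "h m = 0" for m using inj[OF hl2] by blast
    define x where "x r m = (if m < M then - H (\<kappa> r) m else 0)" for r m
    define y where "y r m = (if M \<le> m then H (\<kappa> r) m else 0)" for r m
    have x: "x r \<in> l2" and y: "y r \<in> l2" for r
      using l2_restrict[of "H (\<kappa> r)"] l2_restrict[of "\<lambda>m. - H (\<kappa> r) m"] H(1)
      by (auto simp: x_def y_def l2_def)
    have nx: "(l2_norm (x r))\<^sup>2 = (\<Sum>m<M. (cmod (H (\<kappa> r) m))\<^sup>2)" for r
      by (subst l2_finite_support(2)[of M]) (auto simp: x_def)
    have "(\<lambda>r. (l2_norm (x r))\<^sup>2) \<longlonglongrightarrow> (\<Sum>m<M. (cmod (h m))\<^sup>2)"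
      unfolding nx by (intro tendsto_intros h)
    then have nx0: "(\<lambda>r. (l2_norm (x r))\<^sup>2) \<longlonglongrightarrow> 0" using h0 by simp
    have "A * (1 - (l2_norm (x r))\<^sup>2) \<le> 2 * energy f (H (\<kappa> r)) + 2 * (B * (l2_norm (x r))\<^sup>2)" for r
    proof -
      have "(l2_norm (y r))\<^sup>2 = (\<Sum>m. (cmod (H (\<kappa> r) m))\<^sup>2 - (cmod (x r m))\<^sup>2)"
        unfolding l2_norm_power2[OF y] by (intro suminf_cong) (auto simp: x_def y_def)
      also have "\<dots> = (l2_norm (H (\<kappa> r)))\<^sup>2 - (l2_norm (x r))\<^sup>2"
        unfolding l2_norm_power2[OF x] l2_norm_power2[OF H(1)] using x[of r] H(1)[of "\<kappa> r"]
        by (intro suminf_diff[symmetric]) (auto simp: l2_def)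
      finally have "A * (1 - (l2_norm (x r))\<^sup>2) = A * (l2_norm (y r))\<^sup>2" using H(2) by simp
      also have "\<dots> \<le> energy f (y r)" by (rule tail[OF y]) (simp add: y_def)
      also have "\<dots> \<le> 2 * energy f (H (\<kappa> r)) + 2 * energy f (x r)"
        by (rule energy_split_le[OF f H(1) x y]) (auto simp: x_def y_def)
      also have "energy f (x r) \<le> B * (l2_norm (x r))\<^sup>2" using f x by (simp add: Bessel_def)
      finally show ?thesis by simp
    qed
    then have "A * (1 - 0) \<le> 2 * 0 + 2 * (B * 0)"
      by (intro tendsto_le[of sequentially "\<lambda>r. 2 * energy f (H (\<kappa> r)) + 2 * (B * (l2_norm (x r))\<^sup>2)" _
            "\<lambda>r. A * (1 - (l2_norm (x r))\<^sup>2)"] tendsto_intros nx0 en0) auto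
    then show False using \<open>0 < A\<close> by simp
  qed
  then obtain A' where A': "0 < A'" "\<And>h. h \<in> l2 \<Longrightarrow> A' * (l2_norm h)\<^sup>2 \<le> energy f h" by blast
  have "0 \<le> B" and fl2: "\<forall>k. f k \<in> l2" using f by (auto simp: Bessel_def)
  have "summable (\<lambda>k. (cmod (l2_inner h (f k)))\<^sup>2) \<and>
      A' * (l2_norm h)\<^sup>2 \<le> (\<Sum>k. (cmod (l2_inner h (f k)))\<^sup>2) \<and>
      (\<Sum>k. (cmod (l2_inner h (f k)))\<^sup>2) \<le> (B + A') * (l2_norm h)\<^sup>2" if h: "h \<in> l2" for h
  proof -
    have "summable (\<lambda>k. (cmod (l2_inner h (f k)))\<^sup>2)" "energy f h \<le> B * (l2_norm h)\<^sup>2"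
      using f h by (auto simp: Bessel_def)
    moreover have "B * (l2_norm h)\<^sup>2 \<le> (B + A') * (l2_norm h)\<^sup>2"
      using A'(1) by (intro mult_right_mono) auto
    ultimately show ?thesis using A'(2)[OF h] unfolding energy_def by linarith
  qed
  moreover have "A' \<le> B + A'" using \<open>0 \<le> B\<close> by simp
  ultimately show ?thesis
    unfolding l2_frame_def using fl2 A'(1) by blast
qed

section \<open>Systems of exponentially decaying functions\<close>

lemma Schur_test_symmetric:
  fixes W :: "nat \<Rightarrow> nat \<Rightarrow> real" and x :: "nat \<Rightarrow> real"
  assumes "finite A" and W: "\<And>m m'. 0 \<le> W m m'" "\<And>m m'. W m m' = W m' m"
    and R: "\<And>m. m \<in> A \<Longrightarrow> (\<Sum>m'\<in>A. W m m') \<le> R"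
  shows "(\<Sum>m\<in>A. \<Sum>m'\<in>A. x m * x m' * W m m') \<le> R * (\<Sum>m\<in>A. (x m)\<^sup>2)"
proof -
  have "(\<Sum>m\<in>A. \<Sum>m'\<in>A. x m * x m' * W m m') \<le>
      (\<Sum>m\<in>A. \<Sum>m'\<in>A. ((x m)\<^sup>2 / 2 + (x m')\<^sup>2 / 2) * W m m')"
  proof (intro sum_mono mult_right_mono W)
    show "x m * x m' \<le> (x m)\<^sup>2 / 2 + (x m')\<^sup>2 / 2" for m m'
      using sum_squares_bound[of "x m" "x m'"] by simp
  qed
  also have "\<dots> = (\<Sum>m\<in>A. \<Sum>m'\<in>A. (x m)\<^sup>2 / 2 * W m m') + (\<Sum>m\<in>A. \<Sum>m'\<in>A. (x m')\<^sup>2 / 2 * W m m')"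
    by (simp add: distrib_right sum.distrib)
  also have "(\<Sum>m\<in>A. \<Sum>m'\<in>A. (x m')\<^sup>2 / 2 * W m m') = (\<Sum>m'\<in>A. \<Sum>m\<in>A. (x m')\<^sup>2 / 2 * W m' m)"
    by (subst sum.swap) (simp add: W(2))
  also have "(\<Sum>m\<in>A. \<Sum>m'\<in>A. (x m)\<^sup>2 / 2 * W m m') + \<dots> = (\<Sum>m\<in>A. (x m)\<^sup>2 * (\<Sum>m'\<in>A. W m m'))"
    unfolding sum_distrib_left sum.distrib[symmetric] by (intro sum.cong refl) simp
  also have "\<dots> \<le> (\<Sum>m\<in>A. (x m)\<^sup>2 * R)" by (intro sum_mono mult_left_mono R) auto
  finally show ?thesis by (simp add: sum_distrib_left mult.commute)
qed

text \<open>The sequence is \<open>k / d + o(k)\<close>, with the error bound stated for all \<open>k\<close> at once.\<close>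

definition asymptotic_density :: "(nat \<Rightarrow> real) \<Rightarrow> real \<Rightarrow> bool" where
  "asymptotic_density \<mu> d \<longleftrightarrow> 0 < d \<and> (\<forall>k. 0 \<le> \<mu> k) \<and>
     (\<forall>\<epsilon>>0. \<exists>D. \<forall>k. \<bar>\<mu> k - real k * (1 / d)\<bar> \<le> \<epsilon> * real k + D)"

text \<open>Linear growth with constants that depend on the sequence only; see \<open>near_progression\<close>.\<close>

lemma asymptotic_density_lower:
  assumes "asymptotic_density \<mu> d"
  obtains c D where "0 < c" "0 \<le> D" "\<And>k. c * real k - D \<le> \<mu> k" "\<And>k. c * real k - D \<le> real k * (1 / d)"
proof -
  define c where "c = 1 / (2 * d)"
  have d: "0 < d" and "0 < c" using assms by (auto simp: asymptotic_density_def c_def)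
  then obtain D where D: "\<And>k. \<bar>\<mu> k - real k * (1 / d)\<bar> \<le> c * real k + D"
    using assms unfolding asymptotic_density_def by blast
  have "0 \<le> D" using D[of 0] by simp
  have dc: "1 / d = 2 * c" by (simp add: c_def)
  have "c * real k - D \<le> \<mu> k" for k
    using D[of k] unfolding dc by (simp add: algebra_simps abs_le_iff)
  moreover have "c * real k - D \<le> real k * (1 / d)" for k
    unfolding dc using \<open>0 \<le> D\<close> \<open>0 < c\<close> mult_nonneg_nonneg[of c "real k"] by (simp add: algebra_simps)
  ultimately show ?thesis using that \<open>0 < c\<close> \<open>0 \<le> D\<close> by blast
qed

lemma lacunary_bounded_in_l2:
  assumes S: "lacunary S" and f: "\<And>m. cmod (f m) \<le> C * sqrt (S m)"
  shows "f \<in> l2" "summable (\<lambda>m. cmod (f m))"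
proof -
  have S1: "0 < S m" "S m \<le> 1" for m using S by (auto simp: lacunary_def)
  have sum: "summable (\<lambda>m. sqrt (S m))" by (rule lacunary_summable_sqrt[OF S])
  show "summable (\<lambda>m. cmod (f m))"
    by (rule summable_comparison_test'[of "\<lambda>m. C * sqrt (S m)" 0]) (use f sum in auto)
  have "summable (\<lambda>m. (cmod (f m))\<^sup>2)"
  proof (rule summable_comparison_test'[of "\<lambda>m. C\<^sup>2 * sqrt (S m)" 0])
    show "summable (\<lambda>m. C\<^sup>2 * sqrt (S m))" using sum by (rule summable_mult)
    fix m
    have "(cmod (f m))\<^sup>2 \<le> (C * sqrt (S m))\<^sup>2" using f by (intro power_mono) auto
    also have "\<dots> = C\<^sup>2 * S m" using S1[of m] by (simp add: power_mult_distrib)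
    also have "\<dots> \<le> C\<^sup>2 * sqrt (S m)"
      using S1[of m] by (intro mult_left_mono real_le_rsqrt) (auto simp: power2_eq_square mult_left_le)
    finally show "norm ((cmod (f m))\<^sup>2) \<le> C\<^sup>2 * sqrt (S m)" by simp
  qed
  then show "f \<in> l2" by (simp add: l2_def)
qed

text \<open>Summing \<open>exp (- (s + s') \<mu> k / 2)\<close> over \<open>k\<close> gives at most a constant times
  \<open>1 / (s + s')\<close>, so that the Gram matrix is dominated by the matrix of \<open>lacunary_kernel_bound\<close>.\<close>

lemma exp_family_Bessel:
  assumes S: "lacunary S" and \<mu>: "asymptotic_density \<mu> d"
    and f: "\<And>k m. cmod (f k m) \<le> C * sqrt (S m) * exp (- (S m * \<mu> k / 2))"
  obtains B where "Bessel f B"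
proof -
  have S1: "0 < S m" "S m \<le> 1" for m using S by (auto simp: lacunary_def)
  have \<mu>0: "0 \<le> \<mu> k" for k using \<mu> by (simp add: asymptotic_density_def)
  have "0 \<le> C" using order_trans[OF norm_ge_zero f[of 0 0]] S1[of 0] by (simp add: zero_le_mult_iff)
  obtain c D where c: "0 < c" "0 \<le> D" "\<And>k. c * real k - D \<le> \<mu> k"
    using asymptotic_density_lower[OF \<mu>] by metis
  obtain R where R: "0 \<le> R" "\<And>m A. finite A \<Longrightarrow> (\<Sum>m'\<in>A. sqrt (S m * S m') / (S m + S m')) \<le> R"
    using lacunary_kernel_bound[OF S] by metis
  have fl2: "f k \<in> l2" for k
  proof (rule lacunary_bounded_in_l2[OF S])
    show "cmod (f k m) \<le> C * sqrt (S m)" for m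
    proof -
      have "C * sqrt (S m) * exp (- (S m * \<mu> k / 2)) \<le> C * sqrt (S m) * 1"
        using \<open>0 \<le> C\<close> S1[of m] \<mu>0[of k] by (intro mult_left_mono) auto
      then show ?thesis using f[of k m] by simp
    qed
  qed
  define G where "G = exp D * (1 + 1 / c)"
  have "0 \<le> G" using c by (simp add: G_def)
  have exp_sum: "(\<Sum>k<K. exp (- (\<sigma> * \<mu> k))) \<le> G / \<sigma>" if "0 < \<sigma>" "\<sigma> \<le> 1" for \<sigma> K
  proof -
    have \<sigma>c: "0 < \<sigma> * c" using that c by simp
    have "(\<Sum>k<K. exp (- (\<sigma> * \<mu> k))) \<le> (\<Sum>k<K. exp D * exp (- (\<sigma> * c * real k)))"
    proof (rule sum_mono)
      fix k
      have "\<sigma> * (c * real k - D) \<le> \<sigma> * \<mu> k" using c(3) that by (intro mult_left_mono) auto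
      moreover have "\<sigma> * D \<le> D" using that c by (intro mult_left_le_one_le) auto
      ultimately have "- (\<sigma> * \<mu> k) \<le> D + - (\<sigma> * c * real k)" by (simp add: algebra_simps)
      then show "exp (- (\<sigma> * \<mu> k)) \<le> exp D * exp (- (\<sigma> * c * real k))"
        by (simp add: exp_add[symmetric])
    qed
    also have "\<dots> \<le> exp D * (1 + 1 / (\<sigma> * c))"
      unfolding sum_distrib_left[symmetric] using suminf_exp_le[OF \<sigma>c]
      by (intro mult_left_mono order_trans[OF sum_le_suminf]) auto
    also have "1 + 1 / (\<sigma> * c) \<le> (1 + 1 / c) / \<sigma>"
      using that c by (simp add: field_simps)
    finally show ?thesis by (simp add: G_def)
  qed
  define B where "B = C\<^sup>2 * (2 * G) * R"
  have "Bessel f B"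
  proof (rule Bessel_from_finite[OF fl2])
    show "0 \<le> B" using \<open>0 \<le> G\<close> R by (simp add: B_def)
    fix N K and h :: "nat \<Rightarrow> complex"
    define W where "W m m' = sqrt (S m * S m') / (S m + S m')" for m m'
    have "(\<Sum>k<K. (cmod (\<Sum>m<N. h m * cnj (f k m)))\<^sup>2) \<le>
        (\<Sum>k<K. (\<Sum>m<N. cmod (h m) * (C * sqrt (S m) * exp (- (S m * \<mu> k / 2))))\<^sup>2)"
      by (intro sum_mono power_mono sum_norm_le norm_ge_zero)
         (auto simp: norm_mult intro!: mult_left_mono f)
    also have "\<dots> = (\<Sum>k<K. \<Sum>m<N. \<Sum>m'<N. C\<^sup>2 * (cmod (h m) * cmod (h m') * sqrt (S m * S m'))
        * exp (- ((S m + S m') / 2 * \<mu> k)))"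
    proof (rule sum.cong[OF refl])
      fix k
      have "(\<Sum>m<N. cmod (h m) * (C * sqrt (S m) * exp (- (S m * \<mu> k / 2))))\<^sup>2 =
        (\<Sum>m<N. \<Sum>m'<N. (cmod (h m) * (C * sqrt (S m) * exp (- (S m * \<mu> k / 2))))
           * (cmod (h m') * (C * sqrt (S m') * exp (- (S m' * \<mu> k / 2)))))"
        unfolding power2_eq_square sum_product ..
      also have "\<dots> = (\<Sum>m<N. \<Sum>m'<N. C\<^sup>2 * (cmod (h m) * cmod (h m') * sqrt (S m * S m'))
        * exp (- ((S m + S m') / 2 * \<mu> k)))"
      proof (intro sum.cong refl)
        fix m m'
        have "exp (- ((S m + S m') / 2 * \<mu> k)) = exp (- (S m * \<mu> k / 2)) * exp (- (S m' * \<mu> k / 2))"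
          by (simp add: exp_add[symmetric] algebra_simps add_divide_distrib)
        then show "(cmod (h m) * (C * sqrt (S m) * exp (- (S m * \<mu> k / 2))))
           * (cmod (h m') * (C * sqrt (S m') * exp (- (S m' * \<mu> k / 2)))) =
           C\<^sup>2 * (cmod (h m) * cmod (h m') * sqrt (S m * S m')) * exp (- ((S m + S m') / 2 * \<mu> k))"
          by (simp add: real_sqrt_mult power2_eq_square)
      qed
      finally show "(\<Sum>m<N. cmod (h m) * (C * sqrt (S m) * exp (- (S m * \<mu> k / 2))))\<^sup>2 =
        (\<Sum>m<N. \<Sum>m'<N. C\<^sup>2 * (cmod (h m) * cmod (h m') * sqrt (S m * S m'))
        * exp (- ((S m + S m') / 2 * \<mu> k)))" .
    qed
    also have "\<dots> = (\<Sum>m<N. \<Sum>m'<N. \<Sum>k<K. C\<^sup>2 * (cmod (h m) * cmod (h m') * sqrt (S m * S m'))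
        * exp (- ((S m + S m') / 2 * \<mu> k)))"
      by (subst sum.swap) (intro sum.cong refl sum.swap)
    also have "\<dots> \<le> (\<Sum>m<N. \<Sum>m'<N. C\<^sup>2 * (cmod (h m) * cmod (h m') * sqrt (S m * S m'))
        * (G / ((S m + S m') / 2)))"
      unfolding sum_distrib_left[symmetric]
    proof (intro sum_mono mult_left_mono exp_sum)
      fix m m'
      show "0 < (S m + S m') / 2" "(S m + S m') / 2 \<le> 1" using S1[of m] S1[of m'] by auto
      show "0 \<le> C\<^sup>2 * (cmod (h m) * cmod (h m') * sqrt (S m * S m'))"
        using S1[of m] S1[of m'] by simp
    qed
    also have "\<dots> = C\<^sup>2 * (2 * G) * (\<Sum>m<N. \<Sum>m'<N. cmod (h m) * cmod (h m') * W m m')"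
      unfolding sum_distrib_left W_def by (intro sum.cong refl) (simp add: field_simps)
    also have "\<dots> \<le> C\<^sup>2 * (2 * G) * (R * (\<Sum>m<N. (cmod (h m))\<^sup>2))"
    proof (intro mult_left_mono Schur_test_symmetric)
      show "0 \<le> W m m'" for m m' using S1[of m] S1[of m'] by (simp add: W_def)
      show "W m m' = W m' m" for m m' by (simp add: W_def add.commute mult.commute)
      show "(\<Sum>m'<N. W m m') \<le> R" for m unfolding W_def by (intro R) auto
    qed (use \<open>0 \<le> G\<close> in auto)
    finally show "(\<Sum>k<K. (cmod (\<Sum>m<N. h m * cnj (f k m)))\<^sup>2) \<le> B * (\<Sum>m<N. (cmod (h m))\<^sup>2)"
      by (simp add: B_def mult.assoc)
  qed
  then show ?thesis by (rule that)
qed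

lemma suminf_of_real_eq:
  assumes "(\<lambda>k. complex_of_real (u k)) sums c"
  shows "complex_of_real (\<Sum>k. u k) = c"
proof -
  have u: "u sums Re c" using sums_Re[OF assms] by simp
  then have "(\<lambda>k. complex_of_real (u k)) sums complex_of_real (Re c)" by (rule sums_of_real)
  then show ?thesis using sums_unique2[OF assms] sums_unique[OF u] by simp
qed

text \<open>The bound is required on discs of radius \<open>1 / S m\<close> about the points of the half-line and not only at
  these points: Cauchy's inequality then bounds derivatives with an additional factor \<open>S m\<close>.\<close>

locale exponential_system =
  fixes S :: "nat \<Rightarrow> real" and E :: "nat \<Rightarrow> complex \<Rightarrow> complex" and C :: real
  assumes lac: "lacunary S"
    and hol: "\<And>m. E m holomorphic_on UNIV"
    and E_bound: "\<And>m t w. 0 \<le> t \<Longrightarrow> cmod (w - of_real t) \<le> 1 / S m \<Longrightarrow>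
      cmod (E m w) \<le> C * sqrt (S m) * exp (- (S m * t / 2))"
begin

lemma S_pos: "0 < S m" and S_le_1: "S m \<le> 1"
  using lac by (auto simp: lacunary_def)

text \<open>The entire function that extends the product of \<open>E m\<close> and the conjugate of \<open>E m'\<close> from the real axis.\<close>

definition Q :: "nat \<Rightarrow> nat \<Rightarrow> complex \<Rightarrow> complex" where
  "Q m m' w = E m w * cnj (E m' (cnj w))"

lemma Q_holomorphic: "Q m m' holomorphic_on UNIV"
proof -
  have "cnj \<circ> E m' \<circ> cnj holomorphic_on UNIV"
    by (rule holomorphic_on_compose_cnj_cnj[OF holomorphic_on_subset[OF hol]]) auto
  then show ?thesis unfolding Q_def[abs_def] by (intro holomorphic_intros hol) (simp add: o_def)
qed

lemma Q_bound:
  assumes t: "0 \<le> t" "cmod (w - of_real t) \<le> 1 / (S m + S m')"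
  shows "cmod (Q m m' w) \<le> C\<^sup>2 * sqrt (S m * S m') * exp (- ((S m + S m') / 2) * t)"
proof -
  have "1 / (S m + S m') \<le> 1 / S m" "1 / (S m + S m') \<le> 1 / S m'"
    using S_pos[of m] S_pos[of m'] by (auto intro!: divide_left_mono)
  moreover have "cmod (cnj w - of_real t) = cmod (w - of_real t)"
    by (metis complex_cnj_complex_of_real complex_cnj_diff complex_mod_cnj)
  ultimately have "cmod (E m w) \<le> C * sqrt (S m) * exp (- (S m * t / 2))"
    "cmod (E m' (cnj w)) \<le> C * sqrt (S m') * exp (- (S m' * t / 2))"
    using t by (auto intro!: E_bound)
  then have "cmod (E m w) * cmod (E m' (cnj w)) \<le>
      (C * sqrt (S m) * exp (- (S m * t / 2))) * (C * sqrt (S m') * exp (- (S m' * t / 2)))"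
    by (intro mult_mono) (auto intro: order_trans[OF norm_ge_zero])
  also have "\<dots> = C\<^sup>2 * sqrt (S m * S m') * (exp (- (S m * t / 2)) * exp (- (S m' * t / 2)))"
    by (simp add: real_sqrt_mult power2_eq_square)
  also have "exp (- (S m * t / 2)) * exp (- (S m' * t / 2)) = exp (- ((S m + S m') / 2) * t)"
    by (simp add: exp_add[symmetric] algebra_simps add_divide_distrib)
  finally show ?thesis by (simp add: Q_def norm_mult)
qed

text \<open>Cauchy's inequality on a disc of radius \<open>1 / (S m + S m')\<close>, on which both factors are controlled.\<close>

lemma Q_deriv_bound:
  assumes t: "0 \<le> t"
  shows "cmod (deriv (Q m m') (of_real t)) \<le>
    (C\<^sup>2 * sqrt (S m * S m') * (S m + S m')) * exp (- ((S m + S m') / 2) * t)"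
proof -
  define r where "r = 1 / (S m + S m')"
  have "0 < r" using S_pos[of m] S_pos[of m'] by (simp add: r_def)
  have "cmod ((deriv ^^ 1) (Q m m') (of_real t)) \<le>
      fact 1 * (C\<^sup>2 * sqrt (S m * S m') * exp (- ((S m + S m') / 2) * t)) / r ^ 1"
  proof (rule Cauchy_inequality)
    show "Q m m' holomorphic_on ball (of_real t) r"
      by (rule holomorphic_on_subset[OF Q_holomorphic]) simp
    show "continuous_on (cball (of_real t) r) (Q m m')"
      by (rule continuous_on_subset[OF holomorphic_on_imp_continuous_on[OF Q_holomorphic]]) simp
    show "cmod (Q m m' w) \<le> C\<^sup>2 * sqrt (S m * S m') * exp (- ((S m + S m') / 2) * t)"
      if "cmod (of_real t - w) = r" for w
      using that by (intro Q_bound[OF t]) (simp add: r_def norm_minus_commute)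
  qed fact
  then show ?thesis using S_pos[of m] S_pos[of m'] by (simp add: r_def mult_ac)
qed

text \<open>The entries of the Gram matrix at \<open>\<mu>\<close> and \<open>d\<close> times those at the natural numbers: the term with
  \<open>\<alpha>\<close> is a small multiple of the bounded matrix of \<open>lacunary_kernel_bound\<close>, and the term with
  \<open>b\<close>, which may be large, has rank one and is small far out.\<close>

definition gram_close :: "(nat \<Rightarrow> real) \<Rightarrow> real \<Rightarrow> real \<Rightarrow> real \<Rightarrow> bool" where
  "gram_close \<mu> d \<alpha> b \<longleftrightarrow> (\<forall>m m'.
      summable (\<lambda>k. Q m m' (of_real (\<mu> k))) \<and> summable (\<lambda>k. Q m m' (of_real (real k))) \<and>
      cmod ((\<Sum>k. Q m m' (of_real (\<mu> k))) - of_real d * (\<Sum>k. Q m m' (of_real (real k))))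
        \<le> sqrt (S m * S m') * (\<alpha> / (S m + S m') + b))"

text \<open>Both sums are compared with the same integral by \<open>Riemann_sum_error\<close>, where
  \<open>\<sigma> = (S m + S m') / 2\<close> and the derivative is bounded by \<open>sqrt (S m * S m') * \<sigma>\<close> up to a constant.\<close>

lemma asymptotic_density_gram_close:
  assumes \<mu>: "asymptotic_density \<mu> d" and \<alpha>: "0 < \<alpha>"
  obtains b where "0 \<le> b" "gram_close \<mu> d \<alpha> b"
proof -
  have d: "0 < d" and \<mu>0: "\<And>k. 0 \<le> \<mu> k" using \<mu> by (auto simp: asymptotic_density_def)
  obtain c D0 where c: "0 < c" "0 \<le> D0" "\<And>k. c * real k - D0 \<le> \<mu> k"
    "\<And>k. c * real k - D0 \<le> real k * (1 / d)"
    using asymptotic_density_lower[OF \<mu>] by metis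
  define a1 where "a1 = 1 + 1 / c"
  have "0 \<le> a1" using c by (simp add: a1_def)
  define a where "a = 4 * C\<^sup>2 * exp D0 * a1\<^sup>2"
  have "0 \<le> a" by (simp add: a_def)
  \<comment> \<open>The precision of the progression that turns the main error term \<open>a * \<epsilon>\<close> into at most \<open>\<alpha>\<close>.\<close>
  define \<epsilon> where "\<epsilon> = \<alpha> / (a + 1)"
  have \<epsilon>: "0 < \<epsilon>" and a\<epsilon>: "a * \<epsilon> \<le> \<alpha>"
    using \<alpha> \<open>0 \<le> a\<close> by (auto simp: \<epsilon>_def field_simps)
  show thesis
  proof -
    obtain D where D: "\<And>k. \<bar>\<mu> k - real k * (1 / d)\<bar> \<le> \<epsilon> * real k + D"
      using \<mu> \<epsilon> unfolding asymptotic_density_def by blast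
    have "0 \<le> D" using D[of 0] by simp
    define b where "b = 2 * C\<^sup>2 * (exp D0 * (D + 1 / d) * a1 + 2 * d)"
    have "0 \<le> b" using \<open>0 \<le> D\<close> \<open>0 \<le> a1\<close> d by (simp add: b_def)
    have "summable (\<lambda>k. Q m m' (of_real (\<mu> k))) \<and> summable (\<lambda>k. Q m m' (of_real (real k))) \<and>
      cmod ((\<Sum>k. Q m m' (of_real (\<mu> k))) - of_real d * (\<Sum>k. Q m m' (of_real (real k))))
        \<le> sqrt (S m * S m') * (\<alpha> / (S m + S m') + b)" for m m'
    proof -
      define \<sigma> where "\<sigma> = (S m + S m') / 2"
      have \<sigma>: "0 < \<sigma>" "\<sigma> \<le> 1"
        using S_pos[of m] S_pos[of m'] S_le_1[of m] S_le_1[of m'] by (auto simp: \<sigma>_def)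
      define K0 where "K0 = C\<^sup>2 * sqrt (S m * S m')"
      have "0 \<le> K0" using S_pos[of m] S_pos[of m'] by (simp add: K0_def)
      define K where "K = K0 * (2 * \<sigma>)"
      have "0 \<le> K" using \<open>0 \<le> K0\<close> \<sigma> by (simp add: K_def)
      have Q0: "cmod (Q m m' (of_real t)) \<le> K0 * exp (- \<sigma> * t)" if "0 \<le> t" for t
        using Q_bound[OF that, of "of_real t" m m'] S_pos[of m] S_pos[of m'] by (simp add: K0_def \<sigma>_def)
      have Q1: "cmod (deriv (Q m m') (of_real t)) \<le> K * exp (- \<sigma> * t)" if "0 \<le> t" for t
      proof -
        have "S m + S m' = 2 * \<sigma>" by (simp add: \<sigma>_def)
        from Q_deriv_bound[OF that, of m m', unfolded this] show ?thesis by (simp add: K_def K0_def)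
      qed
      obtain I where I: "\<And>h \<mu> \<epsilon> C c C0. near_progression h \<epsilon> C c C0 \<mu> \<Longrightarrow>
        summable (\<lambda>k. Q m m' (of_real (\<mu> k))) \<and>
        cmod (of_real h * (\<Sum>k. Q m m' (of_real (\<mu> k))) - I) \<le>
          h * K * exp (\<sigma> * C0) * (\<epsilon> * (1 + 1 / (\<sigma> * c))\<^sup>2 + (C + h) * (1 + 1 / (\<sigma> * c)))"
        using Riemann_sum_error[OF Q_holomorphic \<sigma>(1) Q0 Q1] by blast
      have near_\<mu>: "near_progression (1 / d) \<epsilon> D c D0 \<mu>"
        unfolding near_progression_def using d \<epsilon> c \<mu>0 D by simp
      have near_nat: "near_progression 1 0 0 1 0 real" by (simp add: near_progression_def)
      define X where "X = (\<Sum>k. Q m m' (of_real (\<mu> k)))"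
      define Y where "Y = (\<Sum>k. Q m m' (of_real (real k)))"
      have X: "summable (\<lambda>k. Q m m' (of_real (\<mu> k)))"
        "cmod (of_real (1 / d) * X - I) \<le> 1 / d * K * exp (\<sigma> * D0) *
           (\<epsilon> * (1 + 1 / (\<sigma> * c))\<^sup>2 + (D + 1 / d) * (1 + 1 / (\<sigma> * c)))"
        using I[OF near_\<mu>] by (auto simp: X_def)
      have Y: "summable (\<lambda>k. Q m m' (of_real (real k)))" "cmod (Y - I) \<le> K * (1 + 1 / \<sigma>)"
        using I[OF near_nat] by (auto simp: Y_def)
      have "of_real d * (of_real (1 / d) * X) = X"
        using d by (metis less_irrefl mult.assoc mult_1 nonzero_divide_eq_eq of_real_1 of_real_mult mult.commute)
      then have eq: "X - of_real d * Y = of_real d * (of_real (1 / d) * X - I) - of_real d * (Y - I)"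
        by (simp add: algebra_simps)
      have a1\<sigma>: "1 + 1 / (\<sigma> * c) \<le> a1 / \<sigma>" using \<sigma> c by (simp add: a1_def field_simps)
      have one\<sigma>: "1 + 1 / \<sigma> \<le> 2 / \<sigma>" using \<sigma> by (simp add: field_simps)
      have "0 \<le> 1 + 1 / (\<sigma> * c)" using \<sigma> c by simp
      have "cmod (X - of_real d * Y) \<le>
          cmod (of_real d * (of_real (1 / d) * X - I)) + cmod (of_real d * (Y - I))"
        unfolding eq by (rule norm_triangle_ineq4)
      also have "\<dots> = d * cmod (of_real (1 / d) * X - I) + d * cmod (Y - I)"
        using d by (simp only: norm_mult norm_of_real abs_of_pos)
      also have "\<dots> \<le> d * (1 / d * K * exp (\<sigma> * D0) *
           (\<epsilon> * (1 + 1 / (\<sigma> * c))\<^sup>2 + (D + 1 / d) * (1 + 1 / (\<sigma> * c)))) + d * (K * (1 + 1 / \<sigma>))"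
        using X Y d by (intro add_mono mult_left_mono) auto
      also have "\<dots> = K * (exp (\<sigma> * D0) * (\<epsilon> * (1 + 1 / (\<sigma> * c))\<^sup>2 + (D + 1 / d) * (1 + 1 / (\<sigma> * c)))
           + d * (1 + 1 / \<sigma>))"
      proof -
        have "d * (1 / d * K * x * T) + d * (K * u) = K * (x * T + d * u)" for x T u
          using d by (simp add: algebra_simps)
        then show ?thesis .
      qed
      also have "\<dots> \<le> K * (exp D0 * (\<epsilon> * (a1 / \<sigma>)\<^sup>2 + (D + 1 / d) * (a1 / \<sigma>)) + d * (2 / \<sigma>))"
        using \<sigma> c d \<epsilon> \<open>0 \<le> D\<close> \<open>0 \<le> K\<close> a1\<sigma> one\<sigma> \<open>0 \<le> 1 + 1 / (\<sigma> * c)\<close>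
        by (intro mult_left_mono add_mono mult_mono power_mono) (auto intro: mult_left_le_one_le)
      also have "\<dots> = 2 * K0 * (exp D0 * (\<epsilon> * a1\<^sup>2 / \<sigma> + (D + 1 / d) * a1) + 2 * d)"
        using \<sigma> by (simp add: K_def field_simps power2_eq_square)
      also have "\<dots> = sqrt (S m * S m') * (a * \<epsilon> / (2 * \<sigma>) + b)"
        using \<sigma> by (simp add: K0_def a_def b_def field_simps)
      also have "\<dots> \<le> sqrt (S m * S m') * (\<alpha> / (2 * \<sigma>) + b)"
        using a\<epsilon> \<sigma> S_pos[of m] S_pos[of m'] by (intro mult_left_mono add_mono divide_right_mono) auto
      also have "2 * \<sigma> = S m + S m'" by (simp add: \<sigma>_def)
      finally show ?thesis using X(1) Y(1) by (simp add: X_def Y_def)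
    qed
    then have "gram_close \<mu> d \<alpha> b" unfolding gram_close_def by (intro allI)
    with \<open>0 \<le> b\<close> show thesis by (rule that)
  qed
qed

text \<open>First \<open>\<alpha>\<close> is chosen small, which determines \<open>b\<close>; then the tail is started where \<open>sqrt (S m)\<close> is
  small compared with \<open>1 / b\<close>. The Schur test turns the entrywise bounds into a bound for the quadratic forms.\<close>

lemma tail_energy_comparison:
  assumes \<mu>: "asymptotic_density \<mu> d" and "0 < \<eta>"
  obtains M where "\<And>N (h :: nat \<Rightarrow> complex). (\<forall>m<M. h m = 0) \<Longrightarrow>
    d * (\<Sum>k. (cmod (\<Sum>m<N. h m * E m (of_real (real k))))\<^sup>2) - \<eta> * (\<Sum>m<N. (cmod (h m))\<^sup>2)
      \<le> (\<Sum>k. (cmod (\<Sum>m<N. h m * E m (of_real (\<mu> k))))\<^sup>2)"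
proof -
  obtain R where R: "0 \<le> R" "\<And>m A. finite A \<Longrightarrow> (\<Sum>m'\<in>A. sqrt (S m * S m') / (S m + S m')) \<le> R"
    using lacunary_kernel_bound[OF lac] by metis
  have sum_sqrt: "summable (\<lambda>m. sqrt (S m))" by (rule lacunary_summable_sqrt[OF lac])
  define R' where "R' = (\<Sum>m. sqrt (S m))"
  have R': "(\<Sum>m\<in>A. sqrt (S m)) \<le> R'" if "finite A" for A
    unfolding R'_def using that S_pos by (intro sum_le_suminf sum_sqrt) (auto simp: less_imp_le)
  have "0 \<le> R'" using R'[of "{}"] by simp
  define \<alpha> where "\<alpha> = \<eta> / (2 * (R + 1))"
  have "0 < \<alpha>" using \<open>0 < \<eta>\<close> R by (simp add: \<alpha>_def add_nonneg_pos)
  have \<alpha>_le: "\<alpha> * R \<le> \<eta> / 2"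
    using \<open>0 < \<eta>\<close> R(1) by (simp add: \<alpha>_def field_simps)
  obtain b where b0: "0 \<le> b" and close: "gram_close \<mu> d \<alpha> b"
    using asymptotic_density_gram_close[OF \<mu> \<open>0 < \<alpha>\<close>] by blast
  note b = b0 close[unfolded gram_close_def, rule_format]
  define \<tau> where "\<tau> = \<eta> / (2 * (b * R' + 1))"
  have "0 < \<tau>" using \<open>0 < \<eta>\<close> b \<open>0 \<le> R'\<close> by (simp add: \<tau>_def add_nonneg_pos)
  have \<tau>_le: "b * \<tau> * R' \<le> \<eta> / 2"
  proof -
    have "0 < b * R' + 1" using b \<open>0 \<le> R'\<close> by (simp add: add_nonneg_pos)
    then have "\<tau> * (b * R' + 1) = \<eta> / 2" by (simp add: \<tau>_def field_simps)
    then show ?thesis using \<open>0 < \<tau>\<close> by (simp add: algebra_simps)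
  qed
  have "(\<lambda>m. sqrt (S m)) \<longlonglongrightarrow> 0" using sum_sqrt by (rule summable_LIMSEQ_zero)
  from order_tendstoD(2)[OF this \<open>0 < \<tau>\<close>] obtain M where M: "\<And>m. M \<le> m \<Longrightarrow> sqrt (S m) < \<tau>"
    by (auto simp: eventually_sequentially)
  have "d * (\<Sum>k. (cmod (\<Sum>m<N. h m * E m (of_real (real k))))\<^sup>2) - \<eta> * (\<Sum>m<N. (cmod (h m))\<^sup>2)
      \<le> (\<Sum>k. (cmod (\<Sum>m<N. h m * E m (of_real (\<mu> k))))\<^sup>2)" if h: "\<forall>m<M. h m = 0"
    for N and h :: "nat \<Rightarrow> complex"
  proof -
    define A where "A = {M..<N}"
    have A: "finite A" "\<And>m. m \<in> A \<Longrightarrow> sqrt (S m) \<le> \<tau>"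
      using M by (auto simp: A_def less_imp_le)
    have sum_A: "(\<Sum>m<N. h m * E m w) = (\<Sum>m\<in>A. h m * E m w)" for w
      using h by (intro sum.mono_neutral_right) (auto simp: A_def)
    have sum_A2: "(\<Sum>m<N. (cmod (h m))\<^sup>2) = (\<Sum>m\<in>A. (cmod (h m))\<^sup>2)"
      using h by (intro sum.mono_neutral_right) (auto simp: A_def)
    define X where "X m m' = (\<Sum>k. Q m m' (of_real (\<mu> k)))" for m m'
    define Y where "Y m m' = (\<Sum>k. Q m m' (of_real (real k)))" for m m'
    have expand: "of_real ((cmod (\<Sum>m\<in>A. h m * E m (of_real t)))\<^sup>2) =
        (\<Sum>m\<in>A. \<Sum>m'\<in>A. h m * cnj (h m') * Q m m' (of_real t))" for t :: real
    proof -
      have "of_real ((cmod (\<Sum>m\<in>A. h m * E m (of_real t)))\<^sup>2) =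
        (\<Sum>m\<in>A. h m * E m (of_real t)) * cnj (\<Sum>m\<in>A. h m * E m (of_real t))"
        by (rule complex_norm_square)
      also have "\<dots> = (\<Sum>m\<in>A. \<Sum>m'\<in>A. h m * cnj (h m') * Q m m' (of_real t))"
        unfolding cnj_sum sum_product by (intro sum.cong refl) (simp add: Q_def)
      finally show ?thesis .
    qed
    have sumX: "summable (\<lambda>k. Q m m' (of_real (\<mu> k)))"
      and sumY: "summable (\<lambda>k. Q m m' (of_real (real k)))" for m m'
      using b(2)[of m m'] by blast+
    have X: "(\<lambda>k. of_real ((cmod (\<Sum>m\<in>A. h m * E m (of_real (\<mu> k))))\<^sup>2)) sums
        (\<Sum>m\<in>A. \<Sum>m'\<in>A. h m * cnj (h m') * X m m')"
      unfolding expand X_def by (intro sums_sum sums_mult summable_sums sumX)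
    have Y: "(\<lambda>k. of_real ((cmod (\<Sum>m\<in>A. h m * E m (of_real (real k))))\<^sup>2)) sums
        (\<Sum>m\<in>A. \<Sum>m'\<in>A. h m * cnj (h m') * Y m m')"
      unfolding expand Y_def by (intro sums_sum sums_mult summable_sums sumY)
    define x where "x = (\<Sum>k. (cmod (\<Sum>m\<in>A. h m * E m (of_real (\<mu> k))))\<^sup>2)"
    define y where "y = (\<Sum>k. (cmod (\<Sum>m\<in>A. h m * E m (of_real (real k))))\<^sup>2)"
    have x: "complex_of_real x = (\<Sum>m\<in>A. \<Sum>m'\<in>A. h m * cnj (h m') * X m m')"
      unfolding x_def by (rule suminf_of_real_eq[OF X])
    have y: "complex_of_real y = (\<Sum>m\<in>A. \<Sum>m'\<in>A. h m * cnj (h m') * Y m m')"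
      unfolding y_def by (rule suminf_of_real_eq[OF Y])
    define W where "W m m' = sqrt (S m * S m') * (\<alpha> / (S m + S m') + b)" for m m'
    have "complex_of_real (x - d * y) = (\<Sum>m\<in>A. \<Sum>m'\<in>A. h m * cnj (h m') * (X m m' - of_real d * Y m m'))"
      unfolding of_real_diff of_real_mult x y
      by (simp add: sum_distrib_left sum_subtractf algebra_simps)
    then have "\<bar>x - d * y\<bar> = cmod (\<Sum>m\<in>A. \<Sum>m'\<in>A. h m * cnj (h m') * (X m m' - of_real d * Y m m'))"
      by (metis norm_of_real)
    also have "\<dots> \<le> (\<Sum>m\<in>A. \<Sum>m'\<in>A. cmod (h m) * cmod (h m') * W m m')"
      using A b(2) unfolding W_def X_def Y_def
      by (intro sum_norm_le) (auto simp: norm_mult intro!: mult_left_mono)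
    also have "\<dots> \<le> \<eta> * (\<Sum>m\<in>A. (cmod (h m))\<^sup>2)"
    proof (rule Schur_test_symmetric[OF A(1)])
      show "0 \<le> W m m'" for m m'
        using S_pos[of m] S_pos[of m'] b0 \<open>0 < \<alpha>\<close> by (simp add: W_def)
      show "W m m' = W m' m" for m m' by (simp add: W_def add.commute mult.commute)
      fix m assume m: "m \<in> A"
      have "(\<Sum>m'\<in>A. W m m') = (\<Sum>m'\<in>A. \<alpha> * (sqrt (S m * S m') / (S m + S m')) + b * sqrt (S m) * sqrt (S m'))"
        unfolding W_def by (intro sum.cong refl) (simp add: algebra_simps real_sqrt_mult)
      also have "\<dots> = \<alpha> * (\<Sum>m'\<in>A. sqrt (S m * S m') / (S m + S m')) + b * sqrt (S m) * (\<Sum>m'\<in>A. sqrt (S m'))"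
        by (simp add: sum.distrib sum_distrib_left)
      also have "\<dots> \<le> \<alpha> * R + b * \<tau> * R'"
        using b0 \<open>0 < \<alpha>\<close> \<open>0 < \<tau>\<close> R(2) R' A m S_pos[of m] S_pos
        by (intro add_mono mult_mono mult_left_mono) (auto intro!: sum_nonneg simp: less_imp_le)
      also have "\<dots> \<le> \<eta>" using \<alpha>_le \<tau>_le by linarith
      finally show "(\<Sum>m'\<in>A. W m m') \<le> \<eta>" .
    qed
    finally have "\<bar>x - d * y\<bar> \<le> \<eta> * (\<Sum>m\<in>A. (cmod (h m))\<^sup>2)" .
    then show ?thesis unfolding sum_A sum_A2 x_def[symmetric] y_def[symmetric] by linarith
  qed
  then show ?thesis using that by blast
qed

end

section \<open>The density of a sequence and its counting function\<close>

lemma counting_function_finite: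
  assumes "finite {k. \<Lambda> k \<le> x}" "0 < x"
  shows "counting_function \<Lambda> x / ennreal x = ennreal (real (card {k. \<Lambda> k \<le> x}) / x)"
  unfolding counting_function_def using assms
  by (simp add: divide_ennreal ennreal_of_nat_eq_real_of_nat)

text \<open>Bounds for the counting function are stated as bounds for the sequence; as the sequence increases,
  \<open>\<Lambda> k \<le> x\<close> means that at least \<open>k + 1\<close> members are counted at \<open>x\<close>.\<close>

lemma counting_limit_upper:
  assumes mono: "strict_mono \<Lambda>"
    and lim: "((\<lambda>x. counting_function \<Lambda> x / ennreal x) \<longlongrightarrow> L) at_top"
    and b: "L < ennreal b"
  obtains X where "1 \<le> X" "\<And>x k. X \<le> x \<Longrightarrow> \<Lambda> k \<le> x \<Longrightarrow> real k + 1 \<le> b * x"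
proof -
  obtain X0 where X0: "\<And>x. X0 \<le> x \<Longrightarrow> counting_function \<Lambda> x / ennreal x < ennreal b"
    using order_tendstoD(2)[OF lim b] by (auto simp: eventually_at_top_linorder)
  have "real k + 1 \<le> b * x" if x: "max X0 1 \<le> x" and k: "\<Lambda> k \<le> x" for x k
  proof -
    have "0 < x" and less: "counting_function \<Lambda> x / ennreal x < ennreal b" using x X0 by auto
    have fin: "finite {k. \<Lambda> k \<le> x}"
    proof (rule ccontr)
      assume "infinite {k. \<Lambda> k \<le> x}"
      then have "counting_function \<Lambda> x / ennreal x = \<infinity>"
        by (simp add: counting_function_def ennreal_top_divide)
      then show False using less by simp
    qed
    then have "real (card {k. \<Lambda> k \<le> x}) / x < b"
      using less \<open>0 < x\<close> counting_function_finite[OF fin \<open>0 < x\<close>] by (simp add: ennreal_less_iff)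
    moreover have "card {..k} \<le> card {k. \<Lambda> k \<le> x}"
      using order_trans[OF strict_mono_leD[OF mono] k] by (intro card_mono fin) auto
    ultimately show ?thesis using \<open>0 < x\<close> by (simp add: field_simps)
  qed
  then show ?thesis using that[of "max X0 1"] by simp
qed

lemma counting_limit_lower:
  assumes mono: "strict_mono \<Lambda>"
    and lim: "((\<lambda>x. counting_function \<Lambda> x / ennreal x) \<longlongrightarrow> L) at_top"
    and a: "ennreal a < L" "0 \<le> a"
  obtains X where "1 \<le> X" "\<And>x k. X \<le> x \<Longrightarrow> real k \<le> a * x \<Longrightarrow> \<Lambda> k \<le> x"
proof -
  obtain X0 where X0: "\<And>x. X0 \<le> x \<Longrightarrow> ennreal a < counting_function \<Lambda> x / ennreal x"
    using order_tendstoD(1)[OF lim a(1)] by (auto simp: eventually_at_top_linorder)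
  have "\<Lambda> k \<le> x" if x: "max X0 1 \<le> x" and k: "real k \<le> a * x" for x k
  proof (rule ccontr)
    assume "\<not> \<Lambda> k \<le> x"
    then have sub: "{i. \<Lambda> i \<le> x} \<subseteq> {..<k}"
      using strict_mono_less[OF mono] by (auto simp: not_le dest: le_less_trans)
    then have fin: "finite {i. \<Lambda> i \<le> x}" using finite_subset by blast
    have "0 < x" and less: "ennreal a < counting_function \<Lambda> x / ennreal x" using x X0 by auto
    then have "a < real (card {k. \<Lambda> k \<le> x}) / x"
      using a(2) counting_function_finite[OF fin \<open>0 < x\<close>] by (simp add: ennreal_less_iff)
    moreover have "card {i. \<Lambda> i \<le> x} \<le> k" using card_mono[OF _ sub] by simp
    ultimately show False using k \<open>0 < x\<close> by (simp add: field_simps)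
  qed
  then show ?thesis using that[of "max X0 1"] by simp
qed

lemma counting_limit_asymptotic_density:
  assumes mono: "strict_mono \<Lambda>" and nonneg: "\<And>k. 0 \<le> \<Lambda> k"
    and lim: "((\<lambda>x. counting_function \<Lambda> x / ennreal x) \<longlongrightarrow> ennreal d) at_top" and "0 < d"
  shows "asymptotic_density \<Lambda> d"
  unfolding asymptotic_density_def
proof (intro conjI allI impI)
  fix \<epsilon> :: real assume "0 < \<epsilon>"
  define \<delta> where "\<delta> = min \<epsilon> (1 / (2 * d))"
  have \<delta>: "0 < \<delta>" "\<delta> \<le> \<epsilon>" "\<delta> < 1 / d" using \<open>0 < \<epsilon>\<close> \<open>0 < d\<close> by (auto simp: \<delta>_def min_less_iff_disj field_simps)
  \<comment> \<open>The densities \<open>a < d < b\<close> are those of the progressions with steps \<open>1 / d + \<epsilon>\<close> and \<open>1 / d - \<delta>\<close>; the minimum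
     keeps the latter step positive.\<close>
  define b where "b = 1 / (1 / d - \<delta>)"
  have "0 < b" using \<delta> by (simp add: b_def)
  have "d < b" using \<delta> \<open>0 < d\<close> by (simp add: b_def field_simps)
  define a where "a = 1 / (1 / d + \<epsilon>)"
  have "0 < a" "a < d" using \<open>0 < \<epsilon>\<close> \<open>0 < d\<close> by (auto simp: a_def field_simps add_pos_pos)
  obtain X1 where X1: "1 \<le> X1" "\<And>x k. X1 \<le> x \<Longrightarrow> \<Lambda> k \<le> x \<Longrightarrow> real k + 1 \<le> b * x"
    using counting_limit_upper[OF mono lim] \<open>d < b\<close> \<open>0 < d\<close> by (metis ennreal_lessI less_trans)
  obtain X2 where X2: "1 \<le> X2" "\<And>x k. X2 \<le> x \<Longrightarrow> real k \<le> a * x \<Longrightarrow> \<Lambda> k \<le> x"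
    using counting_limit_lower[OF mono lim] \<open>a < d\<close> \<open>0 < a\<close> \<open>0 < d\<close> by (metis ennreal_lessI less_imp_le)
  define X where "X = max X1 X2"
  have "\<bar>\<Lambda> k - real k * (1 / d)\<bar> \<le> \<epsilon> * real k + X" for k
  proof -
    have "real k = a * (real k / a)" using \<open>0 < a\<close> by simp
    also have "\<dots> \<le> a * max X (real k / a)" using \<open>0 < a\<close> by (intro mult_left_mono) auto
    finally have "\<Lambda> k \<le> max X (real k / a)" by (intro X2(2)) (auto simp: X_def)
    also have "\<dots> \<le> X + real k / a" using X1(1) \<open>0 < a\<close> by (auto simp: X_def)
    also have "real k / a = real k * (1 / d) + \<epsilon> * real k" by (simp add: a_def algebra_simps)
    finally have up: "\<Lambda> k \<le> X + (real k * (1 / d) + \<epsilon> * real k)" .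
    have "real k + 1 \<le> b * max X (\<Lambda> k)" by (intro X1(2)) (auto simp: X_def)
    also have "\<dots> \<le> b * (X + \<Lambda> k)"
      using \<open>0 < b\<close> X1(1) nonneg[of k] by (intro mult_left_mono) (auto simp: X_def)
    finally have "real k / b \<le> X + \<Lambda> k" using \<open>0 < b\<close> by (simp add: field_simps)
    moreover have "real k / b = real k * (1 / d) - \<delta> * real k"
      by (simp add: b_def algebra_simps)
    moreover have "\<delta> * real k \<le> \<epsilon> * real k" using \<delta> by (intro mult_right_mono) auto
    ultimately show ?thesis using up by (simp add: abs_le_iff)
  qed
  then show "\<exists>D. \<forall>k. \<bar>\<Lambda> k - real k * (1 / d)\<bar> \<le> \<epsilon> * real k + D" by blast
qed (use nonneg \<open>0 < d\<close> in auto)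

text \<open>An Abelian theorem: the means \<open>(1 - x) * (\<Sum>k. x powr (2 * \<Lambda> k))\<close> are comparable to the density of
  \<open>\<Lambda>\<close> at the scale \<open>1 / (1 - x)\<close>.\<close>

lemma Abel_means_imp_density:
  assumes mono: "strict_mono \<Lambda>" and nonneg: "\<And>k. 0 \<le> \<Lambda> k"
    and lim: "((\<lambda>x. counting_function \<Lambda> x / ennreal x) \<longlongrightarrow> L) at_top"
    and "0 < c1"
    and Abel: "\<And>\<eta>. 0 < \<eta> \<Longrightarrow> \<exists>x. 0 < x \<and> x < 1 \<and> 1 - x < \<eta> \<and> summable (\<lambda>k. x powr (2 * \<Lambda> k)) \<and>
      c1 \<le> (1 - x) * (\<Sum>k. x powr (2 * \<Lambda> k)) \<and> (1 - x) * (\<Sum>k. x powr (2 * \<Lambda> k)) \<le> c2"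
  shows "0 < L" "L < \<infinity>"
proof -
  show "L < \<infinity>"
  proof (rule ccontr)
    assume "\<not> L < \<infinity>"
    \<comment> \<open>At scale \<open>1 / s\<close> there are about \<open>R / s\<close> exponents, each of which contributes at least \<open>exp (- 4)\<close>.\<close>
    define R where "R = \<bar>c2\<bar> * exp 4 + 1"
    have "0 \<le> R" by (simp add: R_def)
    have "ennreal R < L" using \<open>\<not> L < \<infinity>\<close> by (simp add: not_less top_unique)
    then obtain X where X: "1 \<le> X" "\<And>x k. X \<le> x \<Longrightarrow> real k \<le> R * x \<Longrightarrow> \<Lambda> k \<le> x"
      using counting_limit_lower[OF mono lim _ \<open>0 \<le> R\<close>] by metis
    obtain x where x: "0 < x" "x < 1" "1 - x < 1 / (2 * X)" "summable (\<lambda>k. x powr (2 * \<Lambda> k))"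
      "(1 - x) * (\<Sum>k. x powr (2 * \<Lambda> k)) \<le> c2"
      using Abel[of "1 / (2 * X)"] X(1) by auto
    define s where "s = 1 - x"
    have s: "0 < s" "s < 1 / (2 * X)" using x by (auto simp: s_def)
    have "1 / (2 * X) \<le> 1 / 2" using X(1) by (simp add: field_simps)
    then have "s \<le> 1/2" "1/2 \<le> x" using s by (auto simp: s_def)
    have "X \<le> 1 / s" using s X(1) by (simp add: field_simps)
    have "x powr (2 / s) \<ge> exp (- 4)"
    proof -
      have "- ln x \<le> 1 / x - 1" using ln_le_minus_one[of "1 / x"] x by (simp add: ln_div)
      also have "\<dots> = s / x" using x by (simp add: s_def field_simps)
      also have "\<dots> \<le> 2 * s" using \<open>1/2 \<le> x\<close> s x by (simp add: field_simps)
      finally have "2 / s * (- ln x) \<le> 2 / s * (2 * s)" using s by (intro mult_left_mono) auto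
      then have "- 4 \<le> 2 / s * ln x" using s by simp
      then show ?thesis using x by (simp add: powr_def)
    qed
    define K where "K = nat \<lfloor>R / s\<rfloor>"
    have K: "real K \<le> R / s" "R / s \<le> real K + 1" using s \<open>0 \<le> R\<close> by (auto simp: K_def)
    have "R / s * exp (- 4) \<le> (real K + 1) * exp (- 4)" using K by (intro mult_right_mono) auto
    also have "\<dots> = (\<Sum>k<Suc K. exp (- 4))" by simp
    also have "\<dots> \<le> (\<Sum>k<Suc K. x powr (2 * \<Lambda> k))"
    proof (intro sum_mono)
      fix k assume "k \<in> {..<Suc K}"
      then have "real k \<le> R * (1 / s)" using K by simp
      then have "\<Lambda> k \<le> 1 / s" using X(2) \<open>X \<le> 1 / s\<close> by blast
      then have "x powr (2 / s) \<le> x powr (2 * \<Lambda> k)" using x by (intro powr_mono') auto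
      then show "exp (- 4) \<le> x powr (2 * \<Lambda> k)" using \<open>x powr (2 / s) \<ge> exp (- 4)\<close> by linarith
    qed
    also have "\<dots> \<le> (\<Sum>k. x powr (2 * \<Lambda> k))" using x by (intro sum_le_suminf) auto
    finally have "s * (R / s * exp (- 4)) \<le> s * (\<Sum>k. x powr (2 * \<Lambda> k))"
      using s by (intro mult_left_mono) auto
    then have "R * exp (- 4) \<le> c2" using x s by (simp add: s_def)
    then have "R \<le> c2 * exp 4" by (simp add: exp_minus field_simps)
    then show False by (simp add: R_def) (smt (verit) abs_ge_self exp_ge_zero mult_right_mono)
  qed
  show "0 < L"
  proof (rule ccontr)
    assume "\<not> 0 < L"
    \<comment> \<open>With density below \<open>b\<close> and \<open>s\<close> small, the mean is at most \<open>e s + e b / 2 < c1\<close>.\<close>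
    define b where "b = c1 / (2 * exp 1)"
    have "0 < b" using \<open>0 < c1\<close> by (simp add: b_def)
    have "L < ennreal b" using \<open>\<not> 0 < L\<close> \<open>0 < b\<close> by (simp add: zero_less_iff_neq_zero)
    then obtain X where X: "1 \<le> X" "\<And>x k. X \<le> x \<Longrightarrow> \<Lambda> k \<le> x \<Longrightarrow> real k + 1 \<le> b * x"
      using counting_limit_upper[OF mono lim] by metis
    define \<eta> where "\<eta> = min (1 / (2 * X)) (c1 / (4 * exp 1))"
    have "0 < \<eta>" using X(1) \<open>0 < c1\<close> by (simp add: \<eta>_def)
    obtain x where x: "0 < x" "x < 1" "1 - x < \<eta>" "summable (\<lambda>k. x powr (2 * \<Lambda> k))"
      "c1 \<le> (1 - x) * (\<Sum>k. x powr (2 * \<Lambda> k))"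
      using Abel[OF \<open>0 < \<eta>\<close>] by auto
    define s where "s = 1 - x"
    have s: "0 < s" "s < 1 / (2 * X)" "s < c1 / (4 * exp 1)" using x by (auto simp: s_def \<eta>_def)
    have sX: "2 * s * X \<le> 1" using s(2) X(1) by (simp add: field_simps)
    have "0 < 2 * s / b" using s \<open>0 < b\<close> by simp
    note geo = suminf_exp_le[OF this]
    have "x powr (2 * \<Lambda> k) \<le> exp 1 * exp (- (2 * s / b * real k))" for k
    proof -
      have "real k + 1 \<le> b * max X (\<Lambda> k)" by (intro X(2)) auto
      also have "\<dots> \<le> b * (X + \<Lambda> k)" using X(1) nonneg[of k] \<open>0 < b\<close> by (intro mult_left_mono) auto
      finally have "real k / b - X \<le> \<Lambda> k" using \<open>0 < b\<close> by (simp add: field_simps)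
      have "ln x \<le> - s" using ln_le_minus_one[of x] x by (simp add: s_def)
      then have "2 * \<Lambda> k * ln x \<le> 2 * \<Lambda> k * (- s)" using nonneg[of k] by (intro mult_left_mono) auto
      also have "\<dots> = 2 * s * (- \<Lambda> k)" by simp
      also have "\<dots> \<le> 2 * s * (X - real k / b)"
        using \<open>real k / b - X \<le> \<Lambda> k\<close> s by (intro mult_left_mono) auto
      also have "\<dots> \<le> 1 - 2 * s / b * real k" using sX by (simp add: algebra_simps)
      finally show ?thesis using x by (simp add: powr_def exp_add[symmetric])
    qed
    then have "(\<Sum>k. x powr (2 * \<Lambda> k)) \<le> (\<Sum>k. exp 1 * exp (- (2 * s / b * real k)))"
      using x geo(1) by (intro suminf_le summable_mult) auto
    also have "\<dots> = exp 1 * (\<Sum>k. exp (- (2 * s / b * real k)))" using geo(1) by (rule suminf_mult)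
    also have "\<dots> \<le> exp 1 * (1 + 1 / (2 * s / b))" using geo(2) by (intro mult_left_mono) auto
    finally have "s * (\<Sum>k. x powr (2 * \<Lambda> k)) \<le> s * (exp 1 * (1 + 1 / (2 * s / b)))"
      using s by (intro mult_left_mono) auto
    also have "\<dots> = exp 1 * s + exp 1 * b / 2" using s by (simp add: field_simps)
    also have "exp 1 * b / 2 = c1 / 4" by (simp add: b_def)
    also have "exp 1 * s < c1 / 4" using s(3) by (simp add: field_simps)
    finally show False using x(5) \<open>0 < c1\<close> by (simp add: s_def)
  qed
qed

section \<open>Powers of the block diagonal operator\<close>

lemma block_decompose:
  assumes "\<And>i. 0 < n i"
  shows "m - block_start n (block_of n m) < n (block_of n m)"
    "block_start n (block_of n m) + (m - block_start n (block_of n m)) = m"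
proof -
  obtain i j where ij: "j < n i" "m = block_start n i + j"
    by (rule block_exhaust[where n = n and m = m, OF assms])
  have "block_of n m = i" unfolding ij(2) by (rule block_of_eq[where n = n, OF ij(1)])
  with ij show "m - block_start n (block_of n m) < n (block_of n m)"
    "block_start n (block_of n m) + (m - block_start n (block_of n m)) = m" by auto
qed

lemma subdiag_power: "a < N \<Longrightarrow> (subdiag N ^^ l) v a = (if l \<le> a then v (a - l) else 0)"
proof (induction l arbitrary: a)
  case (Suc l)
  have "(subdiag N ^^ Suc l) v a = (if 0 < a then (subdiag N ^^ l) v (a - 1) else 0)"
    using Suc.prems by (simp add: subdiag_def)
  also have "\<dots> = (if Suc l \<le> a then v (a - Suc l) else 0)"
    using Suc.IH[of "a - 1"] Suc.prems by (cases a) auto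
  finally show ?case .
qed simp

text \<open>The coefficient of the \<open>l\<close>-th power of the subdiagonal matrix in the \<open>w\<close>-th power of a Jordan block with
  eigenvalue \<open>x > 0\<close>, as an entire function of the exponent \<open>w\<close>.\<close>

definition pow_coeff :: "real \<Rightarrow> nat \<Rightarrow> complex \<Rightarrow> complex" where
  "pow_coeff x l w = (w gchoose l) * exp ((w - of_nat l) * of_real (ln x)) * of_real ((1 - x\<^sup>2) ^ l)"

lemma of_real_gbinomial: "of_real (t gchoose l) = (of_real t gchoose l :: complex)"
  by (simp add: gbinomial_prod_rev)

lemma pow_coeff_of_real:
  assumes "0 < x"
  shows "pow_coeff x l (of_real t) = of_real (t gchoose l) * of_real x powr of_real (t - real l) *
    of_real ((1 - (cmod (of_real x))\<^sup>2) ^ l)"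
proof -
  have "(of_real x :: complex) powr of_real (t - real l) = exp (of_real (t - real l) * of_real (ln x))"
    using assms by (simp add: powr_def Ln_of_real)
  then show ?thesis by (simp add: pow_coeff_def of_real_gbinomial)
qed

lemma cnj_pow_coeff_of_real: "cnj (pow_coeff x l (of_real t)) = pow_coeff x l (of_real t)"
proof -
  have "pow_coeff x l (of_real t) =
    of_real ((t gchoose l) * exp ((t - real l) * ln x) * (1 - x\<^sup>2) ^ l)"
    unfolding pow_coeff_def of_real_mult of_real_gbinomial exp_of_real[symmetric] by simp
  then show ?thesis by (metis complex_cnj_complex_of_real)
qed

lemma pow_coeff_0: "pow_coeff x 0 w = exp (w * of_real (ln x))"
  by (simp add: pow_coeff_def)

lemma pow_coeff_0_Suc:
  assumes "0 < x"
  shows "pow_coeff x 0 (w + 1) = of_real x * pow_coeff x 0 w"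
  using assms by (simp add: pow_coeff_0 distrib_right exp_add exp_of_real)

text \<open>Pascal's rule: multiplying by the Jordan block raises the exponent by 1.\<close>

lemma pow_coeff_Suc_Suc:
  assumes "0 < x"
  shows "pow_coeff x (Suc l) (w + 1) =
    of_real x * pow_coeff x (Suc l) w + of_real (1 - x\<^sup>2) * pow_coeff x l w"
proof -
  define e where "e = exp ((w - of_nat (Suc l)) * of_real (ln x))"
  have "exp ((w - of_nat l) * of_real (ln x)) = exp ((w - of_nat (Suc l)) * of_real (ln x) + of_real (ln x))"
    by (simp add: algebra_simps)
  then have 1: "exp ((w - of_nat l) * of_real (ln x)) = of_real x * e"
    using assms by (simp add: exp_add e_def exp_of_real)
  have 2: "exp ((w + 1 - of_nat (Suc l)) * of_real (ln x)) = of_real x * e"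
    using 1 by simp
  show ?thesis
    unfolding pow_coeff_def 1 2 e_def[symmetric] gbinomial_Suc_Suc by (simp add: algebra_simps)
qed

lemma Jblock_iterate:
  assumes "0 < x" "a < N"
  shows "(Jblock N (of_real x) ^^ k) v a = (\<Sum>l\<le>a. pow_coeff x l (of_nat k) * v (a - l))"
  using assms(2)
proof (induction k arbitrary: a)
  case 0
  have "(\<Sum>l\<le>a. pow_coeff x l (of_nat 0) * v (a - l)) = (\<Sum>l\<le>a. if l = 0 then v a else 0)"
    by (intro sum.cong refl) (auto simp: pow_coeff_def gbinomial_0 dest: gr0_implies_Suc)
  then show ?case by simp
next
  case (Suc k)
  have c: "(cmod (of_real x))\<^sup>2 = x\<^sup>2" by simp
  have "(Jblock N (of_real x) ^^ Suc k) v a = of_real x * (Jblock N (of_real x) ^^ k) v a +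
      of_real (1 - x\<^sup>2) * (if 0 < a then (Jblock N (of_real x) ^^ k) v (a - 1) else 0)"
    using Suc.prems by (simp add: Jblock_def subdiag_def)
  also have "\<dots> = (\<Sum>l\<le>a. pow_coeff x l (of_nat (Suc k)) * v (a - l))"
  proof (cases a)
    case 0
    then show ?thesis
      using Suc.IH[of 0] Suc.prems pow_coeff_0_Suc[OF assms(1), of "of_nat k"] by (simp add: add.commute)
  next
    case (Suc b)
    then have b: "b < N" using Suc.prems by simp
    have "(\<Sum>l\<le>Suc b. pow_coeff x l (of_nat (Suc k)) * v (Suc b - l)) =
        pow_coeff x 0 (of_nat k + 1) * v (Suc b) +
        (\<Sum>l\<le>b. pow_coeff x (Suc l) (of_nat k + 1) * v (b - l))"
      by (subst sum.atMost_Suc_shift) (simp add: add.commute)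
    also have "\<dots> = of_real x * (pow_coeff x 0 (of_nat k) * v (Suc b) +
        (\<Sum>l\<le>b. pow_coeff x (Suc l) (of_nat k) * v (b - l))) +
        of_real (1 - x\<^sup>2) * (\<Sum>l\<le>b. pow_coeff x l (of_nat k) * v (b - l))"
      unfolding pow_coeff_0_Suc[OF assms(1)] pow_coeff_Suc_Suc[OF assms(1)]
      by (simp only: distrib_right distrib_left sum.distrib sum_distrib_left mult.assoc add.assoc)
    also have "pow_coeff x 0 (of_nat k) * v (Suc b) +
        (\<Sum>l\<le>b. pow_coeff x (Suc l) (of_nat k) * v (b - l)) =
        (\<Sum>l\<le>Suc b. pow_coeff x l (of_nat k) * v (Suc b - l))"
      by (simp add: sum.atMost_Suc_shift del: sum.atMost_Suc)
    finally show ?thesis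
      using Suc.IH[OF Suc.prems] Suc.IH[OF b] Suc by simp
  qed
  finally show ?case .
qed

lemma Jblock_0: "Jblock N 0 = subdiag N"
  by (simp add: Jblock_def fun_eq_iff)

text \<open>The block operator acts on each block separately, and a Jordan block reads only the coordinates within the block.\<close>

lemma Jop_iterate:
  assumes "a < n i"
  shows "(Jop n z ^^ k) x (block_start n i + a) = (Jblock (n i) (z i) ^^ k) (block_component n x i) a"
  using assms
proof (induction k arbitrary: a)
  case 0
  then show ?case by (simp add: block_component_def)
next
  case (Suc k)
  define y where "y = (Jop n z ^^ k) x"
  have comp: "block_component n y i b = (Jblock (n i) (z i) ^^ k) (block_component n x i) b" if "b < n i" for b
    using Suc.IH[OF that] that by (simp add: block_component_def y_def)
  have "(Jop n z ^^ Suc k) x (block_start n i + a) = Jblock (n i) (z i) (block_component n y i) a"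
    using Suc.prems by (simp add: Jop_def block_sum_def block_of_eq y_def)
  also have "\<dots> = Jblock (n i) (z i) ((Jblock (n i) (z i) ^^ k) (block_component n x i)) a"
    using Suc.prems comp[of a] comp[of "a - 1"] by (simp add: Jblock_def subdiag_def)
  finally show ?case by simp
qed

lemma Jpower_regular:
  assumes "a < n i" "z i = of_real x" "0 < x"
  shows "Jpower n z t g (block_start n i + a) =
    (\<Sum>l\<le>a. pow_coeff x l (of_real t) * g (block_start n i + a - l))"
proof -
  have "Jpower n z t g (block_start n i + a) =
      (\<Sum>l<n i. pow_coeff x l (of_real t) * (subdiag (n i) ^^ l) (block_component n g i) a)"
    using assms pow_coeff_of_real[OF assms(3)]
    by (simp add: Jpower_def block_sum_def block_of_eq Jblock_power_def)
  also have "\<dots> = (\<Sum>l\<le>a. pow_coeff x l (of_real t) * g (block_start n i + a - l))"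
    using assms(1) by (intro sum.mono_neutral_cong_right) (auto simp: subdiag_power block_component_def)
  finally show ?thesis .
qed

text \<open>For eigenvalue 0 the Jordan block is a shift. Its noninteger powers are 0, which is the convention of the definition also
  where the power is undefined.\<close>

lemma Jpower_zero_block:
  assumes "a < n i" "z i = 0" "0 \<le> t"
  shows "Jpower n z t g (block_start n i + a) =
    (if t \<in> \<nat> \<and> t \<le> real a then g (block_start n i + (a - nat \<lfloor>t\<rfloor>)) else 0)"
proof (cases "t \<in> \<nat>")
  case True
  then obtain r where r: "t = real r" by (auto elim: Nats_cases)
  then show ?thesis
    using assms by (simp add: Jpower_def block_sum_def block_of_eq Jblock_power_def Jblock_0 subdiag_power
        block_component_def less_imp_diff_less)
next
  case False
  then show ?thesis
    using assms by (simp add: Jpower_def block_sum_def block_of_eq Jblock_power_def)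
qed

lemma Jpower_of_nat:
  assumes pos: "\<And>i. 0 < n i" and z: "\<And>i. z i = of_real (x i)" "\<And>i. 0 \<le> x i"
  shows "Jpower n z (real k) g = (Jop n z ^^ k) g"
proof
  fix m
  obtain i a where ia: "a < n i" "m = block_start n i + a" by (rule block_exhaust[where n = n and m = m, OF pos])
  show "Jpower n z (real k) g m = (Jop n z ^^ k) g m"
  proof (cases "x i = 0")
    case True
    then show ?thesis
      using ia z(1)[of i] by (simp add: Jpower_zero_block Jop_iterate Jblock_0 subdiag_power block_component_def
          less_imp_diff_less)
  next
    case False
    then have "0 < x i" using z(2)[of i] by simp
    have "(Jop n z ^^ k) g m = (\<Sum>l\<le>a. pow_coeff (x i) l (of_nat k) * block_component n g i (a - l))"
      unfolding ia(2) Jop_iterate[where n = n, OF ia(1)] z(1) using Jblock_iterate[OF \<open>0 < x i\<close> ia(1)] by simp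
    also have "\<dots> = (\<Sum>l\<le>a. pow_coeff (x i) l (of_nat k) * g (block_start n i + a - l))"
      using ia(1) by (intro sum.cong refl) (simp add: block_component_def)
    finally show ?thesis
      unfolding ia(2) using Jpower_regular[where n = n and z = z, OF ia(1) z(1) \<open>0 < x i\<close>] by simp
  qed
qed

lemma Jblock_injective:
  assumes "w \<noteq> 0" and zero: "\<And>a. a < N \<Longrightarrow> Jblock N w v a = 0" and "a < N"
  shows "v a = 0"
  using \<open>a < N\<close>
proof (induction a)
  case 0
  then show ?case using zero[of 0] \<open>w \<noteq> 0\<close> by (simp add: Jblock_def subdiag_def)
next
  case (Suc a)
  then show ?case using zero[of "Suc a"] \<open>w \<noteq> 0\<close> by (simp add: Jblock_def subdiag_def)
qed

lemma Jblock_iterate_injective: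
  assumes "w \<noteq> 0" and "\<And>a. a < N \<Longrightarrow> (Jblock N w ^^ k) v a = 0" and "a < N"
  shows "v a = 0"
  using assms(2,3)
proof (induction k arbitrary: a)
  case (Suc k)
  have "(Jblock N w ^^ k) v b = 0" if "b < N" for b
    using Jblock_injective[OF \<open>w \<noteq> 0\<close> _ that, of "(Jblock N w ^^ k) v"] Suc.prems(1) by simp
  then show ?case by (rule Suc.IH[OF _ Suc.prems(2)])
qed simp

lemma delta_in_l2: "delta n i j \<in> l2"
proof -
  have "summable (\<lambda>m. (cmod (delta n i j m))\<^sup>2)"
    by (rule summable_finite[of "{block_start n i + j}"]) (auto simp: delta_def)
  then show ?thesis by (simp add: l2_def)
qed

text \<open>The last basis vector of a block is an eigenvector.\<close>

lemma l2_invertible_imp_nonzero: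
  assumes pos: "\<And>i. 0 < n i" and inv: "l2_invertible (Jop n z)"
  shows "z i \<noteq> 0"
proof
  assume "z i = 0"
  obtain T where T: "l2_bounded_operator T" "\<And>x. x \<in> l2 \<Longrightarrow> T (Jop n z x) = x"
    using inv by (auto simp: l2_invertible_def)
  define x where "x = delta n i (n i - 1)"
  have x: "x \<in> l2" by (simp add: x_def delta_in_l2)
  have "Jop n z x = cscale 0 x"
    unfolding x_def using Jop_delta[where i = i and j = "n i - 1" and n = n and z = z] pos[of i] \<open>z i = 0\<close> pos
    by (simp add: cscale_def fun_eq_iff)
  then have "T (Jop n z x) = cscale 0 (T x)" using T(1) x by (simp add: l2_bounded_operator_def)
  with T(2)[OF x] have "x = cscale 0 (T x)" by (rule trans[OF sym])
  then have "x (block_start n i + (n i - 1)) = cscale 0 (T x) (block_start n i + (n i - 1))"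
    by (rule fun_cong)
  also have "\<dots> = 0" by (simp add: cscale_def)
  finally have "x (block_start n i + (n i - 1)) = 0" .
  then show False by (simp add: x_def delta_def)
qed

text \<open>Jordan blocks with nonzero eigenvalue are injective and the one with eigenvalue 0 is nilpotent, so that the generalized
  eigenvectors are the vectors of that block; its basis vectors are counted.\<close>

lemma algebraic_multiplicity_zero:
  assumes pos: "\<And>i. 0 < n i" and z: "inj z" "z i = 0"
  shows "algebraic_multiplicity (Jop n z) 0 = n i"
proof -
  interpret vs: vector_space cscale by (rule vector_space_cscale)
  define V where "V = {x \<in> l2. \<exists>k. ((\<lambda>y. Jop n z y - cscale 0 y) ^^ k) x = 0}"
  have op: "(\<lambda>y. Jop n z y - cscale 0 y) = Jop n z"
    by (simp add: fun_eq_iff cscale_def)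
  define B where "B = delta n i ` {..<n i}"
  have inj: "inj_on (delta n i) {..<n i}"
  proof (rule inj_onI)
    fix a b assume "delta n i a = delta n i b"
    then have "delta n i a (block_start n i + a) = delta n i b (block_start n i + a)" by simp
    then show "a = b" by (simp add: delta_def split: if_splits)
  qed
  have zero_outside: "x (block_start n i' + a) = 0" if x: "x \<in> V" and that: "i' \<noteq> i" "a < n i'" for x i' a
  proof -
    obtain k where k: "(Jop n z ^^ k) x = 0" using x unfolding V_def op by blast
    have "z i' \<noteq> 0" using z that(1) by (metis injD)
    have iter: "(Jblock (n i') (z i') ^^ k) (block_component n x i') b = 0" if "b < n i'" for b
      using Jop_iterate[where n = n, OF that, where k = k and x = x and z = z] k by simp
    have "block_component n x i' a = 0"
      by (rule Jblock_iterate_injective[OF \<open>z i' \<noteq> 0\<close> iter that(2)])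
    then show ?thesis using that(2) by (simp add: block_component_def)
  qed
  have "vs.dim V = card B"
  proof (rule vs.dim_unique)
    show "B \<subseteq> V"
    proof
      fix y assume "y \<in> B"
      then obtain b where b: "y = delta n i b" "b < n i" by (auto simp: B_def)
      have "(Jop n z ^^ n i) y m = 0" for m
      proof -
        define i' a where "i' = block_of n m" and "a = m - block_start n i'"
        have a: "a < n i'" "block_start n i' + a = m"
          using block_decompose[where n = n and m = m, OF pos] by (auto simp: i'_def a_def)
        have iter: "(Jop n z ^^ n i) y m = (Jblock (n i') (z i') ^^ n i) (block_component n y i') a"
          using Jop_iterate[where n = n and z = z and k = "n i" and x = y, OF a(1)] unfolding a(2) .
        show ?thesis
        proof (cases "i' = i")
          case True
          then show ?thesis unfolding iter using z(2) a(1) by (simp add: Jblock_0 subdiag_power)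
        next
          case False
          then have comp: "block_component n y i' = (\<lambda>a. 0)"
            unfolding b(1) using b(2) by (intro ext) (simp add: block_component_delta)
          have "Jblock (n i') (z i') (\<lambda>a. 0) = (\<lambda>a. 0)"
            by (simp add: Jblock_def subdiag_def fun_eq_iff)
          then have "(Jblock (n i') (z i') ^^ k) (\<lambda>a. 0) = (\<lambda>a. 0)" for k
            by (induction k) simp_all
          then show ?thesis unfolding iter comp by simp
        qed
      qed
      then have "(Jop n z ^^ n i) y = 0" by (simp add: fun_eq_iff)
      moreover have "y \<in> l2" unfolding b(1) by (rule delta_in_l2)
      ultimately show "y \<in> V" unfolding V_def op by auto
    qed
    show "V \<subseteq> vs.span B"
    proof
      fix x assume "x \<in> V"
      have "x = (\<Sum>a<n i. cscale (x (block_start n i + a)) (delta n i a))"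
      proof
        fix m
        obtain i' b where b: "b < n i'" "m = block_start n i' + b" by (rule block_exhaust[where n = n and m = m, OF pos])
        have sum_fun: "(\<Sum>a\<in>A. F a) m = (\<Sum>a\<in>A. F a m)" for A and F :: "nat \<Rightarrow> nat \<Rightarrow> complex"
          by (induction A rule: infinite_finite_induct) auto
        have d: "delta n i a m = (if i' = i \<and> a = b then 1 else 0)" if "a < n i" for a
          using that b block_of_eq[of a n i] block_of_eq[of b n i'] by (auto simp: delta_def)
        have "(\<Sum>a<n i. cscale (x (block_start n i + a)) (delta n i a)) m =
            (\<Sum>a<n i. if i' = i \<and> a = b then x m else 0)"
          unfolding sum_fun using d b by (intro sum.cong refl) (auto simp: cscale_def)
        also have "\<dots> = x m"
          using b zero_outside[OF \<open>x \<in> V\<close> _ b(1)] by (cases "i' = i") auto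
        finally show "x m = (\<Sum>a<n i. cscale (x (block_start n i + a)) (delta n i a)) m" by simp
      qed
      moreover have "(\<Sum>a<n i. cscale (x (block_start n i + a)) (delta n i a)) \<in> vs.span B"
        by (intro vs.span_sum vs.span_scale vs.span_base) (auto simp: B_def)
      ultimately show "x \<in> vs.span B" by simp
    qed
    show "vs.independent B"
    proof (rule vs.independent_if_scalars_zero)
      show "finite B" by (simp add: B_def)
      fix c y assume sum: "(\<Sum>y\<in>B. cscale (c y) y) = 0" and "y \<in> B"
      then obtain b where b: "y = delta n i b" "b < n i" by (auto simp: B_def)
      have sum_fun: "(\<Sum>a\<in>A. F a) m = (\<Sum>a\<in>A. F a m)" for A m and F :: "nat \<Rightarrow> nat \<Rightarrow> complex"
        by (induction A rule: infinite_finite_induct) auto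
      have "0 = (\<Sum>a<n i. cscale (c (delta n i a)) (delta n i a)) (block_start n i + b)"
        using sum unfolding B_def sum.reindex[OF inj] by simp
      also have "\<dots> = (\<Sum>a<n i. if a = b then c (delta n i b) else 0)"
        unfolding sum_fun by (intro sum.cong refl) (auto simp: cscale_def delta_def)
      also have "\<dots> = c y" using b by simp
      finally show "c y = 0" by simp
    qed
  qed simp
  also have "card B = n i" using inj by (simp add: B_def card_image)
  finally show ?thesis by (simp add: algebraic_multiplicity_def V_def)
qed

section \<open>Growth of the coefficients in the exponent\<close>

lemma norm_gbinomial_le: "cmod (w gchoose l) \<le> (cmod w + real l) ^ l"
proof -
  have "cmod (w gchoose l) = (\<Prod>i = 0..<l. cmod (w - of_nat i)) / fact l"
    by (simp add: gbinomial_prod_rev norm_divide prod_norm)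
  also have "\<dots> \<le> (\<Prod>i = 0..<l. cmod (w - of_nat i)) / 1"
    by (intro divide_left_mono prod_nonneg) (auto simp: fact_ge_1)
  also have "(\<Prod>i = 0..<l. cmod (w - of_nat i)) \<le> (\<Prod>i = 0..<l. cmod w + real l)"
  proof (intro prod_mono conjI norm_ge_zero)
    fix i assume "i \<in> {0..<l}"
    then show "cmod (w - of_nat i) \<le> cmod w + real l"
      using norm_triangle_ineq4[of w "of_nat i"] by simp
  qed
  also have "\<dots> = (cmod w + real l) ^ l" by simp
  finally show ?thesis by simp
qed

lemma pow_coeff_holomorphic: "pow_coeff x l holomorphic_on A"
  unfolding pow_coeff_def[abs_def] gbinomial_prod_rev by (intro holomorphic_intros) auto

lemma norm_pow_coeff:
  assumes "0 < x" "x < 1"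
  shows "cmod (pow_coeff x l w) = cmod (w gchoose l) * exp ((Re w - real l) * ln x) * (1 - x\<^sup>2) ^ l"
proof -
  have "0 \<le> 1 - x\<^sup>2" using assms by (simp add: abs_square_le_1)
  then show ?thesis by (simp add: pow_coeff_def norm_mult norm_power flip: of_real_power of_real_diff)
qed

text \<open>Away from 0, the rate \<open>- ln x\<close> at which \<open>x powr t\<close> decays is comparable to \<open>1 - x\<close>.\<close>

lemma minus_ln_le:
  assumes "0 < c" "c \<le> x" "x < (1::real)"
  shows "ln x \<le> - (1 - x)" "- ln x \<le> (1 - x) / c"
proof -
  have "0 < x" using assms by simp
  then show "ln x \<le> - (1 - x)" using ln_le_minus_one[of x] by simp
  have "- ln x \<le> 1 / x - 1" using ln_le_minus_one[of "1 / x"] \<open>0 < x\<close> by (simp add: ln_div)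
  also have "\<dots> = (1 - x) / x" using \<open>0 < x\<close> by (simp add: field_simps)
  also have "\<dots> \<le> (1 - x) / c" using assms by (intro divide_left_mono) auto
  finally show "- ln x \<le> (1 - x) / c" .
qed

lemma power_le_exp_half:
  fixes y :: real
  assumes "0 \<le> y"
  shows "y ^ l \<le> (2 * real l) ^ l * exp (y / 2)"
proof (cases "l = 0")
  case False
  define u where "u = y / (2 * real l)"
  have "0 \<le> u" using assms by (simp add: u_def)
  have "u \<le> exp u" using exp_ge_add_one_self[of u] by linarith
  then have "u ^ l \<le> exp u ^ l" using \<open>0 \<le> u\<close> by (intro power_mono)
  also have "exp u ^ l = exp (y / 2)" using False by (simp add: u_def exp_of_nat_mult[symmetric])
  finally have "(2 * real l) ^ l * u ^ l \<le> (2 * real l) ^ l * exp (y / 2)" by (intro mult_left_mono) auto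
  moreover have "(2 * real l) ^ l * u ^ l = y ^ l"
  proof -
    have "2 * real l * u = y" using False by (simp add: u_def)
    then show ?thesis by (metis power_mult_distrib)
  qed
  ultimately show ?thesis by (simp only:)
qed (use assms in simp)

text \<open>With \<open>s = 1 - x\<close>, the coefficient is of the order of \<open>(s (|w| + l))^l exp (- s t)\<close>, and half of the
  exponential absorbs the polynomial in \<open>s t\<close>. The constant is uniform in \<open>x\<close> because the radius
  \<open>1 / s\<close> changes \<open>x powr w\<close> only by a bounded factor.\<close>

lemma pow_coeff_bound_disc:
  assumes "0 < c"
  obtains K where "0 \<le> K" "\<forall>x l t w. c \<le> x \<longrightarrow> x < 1 \<longrightarrow> l < N \<longrightarrow> 0 \<le> t \<longrightarrow>
    cmod (w - of_real t) \<le> 1 / (1 - x) \<longrightarrow> cmod (pow_coeff x l w) \<le> K * exp (- ((1 - x) * t / 2))"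
proof -
  define K where "K l = 2 ^ l * ((2 * real l) ^ l * exp ((1 + real l) / 2)) * exp ((1 + real l) / c)" for l
  have K0: "0 \<le> K l" for l by (simp add: K_def)
  have "cmod (pow_coeff x l w) \<le> (\<Sum>l<N. K l) * exp (- ((1 - x) * t / 2))"
    if x: "c \<le> x" "x < 1" and "l < N" and t: "0 \<le> t" "cmod (w - of_real t) \<le> 1 / (1 - x)"
    for x l t w
  proof -
    define s where "s = 1 - x"
    have s: "0 < s" "s \<le> 1" and "0 < x" using x \<open>0 < c\<close> by (auto simp: s_def)
    note ln = minus_ln_le[OF \<open>0 < c\<close> x, folded s_def]
    define y where "y = s * t + 1 + real l"
    have "0 \<le> y" using s t by (simp add: y_def)
    have "cmod w \<le> t + 1 / s"
      using t norm_triangle_sub[of w "of_real t"] by (simp add: s_def)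
    then have "s * (cmod w + real l) \<le> s * (t + 1 / s + real l)" using s by (intro mult_left_mono) auto
    also have "\<dots> \<le> y" using s mult_left_le_one_le[of "real l" s] by (simp add: y_def algebra_simps)
    finally have "(s * (cmod w + real l)) ^ l \<le> y ^ l" using s by (intro power_mono) auto
    also have "\<dots> \<le> (2 * real l) ^ l * exp (y / 2)" using \<open>0 \<le> y\<close> by (rule power_le_exp_half)
    finally have pw: "(s * (cmod w + real l)) ^ l \<le> (2 * real l) ^ l * exp (y / 2)" .
    have "\<bar>Re w - t\<bar> \<le> 1 / s" using abs_Re_le_cmod[of "w - of_real t"] t by (simp add: s_def)
    then have "t - 1 / s - real l \<le> Re w - real l" by simp
    then have "(Re w - real l) * ln x \<le> (t - 1 / s - real l) * ln x"
      using ln(1) s by (intro mult_right_mono_neg) auto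
    also have "\<dots> = t * ln x + (1 / s + real l) * (- ln x)" by (simp add: algebra_simps)
    also have "\<dots> \<le> t * (- s) + (1 / s + real l) * (s / c)"
      using ln t s by (intro add_mono mult_left_mono) auto
    also have "(1 / s + real l) * (s / c) = (1 + real l * s) / c"
      using s by (simp add: distrib_right add_divide_distrib)
    also have "\<dots> \<le> (1 + real l) / c"
      using s \<open>0 < c\<close> by (intro divide_right_mono) (auto simp: mult_left_le)
    finally have ex: "exp ((Re w - real l) * ln x) \<le> exp (- (s * t)) * exp ((1 + real l) / c)"
      by (simp add: exp_add[symmetric] mult.commute)
    have "1 - x\<^sup>2 = s * (1 + x)" by (simp add: s_def power2_eq_square algebra_simps)
    also have "\<dots> \<le> s * 2" using x s by (intro mult_left_mono) auto
    finally have x2: "(1 - x\<^sup>2) ^ l \<le> (2 * s) ^ l"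
      using x \<open>0 < x\<close> by (intro power_mono) (auto simp: abs_square_le_1)
    have "cmod (pow_coeff x l w) \<le>
        (cmod w + real l) ^ l * (exp (- (s * t)) * exp ((1 + real l) / c)) * (2 * s) ^ l"
      unfolding norm_pow_coeff[OF \<open>0 < x\<close> x(2)]
      using ex x2 x \<open>0 < x\<close> by (intro mult_mono norm_gbinomial_le) (auto simp: abs_square_le_1)
    also have "\<dots> = 2 ^ l * (s * (cmod w + real l)) ^ l * exp ((1 + real l) / c) * exp (- (s * t))"
      by (simp add: power_mult_distrib)
    also have "\<dots> \<le> 2 ^ l * ((2 * real l) ^ l * exp (y / 2)) * exp ((1 + real l) / c) * exp (- (s * t))"
      using pw by (intro mult_right_mono mult_left_mono) auto
    also have "\<dots> = K l * (exp (s * t / 2) * exp (- (s * t)))"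
      by (simp add: K_def y_def add_divide_distrib exp_add mult_ac)
    also have "exp (s * t / 2) * exp (- (s * t)) = exp (- (s * t / 2))"
      by (simp add: exp_add[symmetric])
    also have "K l * exp (- (s * t / 2)) \<le> (\<Sum>l<N. K l) * exp (- (s * t / 2))"
      using \<open>l < N\<close> K0 by (intro mult_right_mono member_le_sum) auto
    finally show ?thesis by (simp add: s_def)
  qed
  moreover have "0 \<le> (\<Sum>l<N. K l)" using K0 by (intro sum_nonneg) auto
  ultimately show ?thesis using that by blast
qed

lemma pow_coeff_bound_half_plane:
  assumes "0 < c"
  obtains K where "0 \<le> K" "\<forall>x l w. c \<le> x \<longrightarrow> x < 1 \<longrightarrow> l < N \<longrightarrow> - 1 \<le> Re w \<longrightarrow>
    cmod (pow_coeff x l w) \<le> K * (1 + cmod w) ^ N"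
proof -
  define K where "K l = (1 + real l) ^ l * exp ((1 + real l) / c)" for l
  have K0: "0 \<le> K l" for l by (simp add: K_def)
  have "cmod (pow_coeff x l w) \<le> (\<Sum>l<N. K l) * (1 + cmod w) ^ N"
    if x: "c \<le> x" "x < 1" and "l < N" and w: "- 1 \<le> Re w" for x l w
  proof -
    have "0 < x" using x \<open>0 < c\<close> by simp
    note ln = minus_ln_le[OF \<open>0 < c\<close> x]
    have "- ln x \<le> 1 / c" using ln(2) \<open>0 < c\<close> \<open>0 < x\<close> divide_right_mono[of "1 - x" 1 c] by simp
    have "(Re w - real l) * ln x \<le> (- 1 - real l) * ln x"
      using ln(1) x w by (intro mult_right_mono_neg) auto
    also have "\<dots> = (1 + real l) * (- ln x)" by (simp add: algebra_simps)
    also have "\<dots> \<le> (1 + real l) * (1 / c)"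
      using \<open>- ln x \<le> 1 / c\<close> by (intro mult_left_mono) auto
    finally have ex: "exp ((Re w - real l) * ln x) \<le> exp ((1 + real l) / c)" by simp
    have "cmod w + real l \<le> (1 + real l) * (1 + cmod w)"
      using mult_nonneg_nonneg[of "real l" "cmod w"] by (simp add: algebra_simps)
    then have "(cmod w + real l) ^ l \<le> ((1 + real l) * (1 + cmod w)) ^ l"
      by (intro power_mono) auto
    also have "\<dots> = (1 + real l) ^ l * (1 + cmod w) ^ l" by (rule power_mult_distrib)
    also have "\<dots> \<le> (1 + real l) ^ l * (1 + cmod w) ^ N"
      using \<open>l < N\<close> by (intro mult_left_mono power_increasing) auto
    finally have "cmod (w gchoose l) \<le> (1 + real l) ^ l * (1 + cmod w) ^ N"
      using norm_gbinomial_le[of w l] by linarith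
    moreover have "(1 - x\<^sup>2) ^ l \<le> 1" using x \<open>0 < x\<close> by (intro power_le_one) (auto simp: abs_square_le_1)
    ultimately have "cmod (pow_coeff x l w) \<le>
        (1 + real l) ^ l * (1 + cmod w) ^ N * exp ((1 + real l) / c) * 1"
      unfolding norm_pow_coeff[OF \<open>0 < x\<close> x(2)]
      using ex x \<open>0 < x\<close> by (intro mult_mono) (auto simp: abs_square_le_1)
    also have "\<dots> = K l * (1 + cmod w) ^ N" by (simp add: K_def)
    also have "\<dots> \<le> (\<Sum>l<N. K l) * (1 + cmod w) ^ N"
      using \<open>l < N\<close> K0 by (intro mult_right_mono member_le_sum) auto
    finally show ?thesis .
  qed
  moreover have "0 \<le> (\<Sum>l<N. K l)" using K0 by (intro sum_nonneg) auto
  ultimately show ?thesis using that by blast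
qed

text \<open>Dividing by \<open>(w + 2)^N\<close> makes the sum of the series bounded in the half-plane. The half-plane reaches beyond
  0 so that zeros at 0 are admitted and the value at 0 is obtained.\<close>

lemma series_zeros_positive_density:
  fixes e :: "nat \<Rightarrow> complex \<Rightarrow> complex" and a :: "nat \<Rightarrow> real"
  assumes hol: "\<And>m. e m holomorphic_on {w. - 1 < Re w}"
    and bound: "\<And>m w. - 1 < Re w \<Longrightarrow> cmod (e m w) \<le> a m * (1 + cmod w) ^ N"
    and a: "summable a"
    and \<mu>: "inj \<mu>" "\<And>k. 0 \<le> \<mu> k" "\<And>k. \<mu> k \<le> C * (real k + 1)"
    and zero: "\<And>k. (\<Sum>m. e m (of_real (\<mu> k))) = 0"
    and "- 1 < x"
  shows "(\<Sum>m. e m (of_real x)) = 0"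
proof -
  have a0: "0 \<le> a m" for m using order_trans[OF norm_ge_zero bound[of 0 m]] by simp
  define H where "H = {w::complex. 0 < Re w}"
  have "open H" unfolding H_def by (rule open_halfspace_Re_gt)
  define b where "b m w = e m (w - 1) / (w + 1) ^ N" for m w
  have w1: "w + 1 \<noteq> 0" "1 + cmod (w - 1) \<le> 4 * cmod (w + 1)" if "w \<in> H" for w
  proof -
    have "1 \<le> cmod (w + 1)" using that abs_Re_le_cmod[of "w + 1"] by (simp add: H_def)
    then show "w + 1 \<noteq> 0" by auto
    have "cmod (w - 1) \<le> cmod (w + 1) + 2"
      using norm_triangle_ineq4[of "w + 1" 2] by simp
    with \<open>1 \<le> cmod (w + 1)\<close> show "1 + cmod (w - 1) \<le> 4 * cmod (w + 1)" by linarith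
  qed
  have b_bound: "cmod (b m w) \<le> 4 ^ N * a m" if "w \<in> H" for m w
  proof -
    have "cmod (e m (w - 1)) \<le> a m * (1 + cmod (w - 1)) ^ N"
      using that by (intro bound) (simp add: H_def)
    also have "\<dots> \<le> a m * (4 * cmod (w + 1)) ^ N"
      using w1(2)[OF that] a0 by (intro mult_left_mono power_mono) auto
    also have "\<dots> = 4 ^ N * a m * cmod (w + 1) ^ N" by (simp add: power_mult_distrib)
    finally show ?thesis
      using w1(1)[OF that] by (simp add: b_def norm_divide norm_power divide_le_eq)
  qed
  have holb: "b m holomorphic_on H" for m
  proof -
    have image: "(\<lambda>w. w - 1) ` H \<subseteq> {w. - 1 < Re w}" by (auto simp: H_def)
    have "(\<lambda>w. w - 1) holomorphic_on H" by (intro holomorphic_intros)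
    from holomorphic_on_compose_gen[OF this hol image]
    have "(\<lambda>w. e m (w - 1)) holomorphic_on H" by (simp only: o_def)
    then show ?thesis unfolding b_def[abs_def] using w1(1) by (intro holomorphic_intros) auto
  qed
  have sum4: "summable (\<lambda>m. 4 ^ N * a m)" using a by (rule summable_mult)
  define F where "F w = (\<Sum>m. b m w)" for w
  have unif: "uniform_limit H (\<lambda>n w. \<Sum>m<n. b m w) F sequentially"
    unfolding F_def by (rule Weierstrass_m_test[OF b_bound sum4])
  have holF: "F holomorphic_on H"
  proof (rule holomorphic_uniform_sequence[OF \<open>open H\<close>])
    show "(\<lambda>w. \<Sum>m<n. b m w) holomorphic_on H" for n by (intro holomorphic_intros holb)
    fix w assume "w \<in> H"
    then obtain d where "0 < d" "cball w d \<subseteq> H" using \<open>open H\<close> open_contains_cball by blast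
    then show "\<exists>d>0. cball w d \<subseteq> H \<and> uniform_limit (cball w d) (\<lambda>n w. \<Sum>m<n. b m w) F sequentially"
      using uniform_limit_on_subset[OF unif] by blast
  qed
  have F_bound: "cmod (F w) \<le> (\<Sum>m. 4 ^ N * a m)" if "w \<in> H" for w
    unfolding F_def by (rule norm_suminf_le[OF b_bound[OF that] sum4])
  have F_eq: "F (of_real t + 1) = (\<Sum>m. e m (of_real t)) / (of_real t + 2) ^ N" if "- 1 < t" for t :: real
  proof -
    have "of_real t + 1 \<in> H" using that by (simp add: H_def)
    then have "summable (\<lambda>m. b m (of_real t + 1))"
      using b_bound by (intro summable_comparison_test'[OF sum4]) auto
    moreover have "e m (of_real t) = b m (of_real t + 1) * (of_real t + 2) ^ N" for m
      using w1(1)[OF \<open>of_real t + 1 \<in> H\<close>] by (simp add: b_def add.assoc)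
    ultimately have "(\<Sum>m. e m (of_real t)) = F (of_real t + 1) * (of_real t + 2) ^ N"
      by (simp add: F_def suminf_mult2)
    then show ?thesis using w1(1)[OF \<open>of_real t + 1 \<in> H\<close>] by (simp add: add.assoc)
  qed
  have "1 \<le> C + 1" using \<mu>(2,3)[of 0] by simp
  have "F (of_real (x + 1)) = 0"
  proof (rule half_plane_zeros_linear_growth[where \<mu> = "\<lambda>k. \<mu> k + 1" and C = "C + 1"])
    show "F holomorphic_on {w. 0 < Re w}" using holF by (simp add: H_def)
    show "cmod (F w) \<le> (\<Sum>m. 4 ^ N * a m)" if "0 < Re w" for w using F_bound that by (simp add: H_def)
    show "inj (\<lambda>k. \<mu> k + 1)" using \<mu>(1) by (simp add: inj_def)
    show "1 \<le> \<mu> k + 1" for k using \<mu>(2) by simp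
    show "\<mu> k + 1 \<le> (C + 1) * (real k + 1)" for k using \<mu>(3)[of k] by (simp add: algebra_simps)
    show "F (of_real (\<mu> k + 1)) = 0" for k
      using F_eq[of "\<mu> k"] zero[of k] \<mu>(2)[of k] by simp
    show "0 < x + 1" using \<open>- 1 < x\<close> by simp
  qed
  then have "(\<Sum>m. e m (of_real x)) / (of_real x + 2) ^ N = 0" using F_eq[OF \<open>- 1 < x\<close>] by simp
  moreover have "(of_real x + 2 :: complex) \<noteq> 0"
  proof -
    have "of_real x + 1 \<in> H" using \<open>- 1 < x\<close> by (simp add: H_def)
    from w1(1)[OF this] show ?thesis by (simp add: add.assoc)
  qed
  ultimately show ?thesis by simp
qed

section \<open>The orbit of a block diagonal Carleson frame\<close>

lemma l2_frame_coordinates: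
  assumes "l2_frame \<phi>"
  obtains A B where "0 < A" "\<And>m. summable (\<lambda>k. (cmod (\<phi> k m))\<^sup>2)"
    "\<And>m. A \<le> (\<Sum>k. (cmod (\<phi> k m))\<^sup>2)" "\<And>m. (\<Sum>k. (cmod (\<phi> k m))\<^sup>2) \<le> B"
proof -
  obtain A B where AB: "0 < A" "\<And>h. h \<in> l2 \<Longrightarrow> summable (\<lambda>k. (cmod (l2_inner h (\<phi> k)))\<^sup>2) \<and>
      A * (l2_norm h)\<^sup>2 \<le> (\<Sum>k. (cmod (l2_inner h (\<phi> k)))\<^sup>2) \<and>
      (\<Sum>k. (cmod (l2_inner h (\<phi> k)))\<^sup>2) \<le> B * (l2_norm h)\<^sup>2"
    using assms unfolding l2_frame_def by metis
  define e where "e m = (\<lambda>m'. if m' = m then 1 else 0 :: complex)" for m :: nat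
  have e: "e m \<in> l2" "(l2_norm (e m))\<^sup>2 = 1" "l2_inner (e m) y = cnj (y m)" for m y
  proof -
    have z: "e m m' = 0" if "Suc m \<le> m'" for m' using that by (simp add: e_def)
    show "e m \<in> l2" using l2_finite_support(1)[where x = "e m" and N = "Suc m", OF z] .
    have "(l2_norm (e m))\<^sup>2 = (\<Sum>m'<Suc m. (cmod (e m m'))\<^sup>2)"
      by (rule l2_finite_support(2)) (rule z)
    also have "\<dots> = (\<Sum>m'<Suc m. if m' = m then 1 else 0)"
      by (intro sum.cong refl) (simp add: e_def)
    finally show "(l2_norm (e m))\<^sup>2 = 1" by simp
    have "l2_inner (e m) y = (\<Sum>m'<Suc m. e m m' * cnj (y m'))"
      by (rule l2_finite_support(3)) (rule z)
    also have "\<dots> = (\<Sum>m'<Suc m. if m' = m then cnj (y m) else 0)"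
      by (intro sum.cong refl) (simp add: e_def)
    finally show "l2_inner (e m) y = cnj (y m)" by simp
  qed
  show ?thesis using that[OF AB(1), of B] AB(2)[OF e(1)] unfolding e(2,3) by simp
qed

locale Carleson_block_frame =
  fixes n :: "nat \<Rightarrow> nat" and x :: "nat \<Rightarrow> real" and g :: "nat \<Rightarrow> complex" and N :: nat
  assumes n_pos: "\<And>i. 0 < n i" and n_le: "\<And>i. n i \<le> N"
    and x_nonneg: "\<And>i. 0 \<le> x i" and x_less_1: "\<And>i. x i < 1"
    and Carleson: "Carleson_sequence (\<lambda>i. complex_of_real (x i))"
    and frame: "l2_frame (\<lambda>k. (Jop n (\<lambda>i. complex_of_real (x i)) ^^ k) g)"
begin

abbreviation z :: "nat \<Rightarrow> complex" where "z \<equiv> (\<lambda>i. complex_of_real (x i))"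

definition block :: "nat \<Rightarrow> nat" where "block m = block_of n m"
definition position :: "nat \<Rightarrow> nat" where "position m = m - block_start n (block m)"
definition gap :: "nat \<Rightarrow> real" where "gap m = 1 - x (block m)"
definition orbit :: "real \<Rightarrow> nat \<Rightarrow> complex" where "orbit t = Jpower n z t g"

lemma position_less: "position m < n (block m)" and block_start_plus_position: "block_start n (block m) + position m = m"
  using block_decompose[where n = n and m = m, OF n_pos] by (auto simp: block_def position_def)

lemma block_start_plus: "j < n i \<Longrightarrow> block (block_start n i + j) = i"
  and position_start_plus: "j < n i \<Longrightarrow> position (block_start n i + j) = j"
  by (simp_all add: block_def position_def block_of_eq)

lemma position_less_N: "position m < N"
  using position_less[of m] n_le[of "block m"] by linarith

lemma block_position_diff:
  assumes "l \<le> position m"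
  shows "block (m - l) = block m" "position (m - l) = position m - l"
proof -
  have "m - l = block_start n (block m) + (position m - l)" using block_start_plus_position[of m] assms by linarith
  moreover have "position m - l < n (block m)" using position_less[of m] by simp
  ultimately show "block (m - l) = block m" "position (m - l) = position m - l"
    using block_start_plus position_start_plus by metis+
qed

lemma gap_pos: "0 < gap m" and gap_le_1: "gap m \<le> 1"
  using x_nonneg x_less_1 by (auto simp: gap_def)

text \<open>At most \<open>P\<close> blocks have their eigenvalue at a given dyadic distance from 1, and each block has at most \<open>N\<close> coordinates.\<close>

lemma gap_lacunary: "lacunary gap"
proof -
  obtain P :: nat where P: "\<And>p. finite {i. (1/2) ^ Suc p < 1 - x i \<and> 1 - x i \<le> (1/2) ^ p}"
    "\<And>p. card {i. (1/2) ^ Suc p < 1 - x i \<and> 1 - x i \<le> (1/2) ^ p} \<le> P"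
    using Carleson_dyadic_card[OF Carleson x_nonneg x_less_1] by blast
  have "finite {m. (1/2) ^ Suc p < gap m \<and> gap m \<le> (1/2) ^ p} \<and>
      card {m. (1/2) ^ Suc p < gap m \<and> gap m \<le> (1/2) ^ p} \<le> P * N" for p
  proof -
    define I where "I = {i. (1/2) ^ Suc p < 1 - x i \<and> 1 - x i \<le> (1/2) ^ p}"
    have fin: "finite (I \<times> {..<N})" using P(1)[of p] by (simp add: I_def)
    have sub: "{m. (1/2) ^ Suc p < gap m \<and> gap m \<le> (1/2) ^ p} \<subseteq> (\<lambda>(i, j). block_start n i + j) ` (I \<times> {..<N})"
    proof
      fix m assume "m \<in> {m. (1/2) ^ Suc p < gap m \<and> gap m \<le> (1/2) ^ p}"
      then have "(block m, position m) \<in> I \<times> {..<N}" using position_less_N by (simp add: I_def gap_def)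
      then show "m \<in> (\<lambda>(i, j). block_start n i + j) ` (I \<times> {..<N})"
        using block_start_plus_position[of m] by (intro image_eqI[of _ _ "(block m, position m)"]) auto
    qed
    have "card {m. (1/2) ^ Suc p < gap m \<and> gap m \<le> (1/2) ^ p} \<le> card (I \<times> {..<N})"
      using card_mono[OF finite_imageI[OF fin] sub] card_image_le[OF fin, of "\<lambda>(i, j). block_start n i + j"]
      by linarith
    also have "\<dots> \<le> P * N" using P(2)[of p] by (simp add: I_def card_cartesian_product)
    finally show ?thesis using finite_subset[OF sub finite_imageI[OF fin]] by simp
  qed
  then show ?thesis unfolding lacunary_def using gap_pos gap_le_1 by blast
qed

lemma finite_far_coordinates:
  assumes "0 < \<eta>"
  shows "finite {m. \<eta> \<le> gap m}"
proof -
  have "(\<lambda>m. sqrt (gap m)) \<longlonglongrightarrow> 0"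
    by (rule summable_LIMSEQ_zero[OF lacunary_summable_sqrt[OF gap_lacunary]])
  then have "\<forall>\<^sub>F m in sequentially. sqrt (gap m) < sqrt \<eta>"
    using assms by (intro order_tendstoD(2)) auto
  then obtain M where "\<And>m. M \<le> m \<Longrightarrow> gap m < \<eta>" by (auto simp: eventually_sequentially)
  then have "{m. \<eta> \<le> gap m} \<subseteq> {..<M}" by (auto simp: not_le[symmetric])
  then show ?thesis using finite_subset by blast
qed

lemma regular_tail: obtains M0 where "\<And>m. M0 \<le> m \<Longrightarrow> x (block m) \<noteq> 0"
proof -
  have "finite {m. 1 \<le> gap m}" by (rule finite_far_coordinates) simp
  then obtain M0 where "{m. 1 \<le> gap m} \<subseteq> {..<M0}"
    using finite_nat_iff_bounded by blast
  then have "gap m < 1" if "M0 \<le> m" for m using that by (force simp: not_le[symmetric])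
  then have "x (block m) \<noteq> 0" if "M0 \<le> m" for m using that by (force simp: gap_def)
  then show ?thesis using that by blast
qed

text \<open>The eigenvalues tend to 1, so that only finitely many are below \<open>1/2\<close>.\<close>

lemma eigenvalue_lower_bound:
  obtains c where "0 < c" "\<And>m. x (block m) \<noteq> 0 \<Longrightarrow> c \<le> x (block m)"
proof -
  define F where "F = (\<lambda>m. x (block m)) ` {m. 1/2 \<le> gap m} - {0}"
  have fin: "finite F" unfolding F_def using finite_far_coordinates[of "1/2"] by simp
  define c where "c = Min (insert (1/2) F)"
  have "0 < c" unfolding c_def using fin x_nonneg by (subst Min_gr_iff) (auto simp: F_def less_le)
  moreover have "c \<le> x (block m)" if "x (block m) \<noteq> 0" for m
  proof (cases "1/2 \<le> gap m")
    case True
    then have "x (block m) \<in> F" using that by (auto simp: F_def)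
    then show ?thesis unfolding c_def using fin by (intro Min_le) auto
  next
    case False
    then have "1/2 \<le> x (block m)" by (simp add: gap_def)
    moreover have "c \<le> 1/2" unfolding c_def using fin by (intro Min_le) auto
    ultimately show ?thesis by linarith
  qed
  ultimately show ?thesis using that by blast
qed

lemma orbit_regular:
  assumes "x (block m) \<noteq> 0"
  shows "orbit t m = (\<Sum>l\<le>position m. pow_coeff (x (block m)) l (of_real t) * g (m - l))"
proof -
  have "0 < x (block m)" using assms x_nonneg[of "block m"] by simp
  from Jpower_regular[where n = n and z = z and g = g and t = t, OF position_less refl this]
  show ?thesis unfolding block_start_plus_position by (simp add: orbit_def)
qed

lemma orbit_zero_block:
  assumes "x (block m) = 0" "0 \<le> t"
  shows "orbit t m = (if t \<in> \<nat> \<and> t \<le> real (position m) then g (m - nat \<lfloor>t\<rfloor>) else 0)"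
proof -
  have "z (block m) = 0" using assms by simp
  from Jpower_zero_block[where n = n and g = g and z = z and t = t, OF position_less this \<open>0 \<le> t\<close>]
  have eq: "orbit t m = (if t \<in> \<nat> \<and> t \<le> real (position m) then g (block_start n (block m) + (position m - nat \<lfloor>t\<rfloor>)) else 0)"
    unfolding block_start_plus_position by (simp add: orbit_def)
  have "block_start n (block m) + (position m - nat \<lfloor>t\<rfloor>) = m - nat \<lfloor>t\<rfloor>" if "t \<le> real (position m)"
  proof -
    have "nat \<lfloor>t\<rfloor> \<le> position m" using that by linarith
    then show ?thesis using block_start_plus_position[of m] by linarith
  qed
  then show ?thesis unfolding eq by simp
qed

lemma orbit_of_nat: "orbit (real k) = (Jop n z ^^ k) g"
  unfolding orbit_def by (rule Jpower_of_nat[OF n_pos refl x_nonneg])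

lemma frame_nat: "l2_frame (\<lambda>k. orbit (real k))"
  unfolding orbit_of_nat by (rule frame)

lemma orbit_0: "orbit 0 m = g m"
  using orbit_of_nat[of 0] by simp

text \<open>The Bessel inequality for the unit vector \<open>m\<close> bounds \<open>\<Sum>k. |orbit k m|^2\<close>. The leading term of \<open>orbit k m\<close>
  is \<open>x^k g m\<close>, with square sum \<open>|g m|^2 / (1 - x^2)\<close>; the remaining terms involve only earlier coordinates
  of the same block and are square summable by induction over the position.\<close>

lemma g_bound:
  obtains C where "0 \<le> C" "\<And>m. cmod (g m) \<le> C * sqrt (gap m)"
proof -
  obtain A B where AB: "\<And>m. summable (\<lambda>k. (cmod (orbit (real k) m))\<^sup>2)"
    "\<And>m. (\<Sum>k. (cmod (orbit (real k) m))\<^sup>2) \<le> B"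
    using l2_frame_coordinates[OF frame_nat] by metis
  have "0 \<le> B" using AB(2)[of 0] suminf_nonneg[OF AB(1)[of 0]] by simp
  obtain c where c: "0 < c" "\<And>m. x (block m) \<noteq> 0 \<Longrightarrow> c \<le> x (block m)" using eigenvalue_lower_bound by blast
  obtain K where K: "0 \<le> K" "\<forall>x l t w. c \<le> x \<longrightarrow> x < 1 \<longrightarrow> l < N \<longrightarrow> 0 \<le> t \<longrightarrow>
    cmod (w - of_real t) \<le> 1 / (1 - x) \<longrightarrow> cmod (pow_coeff x l w) \<le> K * exp (- ((1 - x) * t / 2))"
    using pow_coeff_bound_disc[OF c(1), of N] by blast
  have "\<exists>C\<ge>0. \<forall>m. x (block m) \<noteq> 0 \<and> position m \<le> j \<longrightarrow> cmod (g m) \<le> C * sqrt (gap m)" for j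
  proof (induction j rule: less_induct)
    case (less j)
    have "\<exists>C\<ge>0. \<forall>m. x (block m) \<noteq> 0 \<and> position m < j \<longrightarrow> cmod (g m) \<le> C * sqrt (gap m)"
    proof (cases j)
      case (Suc j')
      then show ?thesis using less.IH[of j'] by (simp add: less_Suc_eq_le)
    qed auto
    then obtain C where C: "0 \<le> C"
      "\<And>m. x (block m) \<noteq> 0 \<Longrightarrow> position m < j \<Longrightarrow> cmod (g m) \<le> C * sqrt (gap m)" by blast
    define D where "D = real N * K * C"
    define C' where "C' = sqrt (2 * (2 * B + 4 * D\<^sup>2))"
    have "cmod (g m) \<le> C' * sqrt (gap m)" if m: "x (block m) \<noteq> 0" "position m \<le> j" for m
    proof -
      define y where "y = x (block m)"
      define s where "s = gap m"
      have s: "0 < s" "s \<le> 1" "s = 1 - y" using gap_pos gap_le_1 by (auto simp: s_def gap_def y_def)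
      have y: "0 < y" "y < 1" "c \<le> y" using c m x_less_1 by (auto simp: y_def less_le_trans)
      have pointwise: "(y\<^sup>2) ^ k * (cmod (g m))\<^sup>2 \<le> 2 * (cmod (orbit (real k) m))\<^sup>2 + 2 * D\<^sup>2 * s * exp (- (s * real k))" for k
      proof -
        \<comment> \<open>The terms that involve earlier coordinates of the block.\<close>
        define r where "r = (\<Sum>l<position m. pow_coeff y (Suc l) (of_real (real k)) * g (m - Suc l))"
        have "orbit (real k) m = pow_coeff y 0 (of_real (real k)) * g m + r"
          unfolding orbit_regular[OF m(1)] y_def[symmetric] r_def
          by (subst sum.atMost_shift) simp
        moreover have "pow_coeff y 0 (of_real (real k)) = of_real (y ^ k)"
          using y by (simp add: pow_coeff_0 exp_of_nat_mult exp_of_real)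
        ultimately have "of_real (y ^ k) * g m = orbit (real k) m + - r" by simp
        then have "(cmod (of_real (y ^ k) * g m))\<^sup>2 \<le> 2 * (cmod (orbit (real k) m))\<^sup>2 + 2 * (cmod r)\<^sup>2"
          using norm_add_power2_le[of "orbit (real k) m" "- r"] by simp
        moreover have "cmod r \<le> D * sqrt s * exp (- (s * real k / 2))"
        proof -
          have "cmod r \<le> (\<Sum>l<position m. K * exp (- (s * real k / 2)) * (C * sqrt s))"
            unfolding r_def
          proof (rule sum_norm_le)
            fix l assume "l \<in> {..<position m}"
            then have l: "Suc l \<le> position m" by simp
            then have "Suc l < N" using position_less_N[of m] by linarith
            have "cmod (pow_coeff y (Suc l) (of_real (real k))) \<le> K * exp (- (s * real k / 2))"
              using K(2)[rule_format, OF y(3,2) \<open>Suc l < N\<close>, of "real k" "of_real (real k)"] s by simp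
            moreover have "cmod (g (m - Suc l)) \<le> C * sqrt s"
            proof -
              have "position (m - Suc l) < j" using block_position_diff(2)[OF l] m(2) l by linarith
              then show ?thesis using C(2)[of "m - Suc l"] block_position_diff(1)[OF l] m(1) by (simp add: s_def gap_def)
            qed
            ultimately show "cmod (pow_coeff y (Suc l) (of_real (real k)) * g (m - Suc l))
                \<le> K * exp (- (s * real k / 2)) * (C * sqrt s)"
              unfolding norm_mult using K(1) by (intro mult_mono) auto
          qed
          also have "\<dots> = real (position m) * (K * exp (- (s * real k / 2)) * (C * sqrt s))" by simp
          also have "\<dots> \<le> real N * (K * exp (- (s * real k / 2)) * (C * sqrt s))"
            using position_less_N[of m] K(1) C(1) s by (intro mult_right_mono) auto
          finally show ?thesis by (simp add: D_def mult_ac)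
        qed
        then have "(cmod r)\<^sup>2 \<le> (D * sqrt s * exp (- (s * real k / 2)))\<^sup>2" by (intro power_mono) auto
        moreover have "(D * sqrt s * exp (- (s * real k / 2)))\<^sup>2 = D\<^sup>2 * s * exp (- (s * real k))"
          using s by (simp add: power_mult_distrib exp_double[symmetric])
        moreover have "(cmod (of_real (y ^ k) * g m))\<^sup>2 = (y\<^sup>2) ^ k * (cmod (g m))\<^sup>2"
          using y by (simp add: norm_mult norm_power power_mult_distrib power_mult[symmetric] mult.commute)
        ultimately show ?thesis by linarith
      qed
      have y2: "y\<^sup>2 < 1" "0 \<le> y\<^sup>2" using y by (auto simp: abs_square_less_1)
      have "1 / (1 - y\<^sup>2) * (cmod (g m))\<^sup>2 = (\<Sum>k. (y\<^sup>2) ^ k * (cmod (g m))\<^sup>2)"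
        using y2 by (simp add: suminf_mult2[symmetric] summable_geometric suminf_geometric)
      also have "\<dots> \<le> (\<Sum>k. 2 * (cmod (orbit (real k) m))\<^sup>2 + 2 * D\<^sup>2 * s * exp (- (s * real k)))"
        using y2 suminf_exp_le(1)[OF s(1)] AB(1)
        by (intro suminf_le pointwise summable_add summable_mult summable_mult2 summable_geometric) auto
      also have "\<dots> = 2 * (\<Sum>k. (cmod (orbit (real k) m))\<^sup>2) + 2 * D\<^sup>2 * s * (\<Sum>k. exp (- (s * real k)))"
        using suminf_exp_le(1)[OF s(1)] AB(1)
        by (simp add: suminf_add[symmetric] summable_mult suminf_mult)
      also have "\<dots> \<le> 2 * B + 2 * D\<^sup>2 * s * (1 + 1 / s)"
        using suminf_exp_le(2)[OF s(1)] AB(2) s by (intro add_mono mult_left_mono) auto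
      also have "2 * D\<^sup>2 * s * (1 + 1 / s) = 2 * D\<^sup>2 * (s + 1)" using s by (simp add: field_simps)
      also have "2 * D\<^sup>2 * (s + 1) \<le> 2 * D\<^sup>2 * 2" using s by (intro mult_left_mono) auto
      finally have "1 / (1 - y\<^sup>2) * (cmod (g m))\<^sup>2 \<le> 2 * B + 4 * D\<^sup>2" by simp
      then have "(cmod (g m))\<^sup>2 \<le> (2 * B + 4 * D\<^sup>2) * (1 - y\<^sup>2)"
        using y2 by (simp add: field_simps)
      also have "1 - y\<^sup>2 = s * (1 + y)"
        unfolding s(3) by (simp add: power2_eq_square algebra_simps)
      also have "(2 * B + 4 * D\<^sup>2) * (s * (1 + y)) \<le> (2 * B + 4 * D\<^sup>2) * (s * 2)"
        using \<open>0 \<le> B\<close> s y by (intro mult_left_mono) auto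
      also have "\<dots> = (C' * sqrt s)\<^sup>2"
      proof -
        have "C'\<^sup>2 = 2 * (2 * B + 4 * D\<^sup>2)" "(sqrt s)\<^sup>2 = s"
          unfolding C'_def using \<open>0 \<le> B\<close> s(1) by simp_all
        then show ?thesis unfolding power_mult_distrib by simp
      qed
      finally have "cmod (g m) \<le> C' * sqrt s"
        by (rule power2_le_imp_le) (use \<open>0 \<le> B\<close> s in \<open>simp add: C'_def\<close>)
      then show ?thesis by (simp add: s_def)
    qed
    moreover have "0 \<le> C'" using \<open>0 \<le> B\<close> by (simp add: C'_def)
    ultimately show ?case by blast
  qed
  then obtain C where C: "0 \<le> C" "\<And>m. x (block m) \<noteq> 0 \<Longrightarrow> position m \<le> N \<Longrightarrow> cmod (g m) \<le> C * sqrt (gap m)" by blast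
  have "cmod (g m) \<le> (C + sqrt B) * sqrt (gap m)" for m
  proof (cases "x (block m) = 0")
    case True
    have "(cmod (orbit (real 0) m))\<^sup>2 \<le> (\<Sum>k. (cmod (orbit (real k) m))\<^sup>2)"
      using sum_le_suminf[OF AB(1), of "{0}"] by simp
    then have "(cmod (g m))\<^sup>2 \<le> B" using AB(2)[of m] orbit_0 by simp
    then have "cmod (g m) \<le> sqrt B" by (rule real_le_rsqrt)
    then show ?thesis using True C(1) by (simp add: gap_def)
  next
    case False
    have "C * sqrt (gap m) \<le> (C + sqrt B) * sqrt (gap m)"
      using gap_pos[of m] \<open>0 \<le> B\<close> by (intro mult_right_mono) auto
    then show ?thesis using C(2)[OF False] position_less_N[of m] by simp
  qed
  then show ?thesis using that C(1) \<open>0 \<le> B\<close> by (metis add_nonneg_nonneg real_sqrt_ge_zero)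
qed

text \<open>Conjugated so that \<open>\<Sum>m. h m * E m t\<close> is the inner product of \<open>h\<close> and \<open>orbit t\<close>, up to
  the block with eigenvalue 0. That block is excluded by the value 0, since its powers do not depend analytically on the exponent.\<close>

definition E :: "nat \<Rightarrow> complex \<Rightarrow> complex" where
  "E m w = (if x (block m) = 0 then 0 else \<Sum>l\<le>position m. pow_coeff (x (block m)) l w * cnj (g (m - l)))"

lemma E_of_real:
  assumes "x (block m) \<noteq> 0"
  shows "E m (of_real t) = cnj (orbit t m)"
  using assms by (simp add: E_def orbit_regular cnj_sum cnj_pow_coeff_of_real)

lemma E_holomorphic: "E m holomorphic_on A"
proof (cases "x (block m) = 0")
  case False
  have "(\<lambda>w. \<Sum>l\<le>position m. pow_coeff (x (block m)) l w * cnj (g (m - l))) holomorphic_on A"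
    by (intro holomorphic_intros pow_coeff_holomorphic)
  then show ?thesis using False by (simp add: E_def[abs_def])
qed (simp add: E_def[abs_def])

text \<open>The common part of the two bounds below: a bound for the coefficients of the powers gives one for \<open>E\<close>.\<close>

lemma E_norm_le:
  assumes C: "\<And>m. cmod (g m) \<le> C * sqrt (gap m)"
    and P: "\<And>l. l \<le> position m \<Longrightarrow> x (block m) \<noteq> 0 \<Longrightarrow> cmod (pow_coeff (x (block m)) l w) \<le> P" and "0 \<le> P"
  shows "cmod (E m w) \<le> real N * C * P * sqrt (gap m)"
proof -
  have "0 \<le> C * sqrt (gap m)" using order_trans[OF norm_ge_zero C] .
  show ?thesis
  proof (cases "x (block m) = 0")
    case True
    have "0 \<le> real N * P * (C * sqrt (gap m))"
      by (rule mult_nonneg_nonneg[OF mult_nonneg_nonneg[OF of_nat_0_le_iff \<open>0 \<le> P\<close>] \<open>0 \<le> C * sqrt (gap m)\<close>])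
    then show ?thesis using True by (simp add: E_def mult_ac)
  next
    case False
    have "cmod (E m w) = cmod (\<Sum>l\<le>position m. pow_coeff (x (block m)) l w * cnj (g (m - l)))"
      using False by (simp add: E_def)
    also have "\<dots> \<le> (\<Sum>l\<le>position m. P * (C * sqrt (gap m)))"
    proof (rule sum_norm_le)
      fix l assume "l \<in> {..position m}"
      then have l: "l \<le> position m" by simp
      have "cmod (g (m - l)) \<le> C * sqrt (gap m)"
        using C[of "m - l"] block_position_diff(1)[OF l] by (simp add: gap_def)
      then show "cmod (pow_coeff (x (block m)) l w * cnj (g (m - l))) \<le> P * (C * sqrt (gap m))"
        unfolding norm_mult using P[OF l False] \<open>0 \<le> P\<close> by (intro mult_mono) auto
    qed
    also have "\<dots> = real (Suc (position m)) * (P * (C * sqrt (gap m)))" by simp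
    also have "\<dots> \<le> real N * (P * (C * sqrt (gap m)))"
      using position_less_N[of m] mult_nonneg_nonneg[OF \<open>0 \<le> P\<close> \<open>0 \<le> C * sqrt (gap m)\<close>]
      by (intro mult_right_mono) auto
    finally show ?thesis by (simp add: mult_ac)
  qed
qed

lemma E_bound_disc:
  obtains C where "0 \<le> C" "\<forall>m t w. 0 \<le> t \<longrightarrow> cmod (w - of_real t) \<le> 1 / gap m \<longrightarrow>
    cmod (E m w) \<le> C * sqrt (gap m) * exp (- (gap m * t / 2))"
proof -
  obtain C where C: "0 \<le> C" "\<And>m. cmod (g m) \<le> C * sqrt (gap m)" using g_bound by blast
  obtain c where c: "0 < c" "\<And>m. x (block m) \<noteq> 0 \<Longrightarrow> c \<le> x (block m)" using eigenvalue_lower_bound by blast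
  obtain K where K: "0 \<le> K" "\<forall>x l t w. c \<le> x \<longrightarrow> x < 1 \<longrightarrow> l < N \<longrightarrow> 0 \<le> t \<longrightarrow>
    cmod (w - of_real t) \<le> 1 / (1 - x) \<longrightarrow> cmod (pow_coeff x l w) \<le> K * exp (- ((1 - x) * t / 2))"
    using pow_coeff_bound_disc[OF c(1), of N] by blast
  have "cmod (E m w) \<le> (real N * C * K) * sqrt (gap m) * exp (- (gap m * t / 2))"
    if "0 \<le> t" "cmod (w - of_real t) \<le> 1 / gap m" for m t w
  proof -
    have "cmod (E m w) \<le> real N * C * (K * exp (- (gap m * t / 2))) * sqrt (gap m)"
    proof (rule E_norm_le[OF C(2)])
      fix l assume "l \<le> position m" "x (block m) \<noteq> 0"
      then have "l < N" using position_less_N[of m] by linarith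
      then show "cmod (pow_coeff (x (block m)) l w) \<le> K * exp (- (gap m * t / 2))"
        using K(2)[rule_format, OF c(2)[OF \<open>x (block m) \<noteq> 0\<close>] x_less_1 _ that(1)] that(2) by (simp add: gap_def)
    qed (use K in auto)
    then show ?thesis by (simp add: mult_ac)
  qed
  moreover have "0 \<le> real N * C * K" using C(1) K(1) by simp
  ultimately show ?thesis using that[of "real N * C * K"] by simp
qed

lemma E_bound_half_plane:
  obtains a where "summable a" "\<forall>m w. - 1 < Re w \<longrightarrow> cmod (E m w) \<le> a m * (1 + cmod w) ^ N"
proof -
  obtain C where C: "0 \<le> C" "\<And>m. cmod (g m) \<le> C * sqrt (gap m)" using g_bound by blast
  obtain c where c: "0 < c" "\<And>m. x (block m) \<noteq> 0 \<Longrightarrow> c \<le> x (block m)" using eigenvalue_lower_bound by blast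
  obtain K where K: "0 \<le> K" "\<forall>x l w. c \<le> x \<longrightarrow> x < 1 \<longrightarrow> l < N \<longrightarrow> - 1 \<le> Re w \<longrightarrow>
    cmod (pow_coeff x l w) \<le> K * (1 + cmod w) ^ N"
    using pow_coeff_bound_half_plane[OF c(1), of N] by blast
  define a where "a m = (real N * C * K) * sqrt (gap m)" for m
  have "cmod (E m w) \<le> a m * (1 + cmod w) ^ N" if "- 1 < Re w" for m w
  proof -
    have "cmod (E m w) \<le> real N * C * (K * (1 + cmod w) ^ N) * sqrt (gap m)"
    proof (rule E_norm_le[OF C(2)])
      fix l assume "l \<le> position m" "x (block m) \<noteq> 0"
      then have "l < N" using position_less_N[of m] by linarith
      then show "cmod (pow_coeff (x (block m)) l w) \<le> K * (1 + cmod w) ^ N"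
        using K(2)[rule_format, OF c(2)[OF \<open>x (block m) \<noteq> 0\<close>] x_less_1] that by simp
    qed (use K in auto)
    then show ?thesis by (simp add: a_def mult_ac)
  qed
  moreover have "summable a"
    unfolding a_def by (intro summable_mult lacunary_summable_sqrt gap_lacunary)
  ultimately show ?thesis using that by blast
qed

text \<open>On the block with eigenvalue 0 the vectors vanish for \<open>t > N\<close>, and \<open>gap m = 1\<close>; there the factor
  \<open>exp (N / 2)\<close> in the constant makes up for the exponential.\<close>

lemma orbit_bound:
  obtains C where "0 \<le> C" "\<And>t m. 0 \<le> t \<Longrightarrow> cmod (orbit t m) \<le> C * sqrt (gap m) * exp (- (gap m * t / 2))"
proof -
  obtain C1 where C1: "0 \<le> C1" "\<And>m. cmod (g m) \<le> C1 * sqrt (gap m)" using g_bound by blast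
  obtain C2 where C2: "0 \<le> C2" "\<forall>m t w. 0 \<le> t \<longrightarrow> cmod (w - of_real t) \<le> 1 / gap m \<longrightarrow>
    cmod (E m w) \<le> C2 * sqrt (gap m) * exp (- (gap m * t / 2))" using E_bound_disc by blast
  have e1: "1 \<le> exp (real N / 2)" by simp
  define C where "C = C2 + C1 * exp (real N / 2)"
  have "0 \<le> C" using C1 C2 by (simp add: C_def)
  have "cmod (orbit t m) \<le> C * sqrt (gap m) * exp (- (gap m * t / 2))" if t: "0 \<le> t" for t m
  proof (cases "x (block m) = 0")
    case True
    then have S1: "gap m = 1" by (simp add: gap_def)
    show ?thesis
    proof (cases "t \<in> \<nat> \<and> t \<le> real (position m)")
      case in_range: True
      then have "t \<le> real N" using position_less_N[of m] by linarith
      have "nat \<lfloor>t\<rfloor> \<le> position m" using in_range by linarith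
      have "cmod (orbit t m) \<le> C1"
        using C1(2)[of "m - nat \<lfloor>t\<rfloor>"] block_position_diff(1)[OF \<open>nat \<lfloor>t\<rfloor> \<le> position m\<close>] S1 in_range
        by (simp add: orbit_zero_block[OF True t] gap_def)
      also have "C1 = C1 * 1" by simp
      also have "\<dots> \<le> C1 * (exp (real N / 2) * exp (- (t / 2)))"
        using \<open>t \<le> real N\<close> C1(1) by (intro mult_left_mono) (auto simp: exp_add[symmetric])
      also have "\<dots> \<le> C * exp (- (t / 2))"
        unfolding mult.assoc[symmetric] using C2(1) by (intro mult_right_mono) (auto simp: C_def)
      finally show ?thesis using S1 by simp
    next
      case False
      then have "orbit t m = 0" unfolding orbit_zero_block[OF True t] by auto
      then show ?thesis using \<open>0 \<le> C\<close> gap_pos[of m] by simp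
    qed
  next
    case False
    have "cmod (orbit t m) = cmod (E m (of_real t))" using E_of_real[OF False] by simp
    also have "\<dots> \<le> C2 * sqrt (gap m) * exp (- (gap m * t / 2))"
      using C2(2) t gap_pos[of m] by simp
    also have "\<dots> \<le> C * sqrt (gap m) * exp (- (gap m * t / 2))"
      using C1(1) gap_pos[of m] by (intro mult_right_mono) (auto simp: C_def)
    finally show ?thesis .
  qed
  then show ?thesis using that \<open>0 \<le> C\<close> by blast
qed

lemma orbit_zero_block_large:
  assumes "x (block m) = 0" "real N \<le> t"
  shows "orbit t m = 0"
  using orbit_zero_block[OF assms(1), of t] position_less_N[of m] assms(2) by auto

section \<open>Positive finite density is sufficient\<close>

lemma frame_nat_lower_bound:
  obtains A where "0 < A"
    "\<forall>h\<in>l2. A * (l2_norm h)\<^sup>2 \<le> (\<Sum>k. (cmod (l2_inner h (orbit (real k))))\<^sup>2)"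
  using frame_nat unfolding l2_frame_def by blast

lemma frame_nat_injective:
  assumes "h \<in> l2" "\<And>k. l2_inner h (orbit (real k)) = 0"
  shows "h m = 0"
proof -
  obtain A where "0 < A"
    "\<forall>h\<in>l2. A * (l2_norm h)\<^sup>2 \<le> (\<Sum>k. (cmod (l2_inner h (orbit (real k))))\<^sup>2)"
    by (rule frame_nat_lower_bound)
  from this(2)[rule_format, OF assms(1)] this(1) have "(l2_norm h)\<^sup>2 \<le> 0" by (simp add: assms(2) mult_le_0_iff)
  moreover have "(cmod (h m))\<^sup>2 \<le> (l2_norm h)\<^sup>2" using l2_partial_le[OF assms(1), of "{m}"] by simp
  ultimately have "(cmod (h m))\<^sup>2 \<le> 0" by linarith
  then show ?thesis by simp
qed

text \<open>The inner product with \<open>orbit t\<close> splits into a regular part \<open>R t\<close> and the contribution \<open>Z t\<close> of the block with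
  eigenvalue 0, which vanishes for large \<open>t\<close>. So \<open>R\<close> vanishes at all but finitely many \<open>\<Lambda> k\<close>, hence on the half-line;
  then \<open>Z\<close> vanishes at all \<open>\<Lambda> k\<close>, and the first exponents cover all integers where it
  could be nonzero.\<close>

lemma real_samples_injective:
  assumes \<Lambda>: "inj \<Lambda>" "\<And>k. 0 \<le> \<Lambda> k" and dens: "asymptotic_density \<Lambda> d"
    and init: "\<forall>i j. x i = 0 \<longrightarrow> j < n i \<longrightarrow> \<Lambda> j = real j"
    and h: "h \<in> l2" and zero: "\<And>k. l2_inner h (orbit (\<Lambda> k)) = 0"
  shows "h m = 0"
proof -
  obtain C where C: "\<And>t m. 0 \<le> t \<Longrightarrow> cmod (orbit t m) \<le> C * sqrt (gap m) * exp (- (gap m * t / 2))"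
    using orbit_bound by metis
  have "0 \<le> C * sqrt (gap 0)" using order_trans[OF norm_ge_zero C[of 0 0]] by simp
  then have "0 \<le> C" using gap_pos[of 0] by (simp add: zero_le_mult_iff)
  have orbit_l2: "orbit t \<in> l2" if "0 \<le> t" for t
  proof (rule lacunary_bounded_in_l2(1)[OF gap_lacunary])
    fix m
    have "C * sqrt (gap m) * exp (- (gap m * t / 2)) \<le> C * sqrt (gap m) * 1"
      using \<open>0 \<le> C\<close> gap_pos[of m] that by (intro mult_left_mono) auto
    then show "cmod (orbit t m) \<le> C * sqrt (gap m)" using C[OF that, of m] by simp
  qed
  obtain M0 where M0: "\<And>m. M0 \<le> m \<Longrightarrow> x (block m) \<noteq> 0" using regular_tail by blast
  define R where "R w = (\<Sum>m. h m * E m w)" for w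
  define Z where "Z t = (\<Sum>m<M0. if x (block m) = 0 then h m * cnj (orbit t m) else 0)" for t
  have split: "l2_inner h (orbit t) = R (of_real t) + Z t" if t: "0 \<le> t" for t
  proof -
    have eq: "h m * cnj (orbit t m) = h m * E m (of_real t) + (if x (block m) = 0 then h m * cnj (orbit t m) else 0)" for m
    proof (cases "x (block m) = 0")
      case True
      then show ?thesis by (simp add: E_def)
    next
      case False
      then show ?thesis by (simp add: E_of_real)
    qed
    have fin: "(\<lambda>m. if x (block m) = 0 then h m * cnj (orbit t m) else 0) sums Z t"
      unfolding Z_def using M0 by (intro sums_finite) (auto simp: not_less)
    have "summable (\<lambda>m. h m * cnj (orbit t m))"
      using l2_inner_summable[OF h orbit_l2[OF t]] by (rule summable_norm_cancel)
    then have "summable (\<lambda>m. h m * cnj (orbit t m) - (if x (block m) = 0 then h m * cnj (orbit t m) else 0))"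
      using fin by (intro summable_diff) (auto simp: sums_iff)
    then have "summable (\<lambda>m. h m * E m (of_real t))" by (subst (asm) eq) simp
    then have "(\<lambda>m. h m * E m (of_real t) + (if x (block m) = 0 then h m * cnj (orbit t m) else 0)) sums (R (of_real t) + Z t)"
      unfolding R_def by (intro sums_add fin summable_sums)
    then show ?thesis unfolding l2_inner_def by (subst eq) (simp add: sums_iff)
  qed
  have Z_large: "Z t = 0" if "real N \<le> t" for t
    unfolding Z_def using orbit_zero_block_large[OF _ that] by (intro sum.neutral) auto
  obtain D1 where D1: "\<And>k. \<bar>\<Lambda> k - real k * (1 / d)\<bar> \<le> 1 * real k + D1"
    using dens unfolding asymptotic_density_def by (metis zero_less_one)
  have "0 < d" using dens by (simp add: asymptotic_density_def)
  have "0 \<le> D1" using D1[of 0] by simp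
  obtain c D2 where c: "0 < c" "0 \<le> D2" "\<And>k. c * real k - D2 \<le> \<Lambda> k"
    using asymptotic_density_lower[OF dens] by metis
  \<comment> \<open>From index \<open>k0\<close> on, the exponents are at least \<open>N\<close>, where \<open>Z\<close> vanishes.\<close>
  define k0 where "k0 = nat \<lceil>(real N + D2) / c\<rceil>"
  have large: "real N \<le> \<Lambda> (k + k0)" for k
  proof -
    have "(real N + D2) / c \<le> real (k + k0)" by (simp add: k0_def) linarith
    then have "real N + D2 \<le> c * real (k + k0)" using c(1) by (simp add: field_simps)
    then show ?thesis using c(3)[of "k + k0"] by linarith
  qed
  obtain a where a: "summable a" "\<forall>m w. - 1 < Re w \<longrightarrow> cmod (E m w) \<le> a m * (1 + cmod w) ^ N"
    using E_bound_half_plane by blast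
  have h_le: "cmod (h m) \<le> l2_norm h" for m
  proof -
    have "(cmod (h m))\<^sup>2 \<le> (l2_norm h)\<^sup>2" using l2_partial_le[OF h, of "{m}"] by simp
    then show ?thesis by (rule power2_le_imp_le) (simp add: l2_norm_def suminf_nonneg h[unfolded l2_def, simplified])
  qed
  have R0: "R (of_real t) = 0" if "0 \<le> t" for t
    unfolding R_def
  proof (rule series_zeros_positive_density[where \<mu> = "\<lambda>k. \<Lambda> (k + k0)" and N = N
        and a = "\<lambda>m. l2_norm h * a m" and C = "(1 / d + 1) * (real k0 + 1) + D1"])
    show "(\<lambda>w. h m * E m w) holomorphic_on {w. - 1 < Re w}" for m
      by (intro holomorphic_intros E_holomorphic)
    show "cmod (h m * E m w) \<le> l2_norm h * a m * (1 + cmod w) ^ N" if "- 1 < Re w" for m w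
      unfolding norm_mult mult.assoc using a(2) that h_le[of m] order_trans[OF norm_ge_zero h_le]
      by (intro mult_mono) auto
    show "summable (\<lambda>m. l2_norm h * a m)" using a(1) by (rule summable_mult)
    show "inj (\<lambda>k. \<Lambda> (k + k0))" by (rule injI) (use \<Lambda>(1) in \<open>auto dest: injD\<close>)
    show "0 \<le> \<Lambda> (k + k0)" for k by (rule \<Lambda>(2))
    show "\<Lambda> (k + k0) \<le> ((1 / d + 1) * (real k0 + 1) + D1) * (real k + 1)" for k
    proof -
      have "\<Lambda> (k + k0) \<le> (1 / d + 1) * real (k + k0) + D1"
        using D1[of "k + k0"] by (simp add: algebra_simps abs_le_iff)
      also have "\<dots> \<le> (1 / d + 1) * ((real k0 + 1) * (real k + 1)) + D1 * (real k + 1)"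
        using \<open>0 < d\<close> \<open>0 \<le> D1\<close> by (intro add_mono mult_left_mono) (auto simp: algebra_simps)
      also have "\<dots> = ((1 / d + 1) * (real k0 + 1) + D1) * (real k + 1)"
        by (simp only: distrib_right[of _ D1] mult.assoc)
      finally show ?thesis .
    qed
    show "(\<Sum>m. h m * E m (of_real (\<Lambda> (k + k0)))) = 0" for k
      using split[OF \<Lambda>(2), of "k + k0"] zero[of "k + k0"] Z_large[OF large] by (simp add: R_def)
    show "- 1 < t" using that by simp
  qed
  have Z0: "Z (real r) = 0" for r
  proof -
    have "(if x (block m) = 0 then h m * cnj (orbit (real r) m) else 0) = 0"
      if noblock: "\<not> (\<exists>i. x i = 0 \<and> r < n i)" for m
      using orbit_zero_block[of m "real r"] position_less[of m] noblock
      by auto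
    moreover have "Z (real r) = 0" if "x i = 0" "r < n i" for i
      using split[OF \<Lambda>(2), of r] zero[of r] R0[OF \<Lambda>(2), of r] init[rule_format, OF that] by simp
    ultimately show ?thesis by (cases "\<exists>i. x i = 0 \<and> r < n i") (auto simp: Z_def)
  qed
  have "l2_inner h (orbit (real k)) = 0" for k using split[of "real k"] R0[of "real k"] Z0[of k] by simp
  then show ?thesis using frame_nat_injective[OF h] by blast
qed

text \<open>Only vectors supported on late coordinates are compared with the orbit at the natural numbers; there \<open>E\<close>
  describes all coordinates, because the block with eigenvalue 0 is finite.\<close>

lemma real_samples_frame:
  assumes \<Lambda>: "inj \<Lambda>" "\<And>k. 0 \<le> \<Lambda> k" and dens: "asymptotic_density \<Lambda> d"
    and init: "\<forall>i j. x i = 0 \<longrightarrow> j < n i \<longrightarrow> \<Lambda> j = real j"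
  shows "l2_frame (\<lambda>k. orbit (\<Lambda> k))"
proof -
  have "0 < d" using dens by (simp add: asymptotic_density_def)
  obtain C where C: "0 \<le> C" "\<And>t m. 0 \<le> t \<Longrightarrow> cmod (orbit t m) \<le> C * sqrt (gap m) * exp (- (gap m * t / 2))"
    using orbit_bound by metis
  obtain B where B: "Bessel (\<lambda>k. orbit (\<Lambda> k)) B"
    using exp_family_Bessel[OF gap_lacunary dens C(2)[OF \<Lambda>(2)]] by blast
  have l1: "summable (\<lambda>m. cmod (orbit (\<Lambda> k) m))" for k
  proof (rule lacunary_bounded_in_l2(2)[OF gap_lacunary])
    fix m
    have "C * sqrt (gap m) * exp (- (gap m * \<Lambda> k / 2)) \<le> C * sqrt (gap m) * 1"
      using C(1) gap_pos[of m] \<Lambda>(2)[of k] by (intro mult_left_mono) auto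
    then show "cmod (orbit (\<Lambda> k) m) \<le> C * sqrt (gap m)" using C(2)[OF \<Lambda>(2), of k m] by simp
  qed
  obtain A where A: "0 < A"
    "\<forall>h\<in>l2. A * (l2_norm h)\<^sup>2 \<le> (\<Sum>k. (cmod (l2_inner h (orbit (real k))))\<^sup>2)"
    by (rule frame_nat_lower_bound)
  obtain C2 where "0 \<le> C2" and C2: "\<forall>m t w. 0 \<le> t \<longrightarrow> cmod (w - of_real t) \<le> 1 / gap m \<longrightarrow>
    cmod (E m w) \<le> C2 * sqrt (gap m) * exp (- (gap m * t / 2))" using E_bound_disc by blast
  interpret sys: exponential_system gap E C2
  proof
    show "lacunary gap" by (rule gap_lacunary)
    show "E m holomorphic_on UNIV" for m by (rule E_holomorphic)
    show "cmod (E m w) \<le> C2 * sqrt (gap m) * exp (- (gap m * t / 2))"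
      if "0 \<le> t" "cmod (w - of_real t) \<le> 1 / gap m" for m t w
      using C2 that by simp
  qed
  \<comment> \<open>Half of the bound inherited from the natural numbers is given up for the error of the comparison.\<close>
  define A' where "A' = d * A / 2"
  have "0 < A'" using A(1) \<open>0 < d\<close> by (simp add: A'_def)
  obtain M where M: "\<And>N (h :: nat \<Rightarrow> complex). (\<forall>m<M. h m = 0) \<Longrightarrow>
    d * (\<Sum>k. (cmod (\<Sum>m<N. h m * E m (of_real (real k))))\<^sup>2) - A' * (\<Sum>m<N. (cmod (h m))\<^sup>2)
      \<le> (\<Sum>k. (cmod (\<Sum>m<N. h m * E m (of_real (\<Lambda> k))))\<^sup>2)"
    using sys.tail_energy_comparison[OF dens \<open>0 < A'\<close>] by blast
  obtain M0 where M0: "\<And>m. M0 \<le> m \<Longrightarrow> x (block m) \<noteq> 0" using regular_tail by blast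
  have E_f: "(\<Sum>m<K. h m * E m (of_real t)) = (\<Sum>m<K. h m * cnj (orbit t m))"
    if "\<forall>m<max M M0. h m = 0" for K t and h :: "nat \<Rightarrow> complex"
  proof (intro sum.cong refl)
    fix m
    show "h m * E m (of_real t) = h m * cnj (orbit t m)"
      using that E_of_real[OF M0, of m t] by (cases "m < max M M0") auto
  qed
  have fin: "A' * (\<Sum>m<K. (cmod (h m))\<^sup>2) \<le> (\<Sum>k. (cmod (\<Sum>m<K. h m * cnj (orbit (\<Lambda> k) m)))\<^sup>2)"
    if h: "\<forall>m<max M M0. h m = 0" for K and h :: "nat \<Rightarrow> complex"
  proof -
    define h' where "h' m = (if m < K then h m else 0)" for m
    have h'0: "h' m = 0" if "K \<le> m" for m using that by (simp add: h'_def)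
    have "(l2_norm h')\<^sup>2 = (\<Sum>m<K. (cmod (h' m))\<^sup>2)" by (rule l2_finite_support(2)) (rule h'0)
    then have nrm: "(l2_norm h')\<^sup>2 = (\<Sum>m<K. (cmod (h m))\<^sup>2)" by (simp add: h'_def)
    have "l2_inner h' y = (\<Sum>m<K. h' m * cnj (y m))" for y by (rule l2_finite_support(3)) (rule h'0)
    then have inner: "l2_inner h' y = (\<Sum>m<K. h m * cnj (y m))" for y by (simp add: h'_def)
    have "h' \<in> l2" by (rule l2_finite_support(1)) (rule h'0)
    from A(2)[rule_format, OF this] have "A * (\<Sum>m<K. (cmod (h m))\<^sup>2) \<le> (\<Sum>k. (cmod (\<Sum>m<K. h m * cnj (orbit (real k) m)))\<^sup>2)"
      unfolding nrm inner .
    then have "d * (A * (\<Sum>m<K. (cmod (h m))\<^sup>2)) \<le> d * (\<Sum>k. (cmod (\<Sum>m<K. h m * cnj (orbit (real k) m)))\<^sup>2)"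
      using \<open>0 < d\<close> by (intro mult_left_mono) auto
    moreover have "d * (\<Sum>k. (cmod (\<Sum>m<K. h m * cnj (orbit (real k) m)))\<^sup>2) - A' * (\<Sum>m<K. (cmod (h m))\<^sup>2)
      \<le> (\<Sum>k. (cmod (\<Sum>m<K. h m * cnj (orbit (\<Lambda> k) m)))\<^sup>2)"
      using M[of h K] h unfolding E_f[OF h] by simp
    moreover have "d * (A * (\<Sum>m<K. (cmod (h m))\<^sup>2)) = 2 * (A' * (\<Sum>m<K. (cmod (h m))\<^sup>2))"
      by (simp add: A'_def)
    ultimately show ?thesis by linarith
  qed
  show ?thesis
  proof (rule frame_from_tail_bound[OF B l1])
    show "0 < A' / 2" using \<open>0 < A'\<close> by simp
    show "A' / 2 * (l2_norm h)\<^sup>2 \<le> energy (\<lambda>k. orbit (\<Lambda> k)) h"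
      if "h \<in> l2" "\<forall>m<max M M0. h m = 0" for h
      using fin that by (intro lower_bound_from_finite[OF B]) auto
    show "\<forall>m. h m = 0" if "h \<in> l2" "\<forall>k. l2_inner h (orbit (\<Lambda> k)) = 0" for h
      by (intro allI real_samples_injective[OF \<Lambda> dens init that(1)]) (use that(2) in blast)
  qed
qed

section \<open>Necessity of the conditions on the exponents\<close>

lemma block_start_coordinate:
  "block (block_start n i) = i" "position (block_start n i) = 0"
  using block_start_plus[of 0 i] position_start_plus[of 0 i] n_pos[of i] by auto

lemma norm_orbit_block_start:
  assumes "x i \<noteq> 0"
  shows "(cmod (orbit t (block_start n i)))\<^sup>2 = x i powr (2 * t) * (cmod (g (block_start n i)))\<^sup>2"
proof -
  have "0 < x i" using assms x_nonneg[of i] by simp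
  have "orbit t (block_start n i) = pow_coeff (x i) 0 (of_real t) * g (block_start n i)"
    using orbit_regular[of "block_start n i" t] assms by (simp add: block_start_coordinate)
  moreover have "(cmod (pow_coeff (x i) 0 (of_real t)))\<^sup>2 = x i powr (2 * t)"
    using \<open>0 < x i\<close> by (simp add: pow_coeff_0 powr_def exp_double[symmetric] mult_ac)
  ultimately show ?thesis by (simp add: norm_mult power_mult_distrib)
qed

text \<open>In the first coordinate of a block with nonzero eigenvalue the orbit is a pure exponential. Comparing the two frames on this coordinate
  eliminates the unknown value of \<open>g\<close>.\<close>

lemma frame_imp_density:
  assumes mono: "strict_mono \<Lambda>" and nonneg: "\<And>k. 0 \<le> \<Lambda> k"
    and lim: "((\<lambda>t. counting_function \<Lambda> t / ennreal t) \<longlongrightarrow> L) at_top"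
    and fr: "l2_frame (\<lambda>k. orbit (\<Lambda> k))"
  shows "0 < L" "L < \<infinity>"
proof -
  obtain A B where AB: "0 < A" "\<And>m. summable (\<lambda>k. (cmod (orbit (real k) m))\<^sup>2)"
    "\<And>m. A \<le> (\<Sum>k. (cmod (orbit (real k) m))\<^sup>2)" "\<And>m. (\<Sum>k. (cmod (orbit (real k) m))\<^sup>2) \<le> B"
    using l2_frame_coordinates[OF frame_nat] by blast
  obtain A' B' where AB': "0 < A'" "\<And>m. summable (\<lambda>k. (cmod (orbit (\<Lambda> k) m))\<^sup>2)"
    "\<And>m. A' \<le> (\<Sum>k. (cmod (orbit (\<Lambda> k) m))\<^sup>2)" "\<And>m. (\<Sum>k. (cmod (orbit (\<Lambda> k) m))\<^sup>2) \<le> B'"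
    using l2_frame_coordinates[OF fr] by blast
  have "0 < B" using AB(1) AB(3)[of 0] AB(4)[of 0] by linarith
  have "0 < B'" using AB'(1) AB'(3)[of 0] AB'(4)[of 0] by linarith
  have Abel: "\<exists>y. 0 < y \<and> y < 1 \<and> 1 - y < \<eta> \<and> summable (\<lambda>k. y powr (2 * \<Lambda> k)) \<and>
      A' / (2 * B) \<le> (1 - y) * (\<Sum>k. y powr (2 * \<Lambda> k)) \<and>
      (1 - y) * (\<Sum>k. y powr (2 * \<Lambda> k)) \<le> B' / A" if "0 < \<eta>" for \<eta>
  proof -
    have "finite {m. min \<eta> 1 \<le> gap m}" using that by (intro finite_far_coordinates) auto
    from ex_new_if_finite[OF infinite_UNIV_nat this]
    obtain m0 where "m0 \<notin> {m. min \<eta> 1 \<le> gap m}" by (rule exE)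
    then have m0: "gap m0 < \<eta>" "gap m0 < 1" by auto
    define i where "i = block m0"
    define y where "y = x i"
    have y: "0 < y" "y < 1" "1 - y < \<eta>" "y = x i"
      using m0 x_less_1[of i] by (auto simp: y_def i_def gap_def)
    define G where "G = (cmod (g (block_start n i)))\<^sup>2"
    have sq: "(cmod (orbit t (block_start n i)))\<^sup>2 = y powr (2 * t) * G" for t
      using norm_orbit_block_start[of i t] y by (simp add: G_def)
    have y2: "0 \<le> y\<^sup>2" "y\<^sup>2 < 1" using y by (auto simp: abs_square_less_1)
    have pw: "y powr (2 * real k) = (y\<^sup>2) ^ k" for k
    proof -
      have "y powr (2 * real k) = y powr real (2 * k)" by simp
      also have "\<dots> = y ^ (2 * k)" by (rule powr_realpow[OF y(1)])
      finally show ?thesis by (simp only: power_mult)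
    qed
    have "(\<Sum>k. (cmod (orbit (real k) (block_start n i)))\<^sup>2) = (\<Sum>k. (y\<^sup>2) ^ k * G)"
      unfolding sq pw ..
    also have "\<dots> = 1 / (1 - y\<^sup>2) * G"
      using y2 by (simp add: suminf_mult2[symmetric] summable_geometric suminf_geometric)
    finally have sumN: "(\<Sum>k. (cmod (orbit (real k) (block_start n i)))\<^sup>2) = G / (1 - y\<^sup>2)" by simp
    have G: "A * (1 - y\<^sup>2) \<le> G" "G \<le> B * (1 - y\<^sup>2)"
      using AB(3,4)[of "block_start n i"] y2 unfolding sumN by (simp_all add: field_simps)
    have "0 < A * (1 - y\<^sup>2)" using AB(1) y2 by simp
    then have "0 < G" using G(1) by linarith
    have s1: "summable (\<lambda>k. y powr (2 * \<Lambda> k) * G)" using AB'(2)[of "block_start n i"] unfolding sq .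
    then have s2: "summable (\<lambda>k. y powr (2 * \<Lambda> k))" using summable_mult2[OF s1, of "1 / G"] \<open>0 < G\<close> by simp
    define T where "T = (\<Sum>k. y powr (2 * \<Lambda> k))"
    have "(\<Sum>k. (cmod (orbit (\<Lambda> k) (block_start n i)))\<^sup>2) = T * G"
      unfolding sq T_def using s2 by (simp add: suminf_mult2)
    then have TG: "A' \<le> T * G" "T * G \<le> B'" using AB'(3,4)[of "block_start n i"] by auto
    have "0 < T * G" using TG(1) AB'(1) by linarith
    then have "0 < T" using \<open>0 < G\<close> by (simp add: zero_less_mult_iff)
    have fac: "1 - y\<^sup>2 = (1 - y) * (1 + y)" by (simp add: power2_eq_square algebra_simps)
    have lo: "1 - y \<le> 1 - y\<^sup>2" unfolding fac using y by (simp add: mult_le_cancel_left1)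
    have "(1 - y) * (1 + y) \<le> (1 - y) * 2" using y(2) by (intro mult_left_mono) auto
    then have hi: "1 - y\<^sup>2 \<le> 2 * (1 - y)" unfolding fac by (simp only: mult.commute)
    have "A * ((1 - y) * T) \<le> A * ((1 - y\<^sup>2) * T)"
      using lo AB(1) \<open>0 < T\<close> by (intro mult_left_mono mult_right_mono) auto
    also have "\<dots> \<le> G * T" using G(1) \<open>0 < T\<close> by (simp add: mult.assoc[symmetric] mult_right_mono)
    also have "\<dots> \<le> B'" using TG by (simp add: mult.commute)
    finally have up: "(1 - y) * T \<le> B' / A" using AB(1) by (simp add: field_simps)
    have "A' \<le> G * T" using TG by (simp add: mult.commute)
    also have "\<dots> \<le> B * (1 - y\<^sup>2) * T" using G(2) \<open>0 < T\<close> by (intro mult_right_mono) auto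
    also have "\<dots> \<le> B * (2 * (1 - y)) * T"
      using hi \<open>0 < B\<close> \<open>0 < T\<close> by (intro mult_right_mono mult_left_mono) auto
    finally have "A' / (2 * B) \<le> (1 - y) * T" using \<open>0 < B\<close> by (simp add: field_simps)
    then show ?thesis using y s2 up unfolding T_def by blast
  qed
  have "0 < A' / (2 * B)" using \<open>0 < B\<close> AB'(1) by simp
  from Abel_means_imp_density[OF mono nonneg lim this Abel] show "0 < L" "L < \<infinity>" by auto
qed

text \<open>On the block with eigenvalue 0, identify \<open>(v 0, v 1, \<dots>)\<close> with a power series; the operator is multiplication by
  the variable. If \<open>u\<close> is the reciprocal of the series \<open>V\<close> with the conjugate coefficients of \<open>g\<close>, then taking the
  coefficient of index \<open>r\<close> in the product with \<open>u\<close> is a linear functional that is 1 on the \<open>r\<close>-th power and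
  0 on all others. It exists because the constant term of \<open>V\<close> is nonzero, which the given frame forces.\<close>

lemma frame_imp_initial_segment_subset:
  assumes nonneg: "\<And>k. 0 \<le> \<Lambda> k" and fr: "l2_frame (\<lambda>k. orbit (\<Lambda> k))"
    and "x i = 0" "r < n i"
  shows "\<exists>k. \<Lambda> k = real r"
proof (rule ccontr)
  assume contra: "\<nexists>k. \<Lambda> k = real r"
  define st where "st = block_start n i"
  have block: "block (st + a) = i" "position (st + a) = a" if "a < n i" for a
    using that by (simp_all add: st_def block_start_plus position_start_plus)
  have f_eq: "orbit t (st + a) = (if t \<in> \<nat> \<and> t \<le> real a then g (st + a - nat \<lfloor>t\<rfloor>) else 0)"
    if "a < n i" "0 \<le> t" for a t
    using orbit_zero_block[of "st + a" t] block[OF that(1)] that(2) \<open>x i = 0\<close> by simp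
  have "g st \<noteq> 0"
  proof
    assume "g st = 0"
    obtain A where "0 < A" "A \<le> (\<Sum>k. (cmod (orbit (real k) st))\<^sup>2)"
      using l2_frame_coordinates[OF frame_nat] by metis
    moreover have "orbit (real k) st = 0" for k
      using f_eq[of 0 "real k"] n_pos[of i] \<open>g st = 0\<close> by simp
    ultimately show False by simp
  qed
  define V where "V = Abs_fps (\<lambda>a. cnj (g (st + a)))"
  define u where "u = inverse V"
  have "fps_nth V 0 \<noteq> 0" using \<open>g st \<noteq> 0\<close> by (simp add: V_def)
  then have Vu: "V * u = 1" by (simp add: u_def inverse_mult_eq_1')
  \<comment> \<open>The functional that takes the coefficient of index \<open>r\<close> in the product with \<open>u\<close>, as a vector of the block.\<close>
  define h where "h m = (if st \<le> m \<and> m \<le> st + r then fps_nth u (st + r - m) else 0)" for m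
  have h0: "h m = 0" if "Suc (st + r) \<le> m" for m using that by (simp add: h_def)
  have h_l2: "h \<in> l2" by (rule l2_finite_support(1)) (rule h0)
  have inner: "l2_inner h y = (\<Sum>a\<le>r. fps_nth u (r - a) * cnj (y (st + a)))" for y
  proof -
    have "l2_inner h y = (\<Sum>m<Suc (st + r). h m * cnj (y m))"
      by (rule l2_finite_support(3)) (rule h0)
    also have "\<dots> = (\<Sum>m\<in>{st..st + r}. fps_nth u (st + r - m) * cnj (y m))"
      by (intro sum.mono_neutral_cong_right) (auto simp: h_def)
    also have "\<dots> = (\<Sum>a\<le>r. fps_nth u (r - a) * cnj (y (st + a)))"
      by (rule sum.reindex_bij_witness[of _ "\<lambda>a. st + a" "\<lambda>m. m - st"]) (auto simp: add.commute)
    finally show ?thesis .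
  qed
  have "l2_inner h (orbit (\<Lambda> k)) = 0" for k
  proof (cases "\<Lambda> k \<in> \<nat> \<and> \<Lambda> k \<le> real r")
    case True
    then obtain q where q: "\<Lambda> k = real q" by (auto elim: Nats_cases)
    have "q \<noteq> r" using contra q by blast
    then have "q < r" using True q by simp
    have "l2_inner h (orbit (\<Lambda> k)) = (\<Sum>a\<le>r. if q \<le> a then fps_nth u (r - a) * cnj (g (st + a - q)) else 0)"
      unfolding inner using f_eq[of _ "real q"] \<open>r < n i\<close> by (intro sum.cong refl) (simp add: q)
    also have "\<dots> = (\<Sum>a\<in>{q..r}. fps_nth u (r - a) * cnj (g (st + a - q)))"
      by (intro sum.mono_neutral_cong_right) auto
    also have "\<dots> = (\<Sum>b = 0..r - q. fps_nth V b * fps_nth u (r - q - b))"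
      using \<open>q < r\<close>
      by (intro sum.reindex_bij_witness[of _ "\<lambda>b. b + q" "\<lambda>a. a - q"]) (auto simp: V_def)
    also have "\<dots> = fps_nth (V * u) (r - q)" by (simp add: fps_mult_nth)
    also have "\<dots> = 0" using \<open>q < r\<close> by (simp add: Vu)
    finally show ?thesis .
  next
    case False
    then have "orbit (\<Lambda> k) (st + a) = 0" if "a \<le> r" for a
      using f_eq[of a "\<Lambda> k"] nonneg[of k] that \<open>r < n i\<close> by auto
    then show ?thesis unfolding inner by (intro sum.neutral) auto
  qed
  moreover obtain A where A: "0 < A"
    "A * (l2_norm h)\<^sup>2 \<le> (\<Sum>k. (cmod (l2_inner h (orbit (\<Lambda> k))))\<^sup>2)"
    using fr h_l2 unfolding l2_frame_def by blast
  ultimately have "A * (l2_norm h)\<^sup>2 \<le> 0" by simp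
  then have "(l2_norm h)\<^sup>2 \<le> 0" using A(1) by (simp add: mult_le_0_iff)
  moreover have "(cmod (h (st + r)))\<^sup>2 \<le> (l2_norm h)\<^sup>2"
    using l2_partial_le[OF h_l2, of "{st + r}"] by simp
  ultimately have "(cmod (h (st + r)))\<^sup>2 \<le> 0" by linarith
  then have "h (st + r) = 0" by simp
  then have "fps_nth u 0 = 0" by (simp add: h_def)
  then show False using \<open>fps_nth V 0 \<noteq> 0\<close> by (simp add: u_def)
qed

text \<open>All integers below \<open>n i\<close> occur as exponents, and only integers are admitted there, since other powers are undefined.\<close>

lemma frame_imp_initial_segment:
  assumes mono: "strict_mono \<Lambda>" and nonneg: "\<And>k. 0 \<le> \<Lambda> k" and fr: "l2_frame (\<lambda>k. orbit (\<Lambda> k))"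
    and defined: "\<And>k. Jblock_power_defined (n i) (z i) (\<Lambda> k)" and "x i = 0" and "j < n i"
  shows "\<Lambda> j = real j"
  using \<open>j < n i\<close>
proof (induction j rule: less_induct)
  case (less j)
  obtain p where p: "\<Lambda> p = real j"
    using frame_imp_initial_segment_subset[OF nonneg fr \<open>x i = 0\<close> less.prems] by blast
  have "j \<le> p"
  proof (rule ccontr)
    assume "\<not> j \<le> p"
    then have "\<Lambda> p = real p" using less.IH[of p] less.prems by simp
    then show False using p \<open>\<not> j \<le> p\<close> by simp
  qed
  then have "\<Lambda> j \<le> real j" using strict_mono_leD[OF mono \<open>j \<le> p\<close>] p by simp
  moreover have "real j \<le> real (n i) - 1" using less.prems by linarith
  ultimately have "\<Lambda> j \<in> \<nat>"
    using defined[of j] \<open>x i = 0\<close> by (auto simp: Jblock_power_defined_def)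
  then obtain q where q: "\<Lambda> j = real q" by (auto elim: Nats_cases)
  show ?case
  proof (cases "q < j")
    case True
    then have "\<Lambda> q = \<Lambda> j" using less.IH[of q] less.prems q by simp
    then show ?thesis using True strict_monoD[OF mono True] by simp
  next
    case False
    then show ?thesis using q \<open>\<Lambda> j \<le> real j\<close> by simp
  qed
qed

end

section \<open>Frames of real powers\<close>

theorem theorem4p1:
  fixes n :: "nat \<Rightarrow> nat" and z g :: "nat \<Rightarrow> complex"
    and \<Lambda> :: "nat \<Rightarrow> real" and L :: ennreal
  assumes "block_diagonal_Carleson_frame n z g"
    and "point_spectrum (Jop n z) = range z"
    and "range z \<subseteq> of_real ` {0..<1}"
    and "Carleson_sequence z"
    and "strict_mono \<Lambda>"
    and "\<forall>k. 0 \<le> \<Lambda> k"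
    and "((\<lambda>x. counting_function \<Lambda> x / ennreal x) \<longlongrightarrow> L) at_top"
  shows "(l2_invertible (Jop n z) \<longrightarrow>
            (real_powers_frame n z g \<Lambda> \<longleftrightarrow> 0 < L \<and> L < \<infinity>)) \<and>
         (0 \<in> point_spectrum (Jop n z) \<longrightarrow>
            (real_powers_frame n z g \<Lambda> \<longleftrightarrow>
               0 < L \<and> L < \<infinity> \<and>
               (\<forall>j<algebraic_multiplicity (Jop n z) 0. \<Lambda> j = real j)))"
proof -
  have "\<exists>y. 0 \<le> y \<and> y < 1 \<and> z i = of_real y" for i
  proof -
    have "z i \<in> of_real ` {0..<1}" using assms(3) by blast
    then show ?thesis by auto
  qed
  then obtain x where x: "\<And>i. 0 \<le> x i" "\<And>i. x i < 1" "\<And>i. z i = of_real (x i)" by metis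
  have z: "z = (\<lambda>i. complex_of_real (x i))" using x(3) by (rule ext)
  have n_pos: "\<And>i. 0 < n i" and fr: "l2_frame (\<lambda>k. (Jop n z ^^ k) g)"
    using assms(1) by (auto simp: block_diagonal_Carleson_frame_def)
  obtain N where N: "\<And>i. n i \<le> N"
    using assms(1) unfolding block_diagonal_Carleson_frame_def bdd_above_def by blast
  interpret Carleson_block_frame n x g N
  proof
    show "0 < n i" "n i \<le> N" "0 \<le> x i" "x i < 1" for i using n_pos N x by auto
    show "Carleson_sequence (\<lambda>i. complex_of_real (x i))" using assms(4) z by simp
    show "l2_frame (\<lambda>k. (Jop n (\<lambda>i. complex_of_real (x i)) ^^ k) g)" using fr z by simp
  qed
  have nonneg: "0 \<le> \<Lambda> k" for k using assms(6) by simp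
  have inj: "inj \<Lambda>" using assms(5) by (rule strict_mono_imp_inj_on)
  have rpf: "real_powers_frame n z g \<Lambda> \<longleftrightarrow>
      (\<forall>k i. Jblock_power_defined (n i) (z i) (\<Lambda> k)) \<and> l2_frame (\<lambda>k. orbit (\<Lambda> k))"
    unfolding real_powers_frame_def orbit_def z ..
  have density: "0 < L \<and> L < \<infinity>" if "real_powers_frame n z g \<Lambda>"
    using frame_imp_density[OF assms(5) nonneg assms(7)] that rpf by blast
  have sufficient: "l2_frame (\<lambda>k. orbit (\<Lambda> k))"
    if L: "0 < L" "L < \<infinity>" and init: "\<forall>i j. x i = 0 \<longrightarrow> j < n i \<longrightarrow> \<Lambda> j = real j"
  proof -
    obtain d where d: "L = ennreal d" "0 \<le> d" using L(2) by (cases L) auto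
    then have "0 < d" using L(1) by simp
    have lim: "((\<lambda>x. counting_function \<Lambda> x / ennreal x) \<longlongrightarrow> ennreal d) at_top"
      using assms(7) d(1) by simp
    have "asymptotic_density \<Lambda> d"
      by (rule counting_limit_asymptotic_density[OF assms(5) nonneg lim \<open>0 < d\<close>])
    then show ?thesis by (rule real_samples_frame[OF inj nonneg _ init])
  qed
  show ?thesis
  proof (intro conjI impI)
    assume "l2_invertible (Jop n z)"
    then have nz: "z i \<noteq> 0" for i using l2_invertible_imp_nonzero n_pos by blast
    then have "x i \<noteq> 0" for i using x(3)[of i] by auto
    moreover have "Jblock_power_defined (n i) (z i) (\<Lambda> k)" for i k
      using nz by (simp add: Jblock_power_defined_def)
    ultimately show "real_powers_frame n z g \<Lambda> \<longleftrightarrow> 0 < L \<and> L < \<infinity>"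
      using density sufficient rpf by blast
  next
    assume "0 \<in> point_spectrum (Jop n z)"
    then obtain i0 where i0: "z i0 = 0" using assms(2) by (metis imageE)
    have inj_z: "inj z" by (rule Carleson_inj[OF assms(4)])
    have mult: "algebraic_multiplicity (Jop n z) 0 = n i0"
      by (rule algebraic_multiplicity_zero[where n = n and z = z, OF n_pos inj_z i0])
    have x0: "x i = 0 \<longleftrightarrow> i = i0" for i using x(3)[of i] x(3)[of i0] i0 injD[OF inj_z, of i i0] by auto
    show "real_powers_frame n z g \<Lambda> \<longleftrightarrow>
        0 < L \<and> L < \<infinity> \<and> (\<forall>j<algebraic_multiplicity (Jop n z) 0. \<Lambda> j = real j)"
      unfolding mult
    proof
      assume frame: "real_powers_frame n z g \<Lambda>"
      have "\<Lambda> j = real j" if "j < n i0" for j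
      proof (rule frame_imp_initial_segment[OF assms(5) nonneg _ _ _ that])
        show "l2_frame (\<lambda>k. orbit (\<Lambda> k))" using frame rpf by blast
        show "Jblock_power_defined (n i0) (complex_of_real (x i0)) (\<Lambda> k)" for k
          using frame rpf x(3) by metis
        show "x i0 = 0" using x0 by simp
      qed
      then show "0 < L \<and> L < \<infinity> \<and> (\<forall>j<n i0. \<Lambda> j = real j)" using density[OF frame] by blast
    next
      assume *: "0 < L \<and> L < \<infinity> \<and> (\<forall>j<n i0. \<Lambda> j = real j)"
      have "Jblock_power_defined (n i) (z i) (\<Lambda> k)" for k i
      proof (cases "i = i0 \<and> n i0 \<le> k")
        case True
        have "\<Lambda> (n i0 - 1) < \<Lambda> k" 
          using conjunct2[OF True] n_pos[of i0] by (intro strict_monoD[OF assms(5)]) linarith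
        moreover have "\<Lambda> (n i0 - 1) = real (n i0) - 1" using * n_pos[of i0] by (simp add: of_nat_diff)
        ultimately show ?thesis using True by (simp add: Jblock_power_defined_def)
      next
        case False
        then show ?thesis using * x0[of i] x(3)[of i] by (auto simp: Jblock_power_defined_def not_le)
      qed
      moreover have "\<forall>i j. x i = 0 \<longrightarrow> j < n i \<longrightarrow> \<Lambda> j = real j" using * x0 by auto
      ultimately show "real_powers_frame n z g \<Lambda>" using rpf sufficient * by blast
    qed
  qed
qed

end
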